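(* Let $s\ge 2$. For each prime $p$ let $\mu_p$ be the Hilbert-Kunz multiplicity of $h=\sum_{i=1}^s x_i^2\in(\mathbb{Z}/p)[x_1,\ldots,x_s]$. Then, as $p\to\infty$ through the primes, $\mu_p$ converges to $1+{}$the coefficient of $z^{s-1}$ in the power series expansion (at $z=0$) of $\sec z+\tan z$.
   Context: For a prime $p$, let $A=(\mathbb{Z}/p)[x_1,\ldots,x_s]$ and $h=\sum_{i=1}^s x_i^{2}\in A$. For $n\ge 0$ and $q=p^n$, $e_n(h)$ is the colength (the length of the quotient of $A$) of the ideal $(h,x_1^q,\ldots,x_s^q)$. By Hilbert-Kunz theory there is a real $\mu>0$ (depending on $p$) with $e_n(h)=\mu q^{s-1}+O(q^{s-2})$ as $n\to\infty$ for fixed $p$; $\mu=\lim_{n\to\infty}e_n(h)/q^{s-1}$ is the Hilbert-Kunz multiplicity of $h$. *)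

theory Defs
  imports
    "HOL-Algebra.Indexed_Polynomials"
    "HOL-Algebra.Module"
    "HOL-Number_Theory.Residues"
    "HOL-Library.Extended_Nat"
    "HOL-Computational_Algebra.Formal_Power_Series"
begin

text \<open>
  The theory \<open>HOL-Algebra.Indexed_Polynomials\<close> represents a polynomial by its coefficient
  function on monomials, a monomial being a multiset of variables. It provides the carrier
  and the addition but not the product of two polynomials, which is the convolution below.
\<close>

definition mpoly_ring :: "('a, 'm) ring_scheme \<Rightarrow> 'c set \<Rightarrow> ('c multiset \<Rightarrow> 'a) ring"
  where "mpoly_ring R I =
    \<lparr> carrier = ring.indexed_pset R I (carrier R),
      monoid.mult = (\<lambda>P Q m. \<Oplus>\<^bsub>R\<^esub>k\<in>{k. k \<subseteq># m}. P k \<otimes>\<^bsub>R\<^esub> Q (m - k)),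
      one = ring.indexed_const R \<one>\<^bsub>R\<^esub>,
      zero = ring.indexed_const R \<zero>\<^bsub>R\<^esub>,
      add = ring.indexed_padd R \<rparr>"

definition quot_module :: "('a, 'm) ring_scheme \<Rightarrow> 'a set \<Rightarrow> ('a, 'a set) module"
  where "quot_module R I =
    \<lparr> carrier = carrier (R Quot I), monoid.mult = monoid.mult (R Quot I), one = one (R Quot I),
      zero = zero (R Quot I), add = add (R Quot I),
      smult = (\<lambda>a C. (I +>\<^bsub>R\<^esub> a) \<otimes>\<^bsub>R Quot I\<^esub> C) \<rparr>"

definition module_length :: "('a, 'm) ring_scheme \<Rightarrow> ('a, 'b, 'n) module_scheme \<Rightarrow> enat"
  where "module_length R M =
    Sup {enat n |n. \<exists>N :: nat \<Rightarrow> 'b set.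
      (\<forall>i\<le>n. submodule (N i) R M) \<and> (\<forall>i<n. N i \<subset> N (Suc i))}"

definition colength :: "('a, 'm) ring_scheme \<Rightarrow> 'a set \<Rightarrow> enat"
  where "colength R I = module_length R (quot_module R I)"

definition poly_Zp :: "nat \<Rightarrow> nat \<Rightarrow> (nat multiset \<Rightarrow> int) ring"
  where "poly_Zp p s = mpoly_ring (residue_ring (int p)) {1..s}"

abbreviation var_Zp :: "nat \<Rightarrow> nat \<Rightarrow> (nat multiset \<Rightarrow> int)"
  where "var_Zp p i \<equiv> ring.indexed_var (residue_ring (int p)) i"

definition sum_squares :: "nat \<Rightarrow> nat \<Rightarrow> (nat multiset \<Rightarrow> int)"
  where "sum_squares p s = (\<Oplus>\<^bsub>poly_Zp p s\<^esub>i\<in>{1..s}. var_Zp p i [^]\<^bsub>poly_Zp p s\<^esub> (2::nat))"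

definition hk_fun :: "nat \<Rightarrow> nat \<Rightarrow> (nat multiset \<Rightarrow> int) \<Rightarrow> nat \<Rightarrow> enat"
  where "hk_fun p s h n =
    colength (poly_Zp p s)
      (genideal (poly_Zp p s)
        (insert h ((\<lambda>i. var_Zp p i [^]\<^bsub>poly_Zp p s\<^esub> (p ^ n)) ` {1..s})))"

text \<open>
  The colength is finite, since the ideal contains a power of every variable; hence
  \<^const>\<open>the_enat\<close> loses no information. The limit exists by Hilbert-Kunz theory.
\<close>

definition hk_multiplicity :: "nat \<Rightarrow> nat \<Rightarrow> (nat multiset \<Rightarrow> int) \<Rightarrow> real"
  where "hk_multiplicity p s h =
    lim (\<lambda>n. real (the_enat (hk_fun p s h n)) / real (p ^ n) ^ (s - 1))"

definition sec_plus_tan :: "real fps"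
  where "sec_plus_tan = inverse (fps_cos 1) + fps_tan 1"

end

theory Submission
  imports Defs "HOL-Library.Function_Algebras" "HOL-Computational_Algebra.Polynomial"
begin

text \<open>
  Write \<open>k = \<int>/p\<close>, \<open>q = p ^ n\<close> and \<open>B = k[x\<^sub>1, ..., x\<^sub>s] / (x\<^sub>1^q, ..., x\<^sub>s^q)\<close>. The colength \<open>e\<^sub>n\<close> of
  \<open>(h, x\<^sub>1^q, ..., x\<^sub>s^q)\<close> is the dimension of \<open>B / hB\<close>, hence also the dimension of the kernel of
  multiplication by \<open>h\<close> on \<open>B\<close>. Reversing exponents turns this kernel into the space of functions
  \<open>F\<close> on the cube \<open>{0..<q}^s\<close>, extended by zero, with \<open>\<Sum>\<^sub>i F(u + 2 e\<^sub>i) = 0\<close>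
  (\<open>hk_fun_eq_square_ker_dim\<close>). Dimensions are measured as \<open>log p\<close> of cardinalities, so that counting
  replaces linear algebra throughout.

  The parity class of the exponents is preserved by the double shifts. Therefore \<open>e\<^sub>n\<close> is a sum of \<open>2^s\<close>
  numbers \<open>D(a\<^sub>1, ..., a\<^sub>s)\<close>, where \<open>D(a)\<close> is the nullity of the sum \<open>T\<close> of the \<open>s\<close> unit shifts on the
  box with sides \<open>a\<^sub>i\<close>, and for odd \<open>p\<close> every side is \<open>(q - 1)/2\<close> or \<open>(q + 1)/2\<close>. Three properties of \<open>D\<close>
  give the theorem.

  First, enlarging a side by one changes \<open>D\<close> by at most \<open>M^(s-2)\<close>, where \<open>M\<close> bounds the sides
  (\<open>ker_dim_lipschitz\<close>). Secondly, \<open>T^p\<close> is the sum of the \<open>p\<close>-fold shifts, and this yields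
  \<open>D(p a) = p^(s-1) D(a)\<close> (\<open>ker_dim_scale\<close>). These two together show that \<open>e\<^sub>n / q^(s-1)\<close> converges to a
  limit \<open>\<mu>\<close> which differs from \<open>2^s D(a, ..., a) / p^(s-1)\<close>, \<open>a = (p - 1)/2\<close>, by at most \<open>2^s s / p\<close>
  (\<open>square_ker_dim_limit\<close>). The comparison with the box of side \<open>(p - 1)/2\<close> is what allows \<open>p\<close> to tend
  to infinity.

  Thirdly, for \<open>b, c \<le> p\<close> the element \<open>y + z\<close> of \<open>k[y, z] / (y^b, z^c)\<close> is nilpotent with Jordan blocks
  of known sizes \<open>n\<^sub>r\<close>, \<open>r < min b c\<close>: they are \<open>b + c - 1 - 2r\<close>, except that the first \<open>b + c - p\<close> of
  them are equal to \<open>p\<close>. Hence two sides \<open>b, c\<close> can be merged,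
  \<open>D(..., b, c) = \<Sum>\<^sub>r D(..., n\<^sub>r)\<close> (\<open>kernel_card_fusion\<close>), and \<open>D(a, ..., a)\<close> becomes an iterated sum of
  elementary terms (\<open>block_count\<close>). Up to a relative error \<open>O(1/p)\<close> this sum is a Riemann sum for
  the recursion
  \<open>\<phi>\<^sub>n\<^sub>+\<^sub>1(x) = max 0 (x - 1/2) * \<phi>\<^sub>n(1) + (1/2) \<integral> \<phi>\<^sub>n\<close>, with the integral running from \<open>\<bar>x - 1/2\<bar>\<close> to
  \<open>1 - \<bar>x - 1/2\<bar>\<close>. Its solution is
  \<open>\<phi>\<^sub>n(x) = (x + Z\<^sub>n(\<bar>1 - 2x\<bar>) / 2) / 2^n\<close>, where the polynomials \<open>Z\<^sub>n\<close> satisfy \<open>Z\<^sub>n\<^sub>+\<^sub>1'(v) = - Z\<^sub>n(1 - v)\<close> and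
  \<open>Z\<^sub>n(1) = 0\<close> for \<open>n \<ge> 1\<close>; equivalently, they have the generating function
  \<open>(sec z + tan z) cos (vz) - sin (vz)\<close>. At \<open>x = 1/2\<close> and \<open>n = s - 1\<close> this gives
  \<open>2^s \<phi>\<^sub>n(1/2) = 1 + Z\<^sub>n(0)\<close>: the coefficient of \<open>sec z + tan z\<close> is \<open>Z\<^sub>n(0)\<close>, and the additional \<open>1\<close> comes from
  the linear term of \<open>\<phi>\<^sub>n\<close>.
\<close>

section \<open>Elementary abelian groups and additive operators\<close>

text \<open>
  The product of all rings \<open>\<int>/n\<close>. The prime varies within the theorem, and a type cannot depend on it;
  this single type contains a copy of every \<open>\<int>/p\<close>, namely the elements supported at the index \<open>p\<close>.
\<close>
quotient_type residues_prod = "nat \<Rightarrow> int" / "\<lambda>f g. \<forall>n. f n mod int n = g n mod int n"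
  by (rule equivpI) (auto simp: reflp_def symp_def transp_def)

instantiation residues_prod :: comm_ring_1
begin
lift_definition zero_residues_prod :: residues_prod is "\<lambda>_. 0" .
lift_definition one_residues_prod :: residues_prod is "\<lambda>_. 1" .
lift_definition plus_residues_prod :: "residues_prod \<Rightarrow> residues_prod \<Rightarrow> residues_prod"
  is "\<lambda>f g n. f n + g n" by (auto intro: mod_add_cong)
lift_definition minus_residues_prod :: "residues_prod \<Rightarrow> residues_prod \<Rightarrow> residues_prod"
  is "\<lambda>f g n. f n - g n" by (auto intro: mod_diff_cong)
lift_definition uminus_residues_prod :: "residues_prod \<Rightarrow> residues_prod"
  is "\<lambda>f n. - f n" by (auto intro: mod_minus_cong)
lift_definition times_residues_prod :: "residues_prod \<Rightarrow> residues_prod \<Rightarrow> residues_prod"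
  is "\<lambda>f g n. f n * g n" by (auto intro: mod_mult_cong)
instance
proof
  show "(0 :: residues_prod) \<noteq> 1"
    by transfer (auto intro!: exI[of _ 0])
qed (transfer; simp add: algebra_simps)+
end

lift_definition residue :: "nat \<Rightarrow> int \<Rightarrow> residues_prod" is "\<lambda>p c n. if n = p then c else 0" .

lemma residue_add: "residue p (a + b) = residue p a + residue p b"
  by transfer auto

lemma residue_uminus: "residue p (- a) = - residue p a"
  by transfer auto

lemma residue_0 [simp]: "residue p 0 = 0"
  by transfer auto

lemma residue_diff: "residue p (a - b) = residue p a - residue p b"
  using residue_add[of p a "- b"] by (simp add: residue_uminus)

lemma residue_eq_iff: "residue p a = residue p b \<longleftrightarrow> a mod int p = b mod int p"
  by transfer auto

lemma of_nat_times_residue: "of_nat n * residue p a = residue p (int n * a)"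
  by (induction n) (auto simp: algebra_simps residue_add)

lemma of_int_times_residue: "of_int c * residue p a = residue p (c * a)"
  by (cases c rule: int_cases2) (auto simp: of_nat_times_residue residue_uminus)

lemma residue_mod: "residue p (a mod int p) = residue p a"
  by (simp add: residue_eq_iff)

definition Zmod :: "nat \<Rightarrow> residues_prod set" where
  "Zmod p = range (residue p)"

lemma zero_mem_Zmod: "0 \<in> Zmod p"
  unfolding Zmod_def using residue_0[of p] by (metis rangeI)

lemma Zmod_bij: "p > 0 \<Longrightarrow> bij_betw (residue p) {0..<int p} (Zmod p)"
  unfolding bij_betw_def
proof
  assume p: "p > 0"
  show "inj_on (residue p) {0..<int p}"
    by (auto simp: inj_on_def residue_eq_iff)
  show "residue p ` {0..<int p} = Zmod p"
  proof (unfold Zmod_def, safe)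
    fix c show "residue p c \<in> residue p ` {0..<int p}"
      using p by (intro image_eqI[of _ _ "c mod int p"]) (auto simp: residue_eq_iff)
  qed auto
qed

lemma card_Zmod: "p > 0 \<Longrightarrow> card (Zmod p) = p"
  using bij_betw_same_card[OF Zmod_bij[of p]] by simp

text \<open>
  A finite abelian group killed by \<open>p\<close>, that is, a finite vector space over \<open>\<int>/p\<close>. Scalars act as integers
  through the ring structure of the ambient type, so function spaces, which are rings
  pointwise, are covered without defining a scalar multiplication.
\<close>
locale elementary_group =
  fixes p :: nat and W :: "'w :: ring_1 set"
  assumes prime_p: "Factorial_Ring.prime p"
    and finite_W: "finite W"
    and zero_mem: "0 \<in> W"
    and diff_mem: "\<And>x y. x \<in> W \<Longrightarrow> y \<in> W \<Longrightarrow> x - y \<in> W"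
    and torsion: "\<And>x. x \<in> W \<Longrightarrow> of_nat p * x = 0"
begin

lemma uminus_mem: "x \<in> W \<Longrightarrow> - x \<in> W"
  using diff_mem[OF zero_mem, of x] by simp

lemma add_mem: "x \<in> W \<Longrightarrow> y \<in> W \<Longrightarrow> x + y \<in> W"
  using diff_mem[OF _ uminus_mem, of x y] by simp

lemma sum_mem: "(\<And>i. i \<in> A \<Longrightarrow> f i \<in> W) \<Longrightarrow> sum f A \<in> W"
  by (induction A rule: infinite_finite_induct) (auto simp: zero_mem add_mem)

lemma of_nat_mem: "x \<in> W \<Longrightarrow> of_nat n * x \<in> W"
  by (induction n) (auto simp: zero_mem add_mem algebra_simps)

lemma of_int_mem: "x \<in> W \<Longrightarrow> of_int n * x \<in> W"
  by (cases n rule: int_cases2) (auto simp: of_nat_mem uminus_mem)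

lemma torsion_dvd:
  assumes "x \<in> W" "p dvd n"
  shows "of_nat n * x = 0"
proof -
  obtain k where "n = k * p" using assms(2) by (metis dvd_def mult.commute)
  thus ?thesis using torsion[OF assms(1)] by (simp add: mult.assoc)
qed

lemma coprime_cancel:
  assumes "x \<in> W" "coprime n p" "of_nat n * x = 0"
  shows "x = 0"
proof -
  obtain u v where uv: "u * int n + v * int p = 1"
    using bezout_int[of "int n" "int p"] assms(2) by (auto simp: coprime_iff_gcd_eq_1)
  have "x = of_int (u * int n + v * int p) * x"
    by (simp add: uv)
  also have "\<dots> = of_int u * (of_nat n * x) + of_int v * (of_nat p * x)"
    by (simp add: algebra_simps)
  finally show ?thesis using assms torsion by simp
qed

lemma card_pos: "card W > 0"
  using finite_W zero_mem by (auto simp: card_gt_0_iff)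

lemma kernel_group:
  assumes "additive f"
  shows "elementary_group p {w \<in> W. f w = 0}"
proof -
  interpret additive f by fact
  show ?thesis
    using prime_p finite_W zero_mem diff_mem torsion zero
    by unfold_locales (auto simp: diff)
qed

lemma card_eq_cosets_times_subgroup:
  assumes H: "H \<subseteq> W" and g: "\<And>x y. x \<in> W \<Longrightarrow> y \<in> W \<Longrightarrow> g x = g y \<longleftrightarrow> x - y \<in> H"
  shows "card W = card (g ` W) * card H"
proof -
  have "card {x \<in> W. g x = y} = card H" if "y \<in> g ` W" for y
  proof -
    from that obtain w where w: "w \<in> W" "y = g w" by auto
    have "bij_betw (\<lambda>x. x + w) H {x \<in> W. g x = y}"
      by (rule bij_betwI[of _ _ _ "\<lambda>x. x - w"]) (use w H in \<open>auto simp: g add_mem\<close>)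
    thus ?thesis by (simp add: bij_betw_same_card)
  qed
  hence "(\<Sum>y\<in>g ` W. card {x \<in> W. g x = y}) = card (g ` W) * card H" by simp
  thus ?thesis using sum.image_gen[OF finite_W, of "\<lambda>_. 1::nat" g] by simp
qed

text \<open>
  Rank and nullity, in multiplicative form.
\<close>
lemma card_eq_kernel_times_image:
  assumes "additive f"
  shows "card W = card {w \<in> W. f w = 0} * card (f ` W)"
proof -
  interpret additive f by fact
  have "f x = f y \<longleftrightarrow> x - y \<in> {w \<in> W. f w = 0}" if "x \<in> W" "y \<in> W" for x y
    using that diff_mem by (auto simp: diff)
  from card_eq_cosets_times_subgroup[OF _ this] show ?thesis by (simp add: mult.commute)
qed

end

lemma additive_funpow: "additive T \<Longrightarrow> additive ((T :: 'a \<Rightarrow> 'a :: ab_group_add) ^^ n)"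
  by (induction n) (auto simp: additive_def)

lemma additive_of_nat:
  assumes "additive (T :: 'a :: ring_1 \<Rightarrow> 'b :: ring_1)"
  shows "T (of_nat n * x) = of_nat n * T x"
proof -
  interpret additive T by fact
  show ?thesis by (induction n) (auto simp: zero add algebra_simps)
qed

lemma additive_of_int:
  assumes "additive (T :: 'a :: ring_1 \<Rightarrow> 'b :: ring_1)"
  shows "T (of_int n * x) = of_int n * T x"
proof -
  interpret additive T by fact
  show ?thesis
    by (cases n rule: int_cases2) (auto simp: additive_of_nat[OF assms] minus)
qed

lemma funpow_closed: "T ` W \<subseteq> W \<Longrightarrow> w \<in> W \<Longrightarrow> (T ^^ n) w \<in> W"
  by (induction n) auto

lemma of_int_fun_apply: "of_int n x = of_int n"
  by (cases n rule: int_cases2) (auto simp: fun_eq_iff)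

lemma sum_fun_apply: "sum f A x = (\<Sum>i\<in>A. f i x)"
  by (induction A rule: infinite_finite_induct) auto

text \<open>
  Functions are extended by zero outside \<open>A\<close>. A shift that leaves \<open>A\<close> then contributes zero, which is
  the dual form of the relation \<open>x^b = 0\<close>.
\<close>
definition fun_on :: "'a set \<Rightarrow> 'b :: zero set \<Rightarrow> ('a \<Rightarrow> 'b) set" where
  "fun_on A W = {f. (\<forall>x\<in>A. f x \<in> W) \<and> (\<forall>x. x \<notin> A \<longrightarrow> f x = 0)}"

lemma bij_betw_fun_on: "bij_betw (\<lambda>f. restrict f A) (fun_on A W) (PiE A (\<lambda>_. W))"
proof (rule bij_betwI[of _ _ _ "\<lambda>f x. if x \<in> A then f x else 0"])
  fix f :: "'a \<Rightarrow> 'b" assume "f \<in> fun_on A W"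
  thus "(\<lambda>x. if x \<in> A then restrict f A x else 0) = f" by (auto simp: fun_on_def)
next
  fix f :: "'a \<Rightarrow> 'b" assume "f \<in> PiE A (\<lambda>_. W)"
  thus "restrict (\<lambda>x. if x \<in> A then f x else 0) A = f"
    by (auto simp: PiE_def extensional_def restrict_def fun_eq_iff)
qed (auto simp: fun_on_def)

lemma card_fun_on: "finite A \<Longrightarrow> card (fun_on A W) = card W ^ card A"
  using bij_betw_same_card[OF bij_betw_fun_on[of A W]] by (simp add: card_PiE)

lemma finite_fun_on: "finite A \<Longrightarrow> finite W \<Longrightarrow> finite (fun_on A W)"
  using bij_betw_finite[OF bij_betw_fun_on[of A W]] by (auto intro: finite_PiE)

lemma fun_on_mem: "0 \<in> W \<Longrightarrow> f \<in> fun_on A W \<Longrightarrow> f x \<in> W"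
  by (cases "x \<in> A") (auto simp: fun_on_def)

lemma (in elementary_group) fun_on_group:
  assumes "finite (A :: 'a set)"
  shows "elementary_group p (fun_on A W)"
proof
  fix f :: "'a \<Rightarrow> 'w" assume "f \<in> fun_on A W"
  thus "of_nat p * f = 0"
    by (intro ext) (simp add: torsion[OF fun_on_mem[OF zero_mem]])
qed (use assms prime_p finite_W zero_mem diff_mem in \<open>simp_all add: finite_fun_on, simp_all add: fun_on_def\<close>)

lemma elementary_group_Zmod:
  assumes "Factorial_Ring.prime p"
  shows "elementary_group p (Zmod p)"
proof
  have p: "p > 0" using assms prime_gt_0_nat by auto
  show "finite (Zmod p)"
    using bij_betw_finite[OF Zmod_bij[OF p]] by simp
  show "0 \<in> Zmod p" by (rule zero_mem_Zmod)
  show "x - y \<in> Zmod p" if "x \<in> Zmod p" "y \<in> Zmod p" for x y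
    using that unfolding Zmod_def by (auto simp flip: residue_diff)
  show "of_nat p * x = 0" if "x \<in> Zmod p" for x
  proof -
    obtain a where "x = residue p a" using \<open>x \<in> Zmod p\<close> by (auto simp: Zmod_def)
    moreover have "residue p (int p * a) = residue p 0"
      by (subst residue_eq_iff) simp
    ultimately show ?thesis by (simp add: of_nat_times_residue)
  qed
qed (fact assms)

lemma funpow_sum_commuting:
  fixes A B :: "'w :: ring_1 \<Rightarrow> 'w"
  assumes A: "additive A" and B: "additive B" and AB: "\<And>x. A (B x) = B (A x)"
  shows "((\<lambda>x. A x + B x) ^^ n) x = (\<Sum>k\<le>n. of_nat (n choose k) * (A ^^ k) ((B ^^ (n - k)) x))"
proof (induction n)
  case (Suc n)
  interpret A: additive A by fact
  interpret B: additive B by fact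
  define t where "t k j = (A ^^ k) ((B ^^ j) x)" for k j
  have tA: "A (t k j) = t (Suc k) j" for k j by (simp add: t_def)
  have tB: "B (t k j) = t k (Suc j)" for k j
    unfolding t_def by (induction k) (simp_all flip: AB)
  have "((\<lambda>x. A x + B x) ^^ Suc n) x =
      (\<Sum>k\<le>n. of_nat (n choose k) * t (Suc k) (n - k)) + (\<Sum>k\<le>n. of_nat (n choose k) * t k (Suc (n - k)))"
    by (simp add: Suc A.sum B.sum additive_of_nat A B flip: t_def) (simp add: tA tB)
  also have "(\<Sum>k\<le>n. of_nat (n choose k) * t k (Suc (n - k))) =
     (\<Sum>k\<le>Suc n. of_nat (n choose k) * t k (Suc n - k))"
    by (simp add: Suc_diff_le binomial_eq_0)
  also have "\<dots> = t 0 (Suc n) + (\<Sum>k\<le>n. of_nat (n choose Suc k) * t (Suc k) (n - k))"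
    by (subst sum.atMost_Suc_shift) simp
  also have "(\<Sum>k\<le>n. of_nat (n choose k) * t (Suc k) (n - k)) + \<dots> =
     t 0 (Suc n) + (\<Sum>k\<le>n. of_nat (Suc n choose Suc k) * t (Suc k) (n - k))"
    by (simp add: sum.distrib algebra_simps)
  also have "\<dots> = (\<Sum>k\<le>Suc n. of_nat (Suc n choose k) * t k (Suc n - k))"
    by (subst sum.atMost_Suc_shift) simp
  finally show ?case by (simp add: t_def)
qed simp

lemma (in elementary_group) freshmans_dream:
  assumes A: "additive A" "A ` W \<subseteq> W" and B: "additive B" "B ` W \<subseteq> W"
    and AB: "\<And>x. A (B x) = B (A x)" and x: "x \<in> W"
  shows "((\<lambda>x. A x + B x) ^^ p) x = (A ^^ p) x + (B ^^ p) x"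
proof -
  have p: "p > 0" using prime_p prime_gt_0_nat by auto
  define t where "t k = of_nat (p choose k) * (A ^^ k) ((B ^^ (p - k)) x)" for k
  have "t k = 0" if "k \<in> {..p} - {0, p}" for k
    unfolding t_def using that prime_p
    by (intro torsion_dvd funpow_closed A B x dvd_choose_prime) auto
  hence "(\<Sum>k\<le>p. t k) = (\<Sum>k\<in>{0,p}. t k)"
    by (intro sum.mono_neutral_right) auto
  also have "\<dots> = (A ^^ p) x + (B ^^ p) x"
    using p by (simp add: t_def add.commute)
  finally show ?thesis
    unfolding t_def by (subst funpow_sum_commuting[OF A(1) B(1)]) (simp_all add: AB)
qed

text \<open>
  The operator \<open>T \<otimes> 1 + 1 \<otimes> S\<close> on sequences, with \<open>S\<close> the unit shift.
\<close>
definition shift_add :: "('w :: ring_1 \<Rightarrow> 'w) \<Rightarrow> (nat \<Rightarrow> 'w) \<Rightarrow> (nat \<Rightarrow> 'w)" where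
  "shift_add T f = (\<lambda>n. T (f n) + f (Suc n))"

lemma additive_shift_add: "additive T \<Longrightarrow> additive (shift_add T)"
  unfolding additive_def shift_add_def by (simp add: fun_eq_iff algebra_simps)

lemma (in elementary_group) shift_add_closed:
  assumes "additive T" "T ` W \<subseteq> W"
  shows "shift_add T ` fun_on {..<b} W \<subseteq> fun_on {..<b} W"
proof -
  interpret additive T by fact
  show ?thesis
  proof (rule image_subsetI)
    fix f assume f: "f \<in> fun_on {..<b} W"
    have "T (f n) + f (Suc n) \<in> W" for n
      using assms(2) fun_on_mem[OF zero_mem f] by (intro add_mem) auto
    moreover have "T (f n) + f (Suc n) = 0" if "n \<ge> b" for n
      using f that by (simp add: fun_on_def zero)
    ultimately show "shift_add T f \<in> fun_on {..<b} W"
      by (simp add: fun_on_def shift_add_def)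
  qed
qed

text \<open>
  The equation \<open>T (f n) + f (n + 1) = 0\<close> forces \<open>f n = (-T)^n (f 0)\<close>, and the sequence fits into length
  \<open>b\<close> exactly if \<open>T^b\<close> kills \<open>f 0\<close>. In this way a variable is traded for a power of the operator formed
  by the others, and conversely.
\<close>
lemma (in elementary_group) card_kernel_shift_add:
  assumes T: "additive T" "T ` W \<subseteq> W"
  shows "card {f \<in> fun_on {..<b} W. shift_add T f = 0} = card {w \<in> W. (T ^^ b) w = 0}"
proof (rule bij_betw_same_card)
  interpret additive T by fact
  define U where "U x = - T x" for x
  have sgn: "(U ^^ n) w = (T ^^ n) w \<or> (U ^^ n) w = - (T ^^ n) w" for n w
    by (induction n) (auto simp: U_def minus)
  have U0: "(U ^^ n) 0 = 0" for n
    by (induction n) (auto simp: U_def zero)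
  have UW: "U ` W \<subseteq> W" using T uminus_mem by (auto simp: U_def)
  have iter: "f n = (U ^^ n) (f 0)" if "shift_add T f = 0" for f n
  proof (induction n)
    case (Suc n)
    have "T (f n) + f (Suc n) = 0"
      using that by (auto simp: shift_add_def fun_eq_iff)
    thus ?case using Suc by (simp add: U_def eq_neg_iff_add_eq_0 add.commute)
  qed simp
  show "bij_betw (\<lambda>f. f 0) {f \<in> fun_on {..<b} W. shift_add T f = 0} {w \<in> W. (T ^^ b) w = 0}"
  proof (rule bij_betwI[of _ _ _ "\<lambda>w n. (U ^^ n) w"])
    show "(\<lambda>f. f 0) \<in> {f \<in> fun_on {..<b} W. shift_add T f = 0} \<rightarrow> {w \<in> W. (T ^^ b) w = 0}"
    proof safe
      fix f assume f: "f \<in> fun_on {..<b} W" "shift_add T f = 0"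
      show "f 0 \<in> W" by (rule fun_on_mem[OF zero_mem f(1)])
      have "f b = 0" using f by (auto simp: fun_on_def)
      thus "(T ^^ b) (f 0) = 0" using iter[OF f(2), of b] sgn[of b "f 0"] by auto
    qed
    show "(\<lambda>w n. (U ^^ n) w) \<in> {w \<in> W. (T ^^ b) w = 0} \<rightarrow> {f \<in> fun_on {..<b} W. shift_add T f = 0}"
    proof safe
      fix w assume w: "w \<in> W" "(T ^^ b) w = 0"
      have "(U ^^ b) w = 0" using sgn[of b w] w by auto
      hence "(U ^^ n) w = 0" if "n \<ge> b" for n
        using that U0[of "n - b"] funpow_add[of "n - b" b U] by simp
      thus "(\<lambda>n. (U ^^ n) w) \<in> fun_on {..<b} W"
        using funpow_closed[OF UW w(1)] by (auto simp: fun_on_def)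
      show "shift_add T (\<lambda>n. (U ^^ n) w) = 0"
        by (auto simp: shift_add_def fun_eq_iff U_def)
    qed
    show "(\<lambda>n. (U ^^ n) (f 0)) = f" if "f \<in> {f \<in> fun_on {..<b} W. shift_add T f = 0}" for f
    proof
      fix n show "(U ^^ n) (f 0) = f n"
        using iter[of f n] that by (metis (mono_tags, lifting) mem_Collect_eq)
    qed
  qed simp
qed

text \<open>
  \<open>T^k\<close> maps the kernel of \<open>T^(k+1)\<close> into the kernel of \<open>T\<close>, with kernel that of \<open>T^k\<close>.
\<close>
lemma (in elementary_group) card_kernel_funpow_Suc_le:
  assumes T: "additive T" "T ` W \<subseteq> W"
  shows "card {w \<in> W. (T ^^ Suc k) w = 0} \<le> card {w \<in> W. (T ^^ k) w = 0} * card {w \<in> W. T w = 0}"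
proof -
  interpret T: additive T by fact
  have aT: "additive (T ^^ n)" for n by (rule additive_funpow[OF T(1)])
  interpret K: elementary_group p "{w \<in> W. (T ^^ Suc k) w = 0}"
    by (rule kernel_group[OF aT])
  have "(T ^^ k) w = 0 \<Longrightarrow> (T ^^ Suc k) w = 0" for w by (simp add: T.zero)
  hence "{w \<in> {w \<in> W. (T ^^ Suc k) w = 0}. (T ^^ k) w = 0} = {w \<in> W. (T ^^ k) w = 0}" by auto
  hence "card {w \<in> W. (T ^^ Suc k) w = 0} =
     card {w \<in> W. (T ^^ k) w = 0} * card ((T ^^ k) ` {w \<in> W. (T ^^ Suc k) w = 0})"
    using K.card_eq_kernel_times_image[OF aT[of k]] by simp
  also have "\<dots> \<le> card {w \<in> W. (T ^^ k) w = 0} * card {w \<in> W. T w = 0}"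
    using finite_W funpow_closed[OF T(2)]
    by (intro mult_left_mono card_mono) auto
  finally show ?thesis .
qed

section \<open>Binomial identities and block sizes\<close>

text \<open>
  The sum is an \<open>n\<close>-th finite difference, and each difference lowers the degree.
\<close>
lemma alternating_binomial_sum_poly:
  fixes P :: "rat poly"
  assumes "Polynomial.degree P < n"
  shows "(\<Sum>k\<le>n. (-1) ^ k * of_nat (n choose k) * poly P (of_nat k)) = 0"
  using assms
proof (induction n arbitrary: P)
  case (Suc n)
  define Q where "Q = P - pcompose P [:1, 1:]"
  have deg: "Polynomial.degree (pcompose P [:1, 1:]) = Polynomial.degree P"
    by (simp add: degree_pcompose)
  have lc: "Polynomial.lead_coeff (pcompose P [:1, 1:]) = Polynomial.lead_coeff P"
    by (subst lead_coeff_comp) auto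
  have "Polynomial.degree Q < n \<or> Q = 0"
  proof (cases "Polynomial.degree P = 0")
    case True
    then obtain a where "P = [:a:]" by (metis degree_eq_zeroE)
    thus ?thesis by (simp add: Q_def)
  next
    case False
    have "Polynomial.degree Q < Polynomial.degree P"
    proof (rule ccontr)
      assume "\<not> Polynomial.degree Q < Polynomial.degree P"
      moreover have "Polynomial.degree Q \<le> Polynomial.degree P"
        unfolding Q_def by (rule degree_diff_le) (auto simp: deg)
      ultimately have "Polynomial.degree Q = Polynomial.degree P" by simp
      moreover have "Polynomial.coeff Q (Polynomial.degree P) = 0"
        using lc deg by (simp add: Q_def)
      ultimately have "Q = 0" by (metis leading_coeff_0_iff)
      thus False using \<open>Polynomial.degree Q = Polynomial.degree P\<close> False by simp
    qed
    thus ?thesis using Suc.prems by simp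
  qed
  hence Q: "(\<Sum>k\<le>n. (-1) ^ k * of_nat (n choose k) * poly Q (of_nat k)) = 0"
    using Suc.IH by auto
  define f where "f k = (-1) ^ k * poly P (of_nat k)" for k
  have "(\<Sum>k\<le>Suc n. of_nat (Suc n choose k) * f k) =
      f 0 + (\<Sum>k\<le>n. of_nat (Suc n choose Suc k) * f (Suc k))"
    by (subst sum.atMost_Suc_shift) simp
  also have "\<dots> = (f 0 + (\<Sum>k\<le>n. of_nat (n choose Suc k) * f (Suc k))) + (\<Sum>k\<le>n. of_nat (n choose k) * f (Suc k))"
    by (simp add: sum.distrib algebra_simps)
  also have "f 0 + (\<Sum>k\<le>n. of_nat (n choose Suc k) * f (Suc k)) = (\<Sum>k\<le>Suc n. of_nat (n choose k) * f k)"
    by (subst sum.atMost_Suc_shift) simp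
  also have "\<dots> = (\<Sum>k\<le>n. of_nat (n choose k) * f k)"
    by (simp add: binomial_eq_0)
  also have "\<dots> + (\<Sum>k\<le>n. of_nat (n choose k) * f (Suc k)) =
      (\<Sum>k\<le>n. (-1) ^ k * of_nat (n choose k) * poly Q (of_nat k))"
    unfolding sum.distrib[symmetric]
    by (intro sum.cong) (auto simp: f_def Q_def poly_pcompose algebra_simps)
  finally show ?case using Q by (simp add: f_def algebra_simps)
qed simp

lemma prod_add_eq_binomial:
  "(\<Prod>l\<in>{1..a}. of_nat x + of_nat l :: rat) = fact a * of_nat ((x + a) choose a)"
proof -
  have "fact x * (\<Prod>l\<in>{1..a}. of_nat x + of_nat l :: rat) = fact (x + a)"
  proof (induction a)
    case (Suc a)
    have "fact x * (\<Prod>l\<in>{1..Suc a}. of_nat x + of_nat l :: rat) =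
        (fact x * (\<Prod>l\<in>{1..a}. of_nat x + of_nat l)) * of_nat (x + Suc a)"
      by simp
    also have "\<dots> = fact (x + Suc a)" by (simp only: Suc) simp
    finally show ?case .
  qed simp
  also have "\<dots> = fact x * (fact a * of_nat ((x + a) choose a))"
  proof -
    have "of_nat (fact a * fact x * ((x + a) choose a)) = (of_nat (fact (x + a)) :: rat)"
      using binomial_fact_lemma[of a "x + a"] by simp
    thus ?thesis by (simp add: mult_ac)
  qed
  finally show ?thesis by simp
qed

text \<open>
  The left side is the coefficient of \<open>y^(\<alpha>+t)\<close> in the product of \<open>(y + z)^(\<alpha>+\<beta>+1)\<close> with the
  polynomial \<open>\<Sum>\<^sub>u (-1)^u ((\<alpha>+r-u) choose (r-u)) ((\<beta>+u) choose u) y^u z^(r-u)\<close>. The substitution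
  \<open>k = \<alpha> + t - u\<close> turns it into a difference of order \<open>\<alpha> + \<beta> + 1\<close> of a polynomial of degree
  \<open>\<alpha> + \<beta>\<close> in \<open>k\<close>, which vanishes.
\<close>
lemma generator_orthogonality:
  assumes t: "1 \<le> t" "t \<le> r"
  shows "(\<Sum>u\<le>r. if u \<le> \<alpha> + t then (-1) ^ u * int ((\<alpha> + (r - u)) choose (r - u)) *
           int ((\<beta> + u) choose u) * int ((\<alpha> + \<beta> + 1) choose (\<alpha> + t - u)) else 0) = 0"
    (is "?S = 0")
proof -
  define m n where "m = \<alpha> + t" and "n = \<alpha> + \<beta> + 1"
  define P :: "rat poly" where
    "P = (\<Prod>l\<in>{1..\<alpha>}. [:of_nat r - of_nat m + of_nat l, 1:]) * (\<Prod>l\<in>{1..\<beta>}. [:of_nat m + of_nat l, - 1:])"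
  have "Polynomial.degree P \<le> \<alpha> + \<beta>"
  proof -
    have "Polynomial.degree P \<le> (\<Sum>l\<in>{1..\<alpha>}. Polynomial.degree [:of_nat r - of_nat m + of_nat l :: rat, 1:]) +
                     (\<Sum>l\<in>{1..\<beta>}. Polynomial.degree [:of_nat m + of_nat l :: rat, - 1:])"
      unfolding P_def
      by (intro order.trans[OF degree_mult_le] add_mono order.trans[OF degree_prod_sum_le]) simp_all
    also have "\<dots> = \<alpha> + \<beta>" by simp
    finally show ?thesis .
  qed
  hence "Polynomial.degree P < n" by (simp add: n_def)
  hence zero: "(\<Sum>k\<le>n. (-1) ^ k * of_nat (n choose k) * poly P (of_nat k)) = 0"
    by (rule alternating_binomial_sum_poly)
  have eval: "poly P (of_nat k) = (\<Prod>l\<in>{1..\<alpha>}. of_nat r - of_nat m + of_nat l + of_nat k) *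
      (\<Prod>l\<in>{1..\<beta>}. of_nat m + of_nat l - of_nat k)" for k
    by (simp add: P_def poly_prod)
  \<comment> \<open>The product of the two binomial coefficients is polynomial in \<open>k\<close>, and its zeros are the
    indices that do not come from any \<open>u \<le> r\<close>.\<close>
  have vanish: "poly P (of_nat k) = 0" if "k \<le> n" "\<not> (k \<le> m \<and> m - k \<le> r)" for k
  proof (cases "k \<le> m")
    case True
    hence "m - k - r \<in> {1..\<alpha>}" "of_nat r - of_nat m + of_nat (m - k - r) + of_nat k = (0 :: rat)"
      using that t by (auto simp: m_def of_nat_diff)
    thus ?thesis unfolding eval by (auto intro!: prod_zero)
  next
    case False
    hence "k - m \<in> {1..\<beta>}" "of_nat m + of_nat (k - m) - of_nat k = (0 :: rat)"
      using that t by (auto simp: m_def n_def of_nat_diff)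
    thus ?thesis unfolding eval by (auto intro!: prod_zero)
  qed
  have val: "poly P (of_nat (m - u)) = fact \<alpha> * fact \<beta> *
      (of_nat ((\<alpha> + (r - u)) choose (r - u)) * of_nat ((\<beta> + u) choose u))" if "u \<le> r" "u \<le> m" for u
  proof -
    have "poly P (of_nat (m - u)) =
      (\<Prod>l\<in>{1..\<alpha>}. of_nat (r - u) + of_nat l) * (\<Prod>l\<in>{1..\<beta>}. of_nat u + of_nat l)"
      unfolding eval using that by (intro arg_cong2[of _ _ _ _ "(*)"] prod.cong) (auto simp: of_nat_diff)
    also have "\<dots> = fact \<alpha> * of_nat ((r - u + \<alpha>) choose \<alpha>) * (fact \<beta> * of_nat ((u + \<beta>) choose \<beta>))"
      by (simp only: prod_add_eq_binomial)
    also have "(r - u + \<alpha>) choose \<alpha> = (\<alpha> + (r - u)) choose (r - u)"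
      by (subst binomial_symmetric) (auto simp: add.commute)
    also have "(u + \<beta>) choose \<beta> = (\<beta> + u) choose u"
      by (subst binomial_symmetric) (auto simp: add.commute)
    finally show ?thesis by simp
  qed
  define h where "h k = (-1) ^ k * of_nat (n choose k) * poly P (of_nat k)" for k
  define U where "U = {u. u \<le> r \<and> u \<le> m}"
  have "0 = (\<Sum>k\<in>{k. k \<le> n \<and> k \<le> m \<and> m - k \<le> r}. h k)"
    unfolding zero[symmetric] h_def by (rule sum.mono_neutral_right) (auto simp: vanish)
  also have "\<dots> = (\<Sum>u\<in>{u\<in>U. m - u \<le> n}. h (m - u))"
    by (rule sum.reindex_bij_witness[of _ "\<lambda>u. m - u" "\<lambda>k. m - k"]) (auto simp: U_def)
  also have "\<dots> = (\<Sum>u\<in>U. h (m - u))"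
    by (rule sum.mono_neutral_left) (auto simp: U_def h_def binomial_eq_0 not_le)
  also have "\<dots> = (\<Sum>u\<in>U. (-1) ^ m * fact \<alpha> * fact \<beta> * ((-1) ^ u * of_nat ((\<alpha> + (r - u)) choose (r - u)) *
           of_nat ((\<beta> + u) choose u) * of_nat (n choose (m - u))))"
  proof (intro sum.cong refl)
    fix u assume u: "u \<in> U"
    have "(-1) ^ (m - u) = ((-1) ^ m * (-1) ^ u :: rat)"
      using u by (auto simp: U_def minus_one_power_iff)
    thus "h (m - u) = (-1) ^ m * fact \<alpha> * fact \<beta> * ((-1) ^ u * of_nat ((\<alpha> + (r - u)) choose (r - u)) *
           of_nat ((\<beta> + u) choose u) * of_nat (n choose (m - u)))"
      using u val[of u] by (simp add: h_def U_def)
  qed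
  also have "\<dots> = (-1) ^ m * fact \<alpha> * fact \<beta> * (\<Sum>u\<in>U. (-1) ^ u * of_nat ((\<alpha> + (r - u)) choose (r - u)) *
           of_nat ((\<beta> + u) choose u) * of_nat (n choose (m - u)))"
    by (simp add: sum_distrib_left)
  also have "(\<Sum>u\<in>U. (-1) ^ u * of_nat ((\<alpha> + (r - u)) choose (r - u)) *
           of_nat ((\<beta> + u) choose u) * of_nat (n choose (m - u))) = (of_int ?S :: rat)"
    unfolding of_int_sum U_def
    by (rule sum.mono_neutral_cong_left) (auto simp: m_def n_def)
  finally have "(-1) ^ m * fact \<alpha> * fact \<beta> * of_int ?S = (0 :: rat)"
    by (rule sym)
  moreover have "(-1) ^ m * fact \<alpha> * fact \<beta> \<noteq> (0 :: rat)" by simp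
  ultimately have "of_int ?S = (0 :: rat)" by (subst (asm) mult_eq_0_iff) blast
  thus ?thesis by (simp only: of_int_eq_0_iff)
qed

text \<open>
  Vandermonde's convolution with negative upper indices.
\<close>
lemma generator_value:
  "(\<Sum>u\<le>r. ((\<alpha> + (r - u)) choose (r - u)) * ((\<beta> + u) choose u)) = (\<alpha> + \<beta> + 1 + r) choose r"
proof -
  have neg: "(- of_nat (Suc a) :: rat) gchoose k = (-1) ^ k * of_nat ((a + k) choose k)" for a k
  proof -
    have "of_nat (Suc a) + of_nat k - 1 = (of_nat (a + k) :: rat)" by simp
    thus ?thesis by (subst gbinomial_minus) (simp only: binomial_gbinomial)
  qed
  have sgn: "(-1) ^ u * (-1) ^ (r - u) = ((-1) ^ r :: rat)" if "u \<le> r" for u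
    using that by (simp flip: power_add)
  have "(-1) ^ r * of_nat ((\<alpha> + \<beta> + 1 + r) choose r) = (- of_nat (Suc (\<alpha> + \<beta> + 1)) :: rat) gchoose r"
    by (simp only: neg)
  also have "- of_nat (Suc (\<alpha> + \<beta> + 1)) = (- of_nat (Suc \<beta>) + - of_nat (Suc \<alpha>) :: rat)" by simp
  also have "(\<dots> gchoose r) = (\<Sum>u\<le>r. (- of_nat (Suc \<beta>) gchoose u) * (- of_nat (Suc \<alpha>) gchoose (r - u)))"
    using gbinomial_Vandermonde[of "- of_nat (Suc \<beta>) :: rat" "- of_nat (Suc \<alpha>)" r]
    by (simp only: atMost_atLeast0)
  also have "\<dots> = (\<Sum>u\<le>r. (-1) ^ r * (of_nat ((\<alpha> + (r - u)) choose (r - u)) * of_nat ((\<beta> + u) choose u)))"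
  proof (intro sum.cong refl)
    fix u assume "u \<in> {..r}"
    thus "(- of_nat (Suc \<beta>) gchoose u) * (- of_nat (Suc \<alpha>) gchoose (r - u)) =
        ((-1) ^ r * (of_nat ((\<alpha> + (r - u)) choose (r - u)) * of_nat ((\<beta> + u) choose u)) :: rat)"
      using sgn[of u] unfolding neg by (simp only: mult_ac) simp
  qed
  also have "\<dots> = (-1) ^ r * of_nat (\<Sum>u\<le>r. ((\<alpha> + (r - u)) choose (r - u)) * ((\<beta> + u) choose u))"
    by (simp add: sum_distrib_left)
  finally have "(of_nat ((\<alpha> + \<beta> + 1 + r) choose r) :: rat) =
      of_nat (\<Sum>u\<le>r. ((\<alpha> + (r - u)) choose (r - u)) * ((\<beta> + u) choose u))"
    by simp
  thus ?thesis by (simp only: of_nat_eq_iff)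
qed

lemma coprime_binomial_prime:
  assumes "Factorial_Ring.prime (p :: nat)" "n < p" "k \<le> n"
  shows "coprime (n choose k) p"
proof -
  have "(n choose k) dvd fact n"
    using binomial_fact_lemma[OF assms(3)] by (metis dvd_triv_right)
  moreover have "\<not> p dvd fact n" using assms prime_dvd_fact_iff[of p n] by auto
  ultimately have "\<not> p dvd (n choose k)" using dvd_trans by blast
  thus ?thesis using assms(1) prime_imp_coprime coprime_commute by blast
qed

text \<open>
  The sizes of the Jordan blocks of \<open>y + z\<close> on \<open>k[y, z] / (y^b, z^c)\<close> for \<open>b, c \<le> p\<close>. As in
  characteristic zero, the \<open>r\<close>-th block is generated in degree \<open>r\<close> and would have length \<open>b + c - 1 - 2r\<close>;
  when \<open>b + c > p\<close> the relation \<open>(y + z)^p = 0\<close> makes the first \<open>b + c - p\<close> blocks all of length \<open>p\<close>.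
\<close>
definition block :: "nat \<Rightarrow> nat \<Rightarrow> nat \<Rightarrow> nat \<Rightarrow> nat" where
  "block p b c r = (if r < b + c - p then p else b + c - 1 - 2 * r)"

text \<open>
  Replacing the first \<open>b + c - p\<close> lengths by \<open>p\<close> preserves their sum, since these lengths are symmetric
  about \<open>p\<close>.
\<close>
lemma sum_block:
  assumes "b \<le> p" "c \<le> p"
  shows "(\<Sum>r<min b c. block p b c r) = b * c"
proof -
  have *: "(\<Sum>r<n. b + c - 1 - 2 * r) = n * (b + c - n)" if "n \<le> b" "n \<le> c" for n
    using that
  proof (induction n)
    case (Suc n)
    then obtain e where e: "b + c = 2 * n + 2 + e"
      using le_Suc_ex[of "2 * n + 2" "b + c"] by auto
    show ?case using Suc unfolding e by (simp add: algebra_simps)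
  qed simp
  define d where "d = b + c - p"
  have d: "d \<le> b" "d \<le> c" using assms by (auto simp: d_def)
  have "(\<Sum>r<min b c. block p b c r) + (\<Sum>r<d. b + c - 1 - 2 * r) =
     (\<Sum>r<d. p) + (\<Sum>r<min b c. b + c - 1 - 2 * r)"
  proof -
    have *: "{..<min b c} = {..<d} \<union> {d..<min b c}" using d by auto
    have "(\<Sum>r<min b c. f r) = (\<Sum>r<d. f r) + (\<Sum>r\<in>{d..<min b c}. f r)" for f :: "nat \<Rightarrow> nat"
      unfolding * by (rule sum.union_disjoint) auto
    moreover have "(\<Sum>r<d. block p b c r) = (\<Sum>r<d. p)"
      by (intro sum.cong) (auto simp: block_def d_def)
    moreover have "(\<Sum>r\<in>{d..<min b c}. block p b c r) = (\<Sum>r\<in>{d..<min b c}. b + c - 1 - 2 * r)"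
      by (intro sum.cong) (auto simp: block_def d_def)
    ultimately show ?thesis by simp
  qed
  moreover have "(\<Sum>r<d. b + c - 1 - 2 * r) = (\<Sum>r<d. p)"
    unfolding *[OF d] by (auto simp: d_def)
  moreover have "(\<Sum>r<min b c. b + c - 1 - 2 * r) = b * c"
    by (subst *) (auto simp: min_def)
  ultimately show ?thesis by simp
qed

section \<open>Merging two truncated variables\<close>

text \<open>
  A function \<open>g\<close> on \<open>{..<b} \<times> {..<c}\<close> is regarded as the linear form on \<open>k[y, z] / (y^b, z^c)\<close> with value
  \<open>g n m\<close> at \<open>y^n z^m\<close>. The operator is then the transpose of multiplication by \<open>y + z\<close>.
\<close>
definition diag_shift :: "(nat \<Rightarrow> nat \<Rightarrow> 'w :: ring_1) \<Rightarrow> nat \<Rightarrow> nat \<Rightarrow> 'w" where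
  "diag_shift g = (\<lambda>n m. g (Suc n) m + g n (Suc m))"

lemma diag_shift_funpow_add:
  "(diag_shift ^^ k) (g + h) = (diag_shift ^^ k) g + (diag_shift ^^ k) h"
  by (induction k) (auto simp: diag_shift_def fun_eq_iff)

lemma diag_shift_funpow_apply:
  "(diag_shift ^^ k) g n m = (\<Sum>j\<le>k. of_nat (k choose j) * g (n + j) (m + (k - j)))"
proof -
  define A B :: "(nat \<Rightarrow> nat \<Rightarrow> 'a) \<Rightarrow> nat \<Rightarrow> nat \<Rightarrow> 'a"
    where "A g = (\<lambda>n. g (Suc n))" and "B g = (\<lambda>n m. g n (Suc m))" for g
  have add: "additive A" "additive B"
    by (auto simp: additive_def A_def B_def fun_eq_iff)
  have A: "(A ^^ j) h = (\<lambda>n. h (n + j))" for j h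
    by (induction j) (auto simp: A_def)
  have B: "(B ^^ j) h = (\<lambda>n m. h n (m + j))" for j h
    by (induction j) (auto simp: B_def)
  have "diag_shift = (\<lambda>g. A g + B g)"
    by (auto simp: diag_shift_def A_def B_def fun_eq_iff)
  moreover have "A (B h) = B (A h)" for h by (simp add: A_def B_def)
  ultimately have "(diag_shift ^^ k) g = (\<Sum>j\<le>k. of_nat (k choose j) * (A ^^ j) ((B ^^ (k - j)) g))"
    using funpow_sum_commuting[OF add, of k g] by simp
  thus ?thesis by (simp add: sum_fun_apply A B)
qed

text \<open>
  The coefficient at \<open>y^u z^(r-u)\<close> of the generator of the \<open>r\<close>-th block, in the case
  \<open>r \<ge> b + c - p\<close>: the solution, unique up to a factor in characteristic zero, of the equation
  \<open>(y + z)^(b+c-1-2r) v = 0\<close> in degree \<open>r\<close>.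
\<close>
definition gen_coeff :: "nat \<Rightarrow> nat \<Rightarrow> nat \<Rightarrow> nat \<Rightarrow> int" where
  "gen_coeff b c r u = (-1) ^ u * int ((b - 1 - u) choose (r - u)) * int ((c - 1 - r + u) choose u)"

text \<open>
  The value of the linear form \<open>g\<close> at the generator of the \<open>r\<close>-th block. For \<open>r < b + c - p\<close> any
  element of degree \<open>r\<close> outside the multiples of \<open>y + z\<close> will do, because \<open>(y + z)^p = 0\<close>; the
  monomial \<open>z^r\<close> is chosen.
\<close>
definition gen_pairing :: "nat \<Rightarrow> nat \<Rightarrow> nat \<Rightarrow> nat \<Rightarrow> (nat \<Rightarrow> nat \<Rightarrow> 'w :: ring_1) \<Rightarrow> 'w" where
  "gen_pairing p b c r g = (if r < b + c - p then g 0 r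
     else (\<Sum>u\<le>r. of_int (gen_coeff b c r u) * g u (r - u)))"

lemma gen_pairing_add: "gen_pairing p b c r (g + h) = gen_pairing p b c r g + gen_pairing p b c r h"
  by (simp add: gen_pairing_def sum.distrib algebra_simps)

lemma gen_pairing_additive:
  assumes "additive T"
  shows "gen_pairing p b c r (\<lambda>n m. T (g n m)) = T (gen_pairing p b c r g)"
proof -
  interpret additive T by fact
  show ?thesis by (simp add: gen_pairing_def sum additive_of_int[OF assms])
qed

context elementary_group
begin

abbreviation bi_fun :: "nat \<Rightarrow> nat \<Rightarrow> (nat \<Rightarrow> nat \<Rightarrow> 'w) set" where
  "bi_fun b c \<equiv> fun_on {..<b} (fun_on {..<c} W)"

lemma bi_fun_iff: "g \<in> bi_fun b c \<longleftrightarrow> (\<forall>n m. g n m \<in> W) \<and> (\<forall>n m. n \<ge> b \<or> m \<ge> c \<longrightarrow> g n m = 0)"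
proof
  assume "g \<in> bi_fun b c"
  thus "(\<forall>n m. g n m \<in> W) \<and> (\<forall>n m. n \<ge> b \<or> m \<ge> c \<longrightarrow> g n m = 0)"
    using zero_mem unfolding fun_on_def
    by (simp add: fun_eq_iff) (metis lessThan_iff linorder_not_less zero_fun_apply)
next
  assume "(\<forall>n m. g n m \<in> W) \<and> (\<forall>n m. n \<ge> b \<or> m \<ge> c \<longrightarrow> g n m = 0)"
  thus "g \<in> bi_fun b c" by (simp add: fun_on_def fun_eq_iff)
qed

lemma diag_shift_bi_fun: "g \<in> bi_fun b c \<Longrightarrow> diag_shift g \<in> bi_fun b c"
  unfolding bi_fun_iff by (simp add: diag_shift_def add_mem)

lemma diag_shift_funpow_bi_fun: "g \<in> bi_fun b c \<Longrightarrow> (diag_shift ^^ k) g \<in> bi_fun b c"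
  by (induction k) (auto intro: diag_shift_bi_fun)

lemma gen_pairing_mem: "g \<in> bi_fun b c \<Longrightarrow> gen_pairing p b' c' r g \<in> W"
  unfolding bi_fun_iff gen_pairing_def by (auto intro!: sum_mem of_int_mem)

text \<open>
  The generator of the \<open>r\<close>-th block is killed by the power of \<open>y + z\<close> given by the length of the block: for
  \<open>r < b + c - p\<close> by the divisibility of binomial coefficients, and otherwise by \<open>generator_orthogonality\<close>.
\<close>
lemma gen_pairing_annihilated:
  assumes bc: "b \<le> p" "c \<le> p" and r: "r < b" "r < c" and g: "g \<in> bi_fun b c"
  shows "gen_pairing p b c r ((diag_shift ^^ block p b c r) g) = 0"
proof (cases "r < b + c - p")
  case True
  have supp: "g n m = 0" if "n \<ge> b \<or> m \<ge> c" for n m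
    using g that unfolding bi_fun_iff by blast
  have "of_nat (p choose j) * g j (r + (p - j)) = 0" if "j \<le> p" for j
  proof (cases "j = 0 \<or> j = p")
    case True
    thus ?thesis using supp bc by auto
  next
    case False
    hence "p dvd (p choose j)" using that prime_p by (intro dvd_choose_prime) auto
    thus ?thesis using g torsion_dvd unfolding bi_fun_iff by blast
  qed
  thus ?thesis using True
    by (simp add: gen_pairing_def block_def diag_shift_funpow_apply)
next
  case False
  define \<alpha> \<beta> n where "\<alpha> = b - 1 - r" and "\<beta> = c - 1 - r" and "n = \<alpha> + \<beta> + 1"
  have b: "b = \<alpha> + 1 + r" and c: "c = \<beta> + 1 + r" using r by (auto simp: \<alpha>_def \<beta>_def)
  have blk: "block p b c r = n" using False by (simp add: block_def b c n_def)
  have coeff: "gen_coeff b c r u = (-1) ^ u * int ((\<alpha> + (r - u)) choose (r - u)) * int ((\<beta> + u) choose u)"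
    if "u \<le> r" for u
    using that by (simp add: gen_coeff_def b c)
  have supp: "g n m = 0" if "n \<ge> b \<or> m \<ge> c" for n m
    using g that unfolding bi_fun_iff by blast
  define h where "h m = g m (r + n - m)" for m
  have "gen_pairing p b c r ((diag_shift ^^ n) g) =
     (\<Sum>u\<le>r. \<Sum>j\<le>n. of_int (gen_coeff b c r u * int (n choose j)) * g (u + j) (r - u + (n - j)))"
    using False by (simp add: gen_pairing_def diag_shift_funpow_apply sum_distrib_left mult.assoc)
  also have "\<dots> = (\<Sum>u\<le>r. \<Sum>m\<le>r + n. if u \<le> m then of_int (gen_coeff b c r u * int (n choose (m - u))) * h m else 0)"
  proof (rule sum.cong[OF refl])
    fix u assume u: "u \<in> {..r}"
    have "(\<Sum>j\<le>n. of_int (gen_coeff b c r u * int (n choose j)) * g (u + j) (r - u + (n - j))) =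
       (\<Sum>m\<in>{u..u+n}. of_int (gen_coeff b c r u * int (n choose (m - u))) * h m)"
      by (rule sum.reindex_bij_witness[of _ "\<lambda>m. m - u" "\<lambda>j. u + j"]) (use u in \<open>auto simp: h_def\<close>)
    also have "\<dots> = (\<Sum>m\<le>r + n. if u \<le> m then of_int (gen_coeff b c r u * int (n choose (m - u))) * h m else 0)"
      by (rule sum.mono_neutral_cong_left) (use u in \<open>auto simp: binomial_eq_0\<close>)
    finally show "(\<Sum>j\<le>n. of_int (gen_coeff b c r u * int (n choose j)) * g (u + j) (r - u + (n - j))) =
       (\<Sum>m\<le>r + n. if u \<le> m then of_int (gen_coeff b c r u * int (n choose (m - u))) * h m else 0)" .
  qed
  also have "\<dots> = (\<Sum>m\<le>r + n. \<Sum>u\<le>r. if u \<le> m then of_int (gen_coeff b c r u * int (n choose (m - u))) * h m else 0)"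
    by (rule sum.swap)
  also have "\<dots> = (\<Sum>m\<le>r + n. of_int (\<Sum>u\<le>r. if u \<le> m then gen_coeff b c r u * int (n choose (m - u)) else 0) * h m)"
    unfolding of_int_sum sum_distrib_right by (intro sum.cong refl) auto
  also have "\<dots> = 0"
  proof (intro sum.neutral ballI)
    fix m assume m: "m \<in> {..r + n}"
    show "of_int (\<Sum>u\<le>r. if u \<le> m then gen_coeff b c r u * int (n choose (m - u)) else 0) * h m = 0"
    proof (cases "m \<ge> b \<or> r + n - m \<ge> c")
      case True
      thus ?thesis using supp by (simp add: h_def)
    next
      case False
      define t where "t = m - \<alpha>"
      have t: "m = \<alpha> + t" "1 \<le> t" "t \<le> r" using False by (auto simp: t_def b c n_def)
      have "(\<Sum>u\<le>r. if u \<le> m then gen_coeff b c r u * int (n choose (m - u)) else 0) =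
         (\<Sum>u\<le>r. if u \<le> \<alpha> + t then (-1) ^ u * int ((\<alpha> + (r - u)) choose (r - u)) *
           int ((\<beta> + u) choose u) * int ((\<alpha> + \<beta> + 1) choose (\<alpha> + t - u)) else 0)"
        by (intro sum.cong refl) (simp add: coeff t(1) n_def)
      thus ?thesis using generator_orthogonality[OF t(2,3)] by simp
    qed
  qed
  finally show ?thesis by (simp add: blk)
qed

text \<open>
  The generators span the truncated ring over \<open>k[y + z]\<close>. Modulo \<open>y + z\<close> all monomials of degree \<open>d\<close> agree up
  to sign, and they vanish for \<open>d \<ge> min b c\<close>; the generator of degree \<open>d\<close> is a unit multiple of \<open>z^d\<close>,
  because the binomial coefficient in \<open>generator_value\<close> has an upper entry less than \<open>p\<close> unless the
  generator is \<open>z^d\<close> itself. In dual terms, a linear form killed on all powers of \<open>y + z\<close> times a generator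
  is shown to vanish by induction on the degree.
\<close>
lemma gen_pairing_zero_imp_zero:
  assumes bc: "b \<le> p" "c \<le> p" and g: "g \<in> bi_fun b c"
    and zero: "\<And>r m. r < min b c \<Longrightarrow> m < block p b c r \<Longrightarrow> gen_pairing p b c r ((diag_shift ^^ m) g) = 0"
  shows "g = 0"
proof -
  define G where "G m = (diag_shift ^^ m) g" for m
  have G: "G m \<in> bi_fun b c" for m unfolding G_def by (rule diag_shift_funpow_bi_fun[OF g])
  have supp: "G k n m = 0" if "n \<ge> b \<or> m \<ge> c" for k n m
    using G[of k] that unfolding bi_fun_iff by blast
  have mem: "G k n m \<in> W" for k n m using G[of k] unfolding bi_fun_iff by blast
  have zero': "gen_pairing p b c r (G m) = 0" if r: "r < min b c" for r m
  proof (cases "m < block p b c r")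
    case False
    hence "G m = (diag_shift ^^ block p b c r) (G (m - block p b c r))"
      unfolding G_def by (metis comp_apply funpow_add le_add_diff_inverse not_le)
    thus ?thesis using gen_pairing_annihilated[OF bc _ _ G] r by simp
  qed (use zero r in \<open>simp add: G_def\<close>)
  have "\<forall>m. \<forall>u\<le>d. G m u (d - u) = 0" for d
  proof (induction d)
    case 0
    have *: "G m 0 0 = 0" for m
    proof (cases "min b c = 0")
      case True thus ?thesis using supp by (auto simp: min_def split: if_splits)
    next
      case False
      hence "gen_pairing p b c 0 (G m) = 0" by (intro zero') auto
      thus ?thesis by (auto simp: gen_pairing_def gen_coeff_def split: if_splits)
    qed
    show ?case by (auto simp: *)
  next
    case (Suc d)
    \<comment> \<open>The induction hypothesis for \<open>G (m + 1)\<close> says that \<open>G m\<close> kills all multiples of \<open>y + z\<close> in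
      degree \<open>d + 1\<close>.\<close>
    have step: "G m (Suc u) (d - u) = - G m u (Suc d - u)" if "u \<le> d" for m u
    proof -
      have "G m (Suc u) (d - u) + G m u (Suc (d - u)) = G (Suc m) u (d - u)"
        by (simp add: G_def diag_shift_def)
      also have "\<dots> = 0" using Suc that by blast
      finally show ?thesis using that by (simp add: eq_neg_iff_add_eq_0 Suc_diff_le)
    qed
    have alt: "G m u (Suc d - u) = (-1) ^ u * G m 0 (Suc d)" if "u \<le> Suc d" for m u
      using that
    proof (induction u)
      case (Suc u)
      thus ?case using step[of u m] by simp
    qed simp
    have "G m 0 (Suc d) = 0" for m
    proof (cases "Suc d < min b c")
      case False
      show ?thesis
      proof (cases "c \<le> Suc d")
        case True thus ?thesis using supp by blast
      next
        case False
        with \<open>\<not> Suc d < min b c\<close> have "G m (Suc d) 0 = 0" using supp by auto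
        thus ?thesis using alt[of "Suc d" m] by (simp add: minus_one_power_iff split: if_splits)
      qed
    next
      case True
      note z = zero'[OF True, of m]
      show ?thesis
      proof (cases "Suc d < b + c - p")
        case True thus ?thesis using z by (simp add: gen_pairing_def)
      next
        case False
        define \<alpha> \<beta> where "\<alpha> = b - 1 - Suc d" and "\<beta> = c - 1 - Suc d"
        have b: "b = \<alpha> + 1 + Suc d" and c: "c = \<beta> + 1 + Suc d"
          using \<open>Suc d < min b c\<close> by (auto simp: \<alpha>_def \<beta>_def)
        define N where "N = (\<alpha> + \<beta> + 1 + Suc d) choose Suc d"
        have "gen_pairing p b c (Suc d) (G m) = (\<Sum>u\<le>Suc d. of_int (gen_coeff b c (Suc d) u) * G m u (Suc d - u))"
          using False by (simp only: gen_pairing_def if_False)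
        also have "\<dots> = (\<Sum>u\<le>Suc d. of_nat (((\<alpha> + (Suc d - u)) choose (Suc d - u)) * ((\<beta> + u) choose u)) * G m 0 (Suc d))"
        proof (intro sum.cong refl)
          fix u assume u: "u \<in> {..Suc d}"
          have "gen_coeff b c (Suc d) u =
            (-1) ^ u * int (((\<alpha> + (Suc d - u)) choose (Suc d - u)) * ((\<beta> + u) choose u))"
            using u by (simp add: gen_coeff_def b c)
          hence "of_int (gen_coeff b c (Suc d) u) * G m u (Suc d - u) =
            (of_nat (((\<alpha> + (Suc d - u)) choose (Suc d - u)) * ((\<beta> + u) choose u)) * G m 0 (Suc d)) * 1"
            using u alt[of u m] by (cases "even u") (simp_all del: of_nat_mult)
          thus "of_int (gen_coeff b c (Suc d) u) * G m u (Suc d - u) =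
            of_nat (((\<alpha> + (Suc d - u)) choose (Suc d - u)) * ((\<beta> + u) choose u)) * G m 0 (Suc d)"
            by simp
        qed
        also have "\<dots> = of_nat (\<Sum>u\<le>Suc d. ((\<alpha> + (Suc d - u)) choose (Suc d - u)) * ((\<beta> + u) choose u)) * G m 0 (Suc d)"
          by (simp only: of_nat_sum sum_distrib_right)
        also have "\<dots> = of_nat N * G m 0 (Suc d)"
          unfolding N_def by (simp only: generator_value)
        finally have "of_nat N * G m 0 (Suc d) = 0" using z by simp
        moreover have "coprime N p"
          unfolding N_def using False b c by (intro coprime_binomial_prime prime_p) auto
        ultimately show ?thesis using coprime_cancel[OF mem] by blast
      qed
    qed
    thus ?case using alt by auto
  qed
  hence "G 0 n m = 0" for n m
    using spec[of _ 0] by (metis add_diff_cancel_left' le_add1)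
  thus ?thesis by (simp add: G_def fun_eq_iff)
qed

text \<open>
  Let \<open>U = -T\<close>. The kernel consists of those \<open>g\<close> on which the transpose of \<open>y + z\<close> acts as \<open>U\<close>, that is,
  of the \<open>k[x]\<close>-linear maps from \<open>k[y, z] / (y^b, z^c)\<close> to \<open>W\<close>, where \<open>x\<close> acts as \<open>y + z\<close> and as \<open>U\<close>. The
  source is the direct sum of the modules \<open>k[x] / (x^n)\<close> with \<open>n\<close> the block sizes, so a map is given
  by the images of the generators, the one of the \<open>r\<close>-th block being any element killed by \<open>U^n\<close>.
  
  That the generators span is \<open>gen_pairing_zero_imp_zero\<close>; that the sum is direct follows because
  the block sizes add up to the dimension \<open>b c\<close>.
\<close>
theorem card_kernel_two_variables:
  assumes T: "additive T" "T ` W \<subseteq> W" and bc: "b \<le> p" "c \<le> p"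
  shows "card {g \<in> bi_fun b c. shift_add (shift_add T) g = 0} =
    (\<Prod>r<min b c. card {w \<in> W. (T ^^ block p b c r) w = 0})"
proof -
  interpret T: additive T by fact
  define U where "U x = - T x" for x
  have addU: "additive U" using T(1) by (simp add: additive_def U_def)
  interpret U: additive U by fact
  have UW: "U ` W \<subseteq> W" using T uminus_mem by (auto simp: U_def)
  have "(U ^^ n) w = (T ^^ n) w \<or> (U ^^ n) w = - (T ^^ n) w" for n w
    by (induction n) (auto simp: U_def T.minus)
  hence U0: "(U ^^ n) w = 0 \<longleftrightarrow> (T ^^ n) w = 0" for n w by (metis neg_equal_0_iff_equal)
  define KD where "KD = {g \<in> bi_fun b c. shift_add (shift_add T) g = 0}"
  define Up where "Up g = (\<lambda>n m. U (g n m))" for g :: "nat \<Rightarrow> nat \<Rightarrow> 'w"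
  have KD_iff: "g \<in> KD \<longleftrightarrow> g \<in> bi_fun b c \<and> diag_shift g = Up g" for g
    by (auto simp: KD_def shift_add_def diag_shift_def Up_def U_def fun_eq_iff
        eq_neg_iff_add_eq_0 algebra_simps)
  define L where "L r g = gen_pairing p b c r g" for r and g :: "nat \<Rightarrow> nat \<Rightarrow> 'w"
  have L_Up: "L r (Up g) = U (L r g)" for r g
    unfolding L_def Up_def by (rule gen_pairing_additive[OF addU])
  have shift_Up: "diag_shift (Up g) = Up (diag_shift g)" for g
    by (auto simp: diag_shift_def Up_def fun_eq_iff U.add)
  have shiftn_Up: "(diag_shift ^^ k) (Up g) = Up ((diag_shift ^^ k) g)" for k g
    by (induction k) (auto simp: shift_Up)
  have L_iter: "L r ((diag_shift ^^ k) g) = (U ^^ k) (L r g)" if "g \<in> KD" for r k g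
  proof (induction k)
    case (Suc k)
    have "(diag_shift ^^ Suc k) g = (diag_shift ^^ k) (Up g)"
      using that by (simp add: KD_iff funpow_swap1)
    thus ?case using Suc by (simp add: shiftn_Up L_Up)
  qed simp
  \<comment> \<open>\<open>\<Phi> g\<close> lists the values of the form \<open>g\<close> at all \<open>(y + z)^m\<close> times the \<open>r\<close>-th generator. It is
    injective between sets of equal size, hence bijective.\<close>
  define S where "S = (SIGMA r:{..<min b c}. {..<block p b c r})"
  define \<Phi> where "\<Phi> g = (\<lambda>(r, m). if (r, m) \<in> S then L r ((diag_shift ^^ m) g) else 0)" for g
  have finS: "finite S" unfolding S_def by auto
  have cardS: "card S = b * c" unfolding S_def using sum_block[OF bc] by simp
  have finD: "finite (bi_fun b c)" by (intro finite_fun_on finite_W) auto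
  have cardD: "card (bi_fun b c) = card (fun_on S W)"
    by (simp add: card_fun_on cardS finS mult.commute flip: power_mult)
  have \<Phi>_add: "\<Phi> (g + h) = \<Phi> g + \<Phi> h" for g h
    by (auto simp: \<Phi>_def fun_eq_iff L_def diag_shift_funpow_add gen_pairing_add)
  have \<Phi>_zero: "g = 0" if "g \<in> bi_fun b c" "\<Phi> g = 0" for g
  proof (rule gen_pairing_zero_imp_zero[OF bc that(1)])
    fix r m assume "r < min b c" "m < block p b c r"
    thus "gen_pairing p b c r ((diag_shift ^^ m) g) = 0"
      using fun_cong[OF that(2), of "(r, m)"] by (simp add: \<Phi>_def S_def L_def)
  qed
  interpret D: elementary_group p "bi_fun b c"
    by (intro elementary_group.fun_on_group fun_on_group) auto
  have inj: "inj_on \<Phi> (bi_fun b c)"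
  proof (rule inj_onI)
    fix g h assume gh: "g \<in> bi_fun b c" "h \<in> bi_fun b c" "\<Phi> g = \<Phi> h"
    have "\<Phi> h + \<Phi> (g - h) = \<Phi> g" by (simp flip: \<Phi>_add)
    hence "\<Phi> (g - h) = 0" using gh by simp
    thus "g = h" using \<Phi>_zero[of "g - h"] gh D.diff_mem by simp
  qed
  have "\<Phi> ` bi_fun b c \<subseteq> fun_on S W"
  proof (rule image_subsetI)
    fix g assume "g \<in> bi_fun b c"
    hence "L r ((diag_shift ^^ m) g) \<in> W" for r m
      unfolding L_def by (intro gen_pairing_mem diag_shift_funpow_bi_fun)
    thus "\<Phi> g \<in> fun_on S W" unfolding fun_on_def \<Phi>_def by auto
  qed
  moreover have "card (\<Phi> ` bi_fun b c) = card (fun_on S W)"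
    by (simp add: card_image[OF inj] cardD)
  ultimately have surj: "\<Phi> ` bi_fun b c = fun_on S W"
    using finS finite_W by (intro card_subset_eq finite_fun_on) auto
  define KT where "KT = (\<Pi>\<^sub>E r\<in>{..<min b c}. {w \<in> W. (T ^^ block p b c r) w = 0})"
  have \<Phi>_KD: "\<Phi> g = (\<lambda>(r, m). if (r, m) \<in> S then (U ^^ m) (L r g) else 0)" if "g \<in> KD" for g
    using L_iter[OF that] by (auto simp: \<Phi>_def fun_eq_iff)
  have U_zero: "(U ^^ n) 0 = 0" for n by (induction n) (auto simp: U.zero)
  have "bij_betw (\<lambda>g. \<lambda>r\<in>{..<min b c}. L r g) KD KT"
    unfolding bij_betw_def
  proof
    show "inj_on (\<lambda>g. \<lambda>r\<in>{..<min b c}. L r g) KD"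
    proof (rule inj_onI)
      fix g h assume gh: "g \<in> KD" "h \<in> KD" "(\<lambda>r\<in>{..<min b c}. L r g) = (\<lambda>r\<in>{..<min b c}. L r h)"
      have "L r g = L r h" if "r < min b c" for r
        using fun_cong[OF gh(3), of r] that by simp
      hence "\<Phi> g = \<Phi> h" unfolding \<Phi>_KD[OF gh(1)] \<Phi>_KD[OF gh(2)] by (auto simp: S_def fun_eq_iff)
      thus "g = h" using inj gh by (auto simp: KD_iff dest: inj_onD)
    qed
    show "(\<lambda>g. \<lambda>r\<in>{..<min b c}. L r g) ` KD = KT"
    proof (intro equalityI subsetI)
      fix v assume "v \<in> (\<lambda>g. \<lambda>r\<in>{..<min b c}. L r g) ` KD"
      then obtain g where g: "g \<in> KD" "v = (\<lambda>r\<in>{..<min b c}. L r g)" by auto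
      have "(T ^^ block p b c r) (L r g) = 0" if "r < min b c" for r
        using L_iter[OF g(1), of r "block p b c r"] gen_pairing_annihilated[OF bc, of r g] g(1) that
        by (simp add: KD_iff L_def flip: U0)
      moreover have "L r g \<in> W" for r
        using g(1) gen_pairing_mem by (auto simp: KD_iff L_def)
      ultimately show "v \<in> KT" unfolding KT_def g(2) by auto
    next
      fix v assume v: "v \<in> KT"
      \<comment> \<open>The prescribed images \<open>v r\<close> of the generators determine the values on the whole basis.\<close>
      define w where "w = (\<lambda>(r, m). if (r, m) \<in> S then (U ^^ m) (v r) else 0)"
      have "(U ^^ m) (v r) \<in> W" if "r < min b c" for r m
        using v that by (intro funpow_closed[OF UW]) (auto simp: KT_def PiE_iff)
      hence "w \<in> fun_on S W" by (auto simp: w_def fun_on_def S_def)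
      hence "w \<in> \<Phi> ` bi_fun b c" by (simp only: surj)
      then obtain g where g: "g \<in> bi_fun b c" "\<Phi> g = w" by (metis imageE)
      have kill: "(U ^^ m) (v r) = 0" if "m \<ge> block p b c r" "r < min b c" for m r
      proof -
        have "(U ^^ block p b c r) (v r) = 0" using v that by (auto simp: KT_def PiE_iff U0)
        thus ?thesis using that(1) U_zero[of "m - block p b c r"]
            funpow_add[of "m - block p b c r" "block p b c r" U] by simp
      qed
      have Lg: "L r ((diag_shift ^^ m) g) = (U ^^ m) (v r)" if r: "r < min b c" for r m
      proof (cases "m < block p b c r")
        case True
        thus ?thesis using fun_cong[OF g(2), of "(r, m)"] r by (simp add: \<Phi>_def w_def S_def)
      next
        case False
        hence "(diag_shift ^^ m) g = (diag_shift ^^ block p b c r) ((diag_shift ^^ (m - block p b c r)) g)"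
          by (metis comp_apply funpow_add le_add_diff_inverse not_le)
        thus ?thesis using kill[of r m] False r
            gen_pairing_annihilated[OF bc _ _ diag_shift_funpow_bi_fun[OF g(1)], of r]
          by (simp add: L_def)
      qed
      have UpD: "Up h \<in> bi_fun b c" if "h \<in> bi_fun b c" for h
        using that UW unfolding bi_fun_iff by (auto simp: Up_def U.zero)
      have "\<Phi> (diag_shift g) = \<Phi> (Up g)"
      proof
        fix x :: "nat \<times> nat"
        obtain r m where x: "x = (r, m)" by (cases x)
        have "L r ((diag_shift ^^ m) (diag_shift g)) = L r ((diag_shift ^^ m) (Up g))" if "(r, m) \<in> S"
        proof -
          have r: "r < min b c" using that by (simp add: S_def)
          have "L r ((diag_shift ^^ m) (diag_shift g)) = (U ^^ Suc m) (v r)"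
            using Lg[OF r, of "Suc m"] by (simp add: funpow_swap1)
          thus ?thesis by (simp add: shiftn_Up L_Up Lg[OF r])
        qed
        thus "\<Phi> (diag_shift g) x = \<Phi> (Up g) x" by (simp add: \<Phi>_def x)
      qed
      hence "diag_shift g = Up g"
        using inj diag_shift_bi_fun[OF g(1)] UpD[OF g(1)] by (auto dest: inj_onD)
      hence "g \<in> KD" using g by (simp add: KD_iff)
      moreover have "v = (\<lambda>r\<in>{..<min b c}. L r g)"
      proof
        fix r show "v r = (\<lambda>r\<in>{..<min b c}. L r g) r"
          using Lg[of r 0] v by (cases "r < min b c") (auto simp: KT_def PiE_iff extensional_def)
      qed
      ultimately show "v \<in> (\<lambda>g. \<lambda>r\<in>{..<min b c}. L r g) ` KD" by blast
    qed
  qed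
  hence "card KD = card KT" by (rule bij_betw_same_card)
  thus ?thesis unfolding KD_def KT_def by (simp add: card_PiE)
qed

end

section \<open>Kernels of sums of shifts on boxes\<close>

definition box :: "(nat \<Rightarrow> nat) \<Rightarrow> (nat \<Rightarrow> nat) set" where
  "box a = {u. \<forall>i. u i < a i}"

definition box_fun :: "nat \<Rightarrow> (nat \<Rightarrow> nat) \<Rightarrow> ((nat \<Rightarrow> nat) \<Rightarrow> residues_prod) set" where
  "box_fun p a = fun_on (box a) (Zmod p)"

text \<open>
  With \<open>c = 1\<close> this is the operator \<open>T\<close> whose nullities are studied; \<open>c = 2\<close> belongs to the squares
  \<open>x\<^sub>i\<^sup>2\<close>, and \<open>c = p\<close> arises as the \<open>p\<close>-th power of \<open>T\<close>.
\<close>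
definition shifts :: "nat \<Rightarrow> nat set \<Rightarrow> ((nat \<Rightarrow> nat) \<Rightarrow> 'w :: ring_1) \<Rightarrow> (nat \<Rightarrow> nat) \<Rightarrow> 'w" where
  "shifts c I F = (\<lambda>u. \<Sum>i\<in>I. F (u(i := u i + c)))"

text \<open>
  Boxes live in \<open>nat \<Rightarrow> nat\<close> for every index set \<open>I\<close>. A side of length \<open>1\<close> freezes its coordinate at \<open>0\<close>, so
  a variable is removed by setting its side to \<open>1\<close>, and the shift in its direction then acts as zero.
\<close>
definition sides :: "nat set \<Rightarrow> (nat \<Rightarrow> nat) \<Rightarrow> bool" where
  "sides I a \<longleftrightarrow> finite I \<and> (\<forall>i. i \<notin> I \<longrightarrow> a i = 1)"

definition kernel_card :: "nat \<Rightarrow> nat set \<Rightarrow> (nat \<Rightarrow> nat) \<Rightarrow> nat" where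
  "kernel_card p I a = card {F \<in> box_fun p a. shifts 1 I F = 0}"

lemma sides_upd: "sides I a \<Longrightarrow> i \<in> I \<Longrightarrow> sides I (a(i := b))"
  by (auto simp: sides_def)

lemma bij_betw_box:
  assumes "sides I a"
  shows "bij_betw (\<lambda>u. restrict u I) (box a) (\<Pi>\<^sub>E i\<in>I. {..<a i})"
proof (rule bij_betwI[of _ _ _ "\<lambda>f i. if i \<in> I then f i else 0"])
  show "(\<lambda>f i. if i \<in> I then f i else 0) \<in> (\<Pi>\<^sub>E i\<in>I. {..<a i}) \<rightarrow> box a"
    using assms by (auto simp: box_def sides_def)
  show "(\<lambda>i. if i \<in> I then restrict u I i else 0) = u" if "u \<in> box a" for u
    using assms that by (auto simp: box_def sides_def fun_eq_iff) (metis less_Suc0)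
  show "restrict (\<lambda>i. if i \<in> I then f i else 0) I = f" if "f \<in> (\<Pi>\<^sub>E i\<in>I. {..<a i})" for f
    using that by (auto simp: PiE_def extensional_def restrict_def fun_eq_iff)
qed (auto simp: box_def)

lemma finite_box: "sides I a \<Longrightarrow> finite (box a)"
  using bij_betw_finite[OF bij_betw_box] by (auto simp: sides_def intro: finite_PiE)

lemma card_box: "sides I a \<Longrightarrow> card (box a) = (\<Prod>i\<in>I. a i)"
  using bij_betw_same_card[OF bij_betw_box] by (auto simp: sides_def card_PiE)

lemma additive_shifts: "additive (shifts c I)"
  by (auto simp: additive_def shifts_def fun_eq_iff sum.distrib)

lemma elementary_group_box_fun:
  "Factorial_Ring.prime p \<Longrightarrow> sides I a \<Longrightarrow> elementary_group p (box_fun p a)"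
  unfolding box_fun_def by (intro elementary_group.fun_on_group elementary_group_Zmod finite_box)

lemma shifts_closed:
  assumes "Factorial_Ring.prime p"
  shows "shifts c I ` box_fun p a \<subseteq> box_fun p a"
proof (rule image_subsetI)
  interpret elementary_group p "Zmod p" by (rule elementary_group_Zmod[OF assms])
  fix F assume F: "F \<in> box_fun p a"
  have "F (u(i := u i + c)) = 0" if "u \<notin> box a" for u i
  proof -
    from that obtain j where "a j \<le> u j" by (auto simp: box_def not_less)
    hence "u(i := u i + c) \<notin> box a" by (auto simp: box_def not_less intro!: exI[of _ j])
    thus ?thesis using F by (auto simp: box_fun_def fun_on_def)
  qed
  moreover have "F u \<in> Zmod p" for u using F zero_mem fun_on_mem unfolding box_fun_def by metis
  ultimately show "shifts c I F \<in> box_fun p a"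
    unfolding box_fun_def fun_on_def shifts_def by (auto intro!: sum_mem)
qed

lemma card_kernel_transfer:
  assumes bij: "bij_betw \<Psi> A B" and cl: "T ` A \<subseteq> A"
    and int: "\<And>F. F \<in> A \<Longrightarrow> \<Psi> (T F) = T' (\<Psi> F)"
    and zero: "0 \<in> A" "\<Psi> 0 = 0"
  shows "card {F \<in> A. (T ^^ k) F = 0} = card {f \<in> B. (T' ^^ k) f = 0}"
proof (rule bij_betw_same_card)
  have T: "(T ^^ k) F \<in> A" if "F \<in> A" for F k
    using that cl by (induction k) auto
  have "\<Psi> ((T ^^ k) F) = (T' ^^ k) (\<Psi> F)" if "F \<in> A" for F
    by (induction k) (auto simp: int T that)
  moreover have "(T ^^ k) F = 0 \<longleftrightarrow> \<Psi> ((T ^^ k) F) = 0" if "F \<in> A" for F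
    using bij_betw_imp_inj_on[OF bij] T[OF that] zero by (metis inj_onD)
  ultimately show "bij_betw \<Psi> {F \<in> A. (T ^^ k) F = 0} {f \<in> B. (T' ^^ k) f = 0}"
    using bij by (intro bij_betw_subset[OF bij, THEN bij_betw_cong[THEN iffD1, rotated]])
      (auto simp: bij_betw_def image_iff)
qed

text \<open>
  Functions of the remaining coordinates are encoded as functions on the box whose side \<open>i\<close> is \<open>1\<close>, whence the
  condition \<open>u i = 0\<close>.
\<close>
definition slices :: "nat \<Rightarrow> ((nat \<Rightarrow> nat) \<Rightarrow> 'w :: ring_1) \<Rightarrow> nat \<Rightarrow> (nat \<Rightarrow> nat) \<Rightarrow> 'w" where
  "slices i F n = (\<lambda>u. if u i = 0 then F (u(i := n)) else 0)"

lemma slices_shifts: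
  assumes "finite I" "i \<in> I"
  shows "slices i (shifts 1 I F) = shift_add (shifts 1 I) (slices i F)"
proof (intro ext)
  fix n u
  show "slices i (shifts 1 I F) n u = shift_add (shifts 1 I) (slices i F) n u"
  proof (cases "u i = 0")
    case True
    have *: "(\<Sum>j\<in>I. f j) = f i + (\<Sum>j\<in>I - {i}. f j)" for f :: "nat \<Rightarrow> 'a"
      using assms by (rule sum.remove)
    have "(\<Sum>j\<in>I - {i}. F (u(i := n, j := (u(i := n)) j + 1))) = (\<Sum>j\<in>I - {i}. F (u(j := u j + 1, i := n)))"
      by (intro sum.cong refl arg_cong[of _ _ F]) auto
    thus ?thesis using True
      by (simp add: slices_def shift_add_def shifts_def * cong: sum.cong_simp)
  next
    case False
    thus ?thesis by (auto simp: slices_def shift_add_def shifts_def intro!: sum.neutral)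
  qed
qed

lemma bij_betw_slices:
  shows "bij_betw (slices i) (box_fun p (a(i := b))) (fun_on {..<b} (box_fun p (a(i := 1))))"
proof (rule bij_betwI[of _ _ _ "\<lambda>f u. f (u i) (u(i := 0))"])
  note Z0 = zero_mem_Zmod[of p]
  show "slices i \<in> box_fun p (a(i := b)) \<rightarrow> fun_on {..<b} (box_fun p (a(i := 1)))"
  proof
    fix F assume F: "F \<in> box_fun p (a(i := b))"
    have mem: "F u \<in> Zmod p" for u by (rule fun_on_mem[OF Z0 F[unfolded box_fun_def]])
    have supp: "F u = 0" if "u \<notin> box (a(i := b))" for u
      using F that unfolding box_fun_def fun_on_def by blast
    have "slices i F n u = 0" if "n \<ge> b" for n u
    proof -
      have "\<not> (u(i := n)) i < (a(i := b)) i" using that by simp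
      hence "u(i := n) \<notin> box (a(i := b))" unfolding box_def by blast
      thus ?thesis by (simp add: slices_def supp)
    qed
    moreover have "slices i F n u = 0" if u: "u \<notin> box (a(i := 1))" for n u
    proof (cases "u i = 0")
      case True
      from u obtain j where "\<not> u j < (a(i := 1)) j" by (auto simp: box_def)
      with True have "j \<noteq> i" "\<not> u j < a j" by (auto split: if_splits)
      hence "\<not> (u(i := n)) j < (a(i := b)) j" by simp
      hence "u(i := n) \<notin> box (a(i := b))" unfolding box_def by blast
      thus ?thesis by (simp add: slices_def supp)
    qed (simp add: slices_def)
    moreover have "slices i F n u \<in> Zmod p" for n u
      using mem Z0 by (simp add: slices_def)
    ultimately show "slices i F \<in> fun_on {..<b} (box_fun p (a(i := 1)))"
      by (auto simp: fun_on_def box_fun_def fun_eq_iff)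
  qed
  show "(\<lambda>f u. f (u i) (u(i := 0))) \<in> fun_on {..<b} (box_fun p (a(i := 1))) \<rightarrow> box_fun p (a(i := b))"
  proof
    fix f :: "nat \<Rightarrow> (nat \<Rightarrow> nat) \<Rightarrow> residues_prod"
    assume f: "f \<in> fun_on {..<b} (box_fun p (a(i := 1)))"
    have "0 \<in> box_fun p (a(i := 1))" using Z0 by (simp add: box_fun_def fun_on_def)
    hence mem: "f n u \<in> Zmod p" for n u
      using fun_on_mem[OF Z0, of "f n" "box (a(i := 1))" u] fun_on_mem[OF _ f, of n]
      by (simp add: box_fun_def)
    have supp: "f n u = 0" if "n \<ge> b \<or> u \<notin> box (a(i := 1))" for n u
      using f that unfolding fun_on_def box_fun_def by (cases "n < b") auto
    have "f (u i) (u(i := 0)) = 0" if u: "u \<notin> box (a(i := b))" for u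
    proof -
      from u obtain j where j: "\<not> u j < (a(i := b)) j" by (auto simp: box_def)
      show ?thesis
      proof (cases "j = i")
        case True thus ?thesis using j by (intro supp) auto
      next
        case False
        hence "u(i := 0) \<notin> box (a(i := 1))" using j by (auto simp: box_def intro!: exI[of _ j])
        thus ?thesis by (intro supp) auto
      qed
    qed
    thus "(\<lambda>u. f (u i) (u(i := 0))) \<in> box_fun p (a(i := b))"
      using mem by (auto simp: fun_on_def box_fun_def)
  qed
  show "(\<lambda>u. slices i F (u i) (u(i := 0))) = F" for F :: "(nat \<Rightarrow> nat) \<Rightarrow> residues_prod"
    by (simp add: slices_def)
  show "slices i (\<lambda>u. f (u i) (u(i := 0))) = f" if f: "f \<in> fun_on {..<b} (box_fun p (a(i := 1)))" for f
  proof (intro ext)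
    fix n u
    have "f n u = 0" if "u i \<noteq> 0"
    proof -
      have "u \<notin> box (a(i := 1))" using that by (auto simp: box_def intro!: exI[of _ i])
      thus ?thesis using f unfolding fun_on_def box_fun_def by (cases "n < b") auto
    qed
    moreover have "u(i := 0) = u" if "u i = 0" using that by auto
    ultimately show "slices i (\<lambda>u. f (u i) (u(i := 0))) n u = f n u"
      by (auto simp: slices_def)
  qed
qed

lemma card_kernel_slices:
  assumes p: "Factorial_Ring.prime p" and a: "sides I a" and i: "i \<in> I"
  shows "card {F \<in> box_fun p (a(i := b)). (shifts 1 I ^^ k) F = 0} =
    card {f \<in> fun_on {..<b} (box_fun p (a(i := 1))). (shift_add (shifts 1 I) ^^ k) f = 0}"
proof (rule card_kernel_transfer[OF bij_betw_slices shifts_closed[OF p]])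
  show "slices i (shifts 1 I F) = shift_add (shifts 1 I) (slices i F)" for F
    using a i by (intro slices_shifts) (auto simp: sides_def)
  show "0 \<in> box_fun p (a(i := b))"
    using elementary_group.zero_mem[OF elementary_group_box_fun[OF p sides_upd[OF a i]]] .
qed (auto simp: slices_def fun_eq_iff)

lemma kernel_card_eliminate:
  assumes p: "Factorial_Ring.prime p" and a: "sides I a" and i: "i \<in> I"
  shows "kernel_card p I (a(i := b)) = card {F \<in> box_fun p (a(i := 1)). (shifts 1 I ^^ b) F = 0}"
proof -
  interpret elementary_group p "box_fun p (a(i := 1))"
    by (rule elementary_group_box_fun[OF p sides_upd[OF a i]])
  show ?thesis
    using card_kernel_slices[OF p a i, of b 1]
      card_kernel_shift_add[OF additive_shifts shifts_closed[OF p], where b = b]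
    by (simp add: kernel_card_def)
qed

text \<open>
  By \<open>card_kernel_shift_add\<close> the two variables \<open>i\<close> and \<open>j\<close> become the two sequence variables of
  \<open>card_kernel_two_variables\<close>, and each power of the remaining operator that appears there is turned back into
  one variable.
\<close>
theorem kernel_card_fusion:
  assumes p: "Factorial_Ring.prime p" and a: "sides I a" and ij: "i \<in> I" "j \<in> I" "i \<noteq> j"
    and bc: "b \<le> p" "c \<le> p"
  shows "kernel_card p I (a(i := b, j := c)) =
    (\<Prod>r<min b c. kernel_card p I (a(i := block p b c r, j := 1)))"
proof -
  define a' where "a' = a(j := 1)"
  have a': "sides I a'" unfolding a'_def by (rule sides_upd[OF a ij(2)])
  define T where "T = (shifts 1 I :: ((nat \<Rightarrow> nat) \<Rightarrow> residues_prod) \<Rightarrow> _)"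
  define W where "W = box_fun p (a'(i := 1))"
  interpret elementary_group p W
    unfolding W_def by (rule elementary_group_box_fun[OF p sides_upd[OF a' ij(1)]])
  have T: "additive T" "T ` W \<subseteq> W"
    unfolding T_def W_def by (rule additive_shifts, rule shifts_closed[OF p])
  interpret S: elementary_group p "fun_on {..<b} W" by (rule fun_on_group) simp
  have "kernel_card p I (a(i := b, j := c)) = card {F \<in> box_fun p (a'(i := b)). (T ^^ c) F = 0}"
    using kernel_card_eliminate[OF p sides_upd[OF a ij(1)] ij(2), of b c] ij(3)
    by (simp add: T_def a'_def fun_upd_twist)
  also have "\<dots> = card {f \<in> fun_on {..<b} W. (shift_add T ^^ c) f = 0}"
    unfolding T_def W_def by (rule card_kernel_slices[OF p a' ij(1)])
  also have "\<dots> = card {g \<in> fun_on {..<c} (fun_on {..<b} W). shift_add (shift_add T) g = 0}"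
    by (rule S.card_kernel_shift_add[OF additive_shift_add[OF T(1)] shift_add_closed[OF T], symmetric])
  also have "\<dots> = (\<Prod>r<min c b. card {w \<in> W. (T ^^ block p c b r) w = 0})"
    by (rule card_kernel_two_variables[OF T bc(2,1)])
  also have "\<dots> = (\<Prod>r<min b c. kernel_card p I (a(i := block p b c r, j := 1)))"
  proof (rule prod.cong)
    fix r
    have "a(i := x, j := 1) = a'(i := x)" for x using ij(3) by (auto simp: a'_def)
    thus "card {w \<in> W. (T ^^ block p c b r) w = 0} = kernel_card p I (a(i := block p b c r, j := 1))"
      using kernel_card_eliminate[OF p a' ij(1)]
      by (simp add: T_def W_def block_def add.commute)
  qed (simp add: min.commute)
  finally show ?thesis .
qed

lemma shifts_funpow_prime:
  assumes p: "Factorial_Ring.prime p" and a: "sides I a" and F: "F \<in> box_fun p a"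
  shows "(shifts 1 I ^^ p) F = shifts p I F"
proof -
  interpret elementary_group p "box_fun p a" by (rule elementary_group_box_fun[OF p a])
  have "finite I" using a by (simp add: sides_def)
  have single: "(shifts 1 {i} ^^ k) G = shifts k {i} G" for i k and G :: "(nat \<Rightarrow> nat) \<Rightarrow> residues_prod"
    by (induction k) (auto simp: shifts_def fun_eq_iff)
  have "(shifts 1 J ^^ p) F = shifts p J F" if "finite J" for J
    using that
  proof (induction J)
    case empty
    have "(shifts 1 {} ^^ k) F = shifts k {} F" if "k > 0" for k
      using that by (cases k) (auto simp: shifts_def fun_eq_iff)
    thus ?case using p prime_gt_0_nat by blast
  next
    case (insert i J)
    have ins: "shifts k (insert i J) = (\<lambda>G. shifts k {i} G + shifts k J G)"
      for k and G :: "(nat \<Rightarrow> nat) \<Rightarrow> residues_prod"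
      using insert.hyps by (auto simp: shifts_def fun_eq_iff)
    have comm: "shifts 1 {i} (shifts 1 J G) = shifts 1 J (shifts 1 {i} G)"
      for G :: "(nat \<Rightarrow> nat) \<Rightarrow> residues_prod"
      using insert.hyps by (auto simp: shifts_def fun_eq_iff fun_upd_twist intro!: sum.cong)
    show ?case
      unfolding ins
      by (subst freshmans_dream[OF additive_shifts shifts_closed[OF p] additive_shifts shifts_closed[OF p] comm F])
        (simp only: single insert.IH)
  qed
  thus ?thesis using \<open>finite I\<close> .
qed

text \<open>
  The natural numbers \<open>l\<close> with \<open>c l + e < x\<close> form an initial segment; its length is a rounded-up quotient.
\<close>
lemma less_ceiling_div_iff:
  "c > 0 \<Longrightarrow> (l :: nat) < (x - e + c - 1) div c \<longleftrightarrow> c * l + e < x"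
proof -
  assume c: "c > 0"
  have "l < (x - e + c - 1) div c \<longleftrightarrow> Suc l \<le> (x - e + c - 1) div c" by auto
  also have "\<dots> \<longleftrightarrow> Suc l * c \<le> x - e + c - 1" using c by (simp add: less_eq_div_iff_mult_less_eq)
  also have "\<dots> \<longleftrightarrow> c * l + e < x" using c by (auto simp: mult.commute)
  finally show ?thesis .
qed

text \<open>
  The shift by \<open>c\<close> preserves the residues modulo \<open>c\<close> of all coordinates. The operator therefore splits into
  one copy of the unit shifts for each residue vector \<open>e\<close>, on the box of those \<open>l\<close> with \<open>c l + e\<close> in the
  given box.
\<close>
theorem card_kernel_residue_classes:
  assumes p: "Factorial_Ring.prime p" and a: "sides I a" and c: "c > 0"
  shows "card {F \<in> box_fun p a. (shifts c I ^^ k) F = 0} =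
    (\<Prod>e\<in>box (\<lambda>i. if i \<in> I then c else 1).
       card {F \<in> box_fun p (\<lambda>i. (a i - e i + c - 1) div c). (shifts 1 I ^^ k) F = 0})"
proof -
  define E where "E = box (\<lambda>i. if i \<in> I then c else 1)"
  define q where "q e = (\<lambda>i. (a i - e i + c - 1) div c)" for e :: "nat \<Rightarrow> nat"
  define comp where "comp F e = (\<lambda>l. F (\<lambda>i. c * l i + e i))" for F :: "(nat \<Rightarrow> nat) \<Rightarrow> residues_prod" and e
  note Z0 = zero_mem_Zmod[of p]
  interpret elementary_group p "box_fun p a" by (rule elementary_group_box_fun[OF p a])
  have q_iff: "l \<in> box (q e) \<longleftrightarrow> (\<lambda>i. c * l i + e i) \<in> box a" for l e
    using c by (simp add: box_def q_def less_ceiling_div_iff del: One_nat_def)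
  have comp_mem: "comp F e \<in> box_fun p (q e)" if "F \<in> box_fun p a" for F e
    using that by (auto simp: box_fun_def fun_on_def comp_def q_iff)
  have comp_shifts: "comp (shifts c I F) e = shifts 1 I (comp F e)" for F e
    by (auto simp: comp_def shifts_def fun_eq_iff intro!: sum.cong arg_cong[of _ _ F])
  have comp_iter: "comp ((shifts c I ^^ k) F) e = (shifts 1 I ^^ k) (comp F e)" for F e k
    by (induction k) (auto simp: comp_shifts)
  have E_bounds: "e i < c" "i \<notin> I \<Longrightarrow> e i = 0" if "e \<in> E" for e i
  proof -
    have "e i < (if i \<in> I then c else 1)" using that unfolding E_def box_def by blast
    thus "e i < c" "i \<notin> I \<Longrightarrow> e i = 0" using c by (auto split: if_splits)
  qed
  have off: "u i = 0" if "u \<in> box a" "i \<notin> I" for u i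
    using that a by (auto simp: box_def sides_def) (metis less_Suc0)
  have comp_inj: "F = G" if "F \<in> box_fun p a" "G \<in> box_fun p a" "\<And>e. e \<in> E \<Longrightarrow> comp F e = comp G e" for F G
  proof
    fix u show "F u = G u"
    proof (cases "u \<in> box a")
      case False thus ?thesis using that by (simp add: box_fun_def fun_on_def)
    next
      case True
      define e where "e i = (if i \<in> I then u i mod c else 0)" for i
      have "(\<lambda>i. c * (u i div c) + e i) = u"
        using off[OF True] by (auto simp: e_def fun_eq_iff)
      moreover have "e \<in> E" using c by (auto simp: E_def box_def e_def)
      ultimately show ?thesis using fun_cong[OF that(3)[of e], of "\<lambda>i. u i div c"] by (simp add: comp_def)
    qed
  qed
  have comp_surj: "\<exists>F\<in>box_fun p a. \<forall>e\<in>E. comp F e = G e" if G: "\<And>e. e \<in> E \<Longrightarrow> G e \<in> box_fun p (q e)" for G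
  proof
    define res where "res u = (\<lambda>i. if i \<in> I then u i mod c else 0)" for u :: "nat \<Rightarrow> nat"
    define F where "F u = (if u \<in> box a then G (res u) (\<lambda>i. u i div c) else 0)" for u
    have res: "res u \<in> E" for u using c by (auto simp: E_def box_def res_def)
    have "G e u \<in> Zmod p" if "e \<in> E" for e u
      by (rule fun_on_mem[OF Z0 G[OF that, unfolded box_fun_def]])
    thus "F \<in> box_fun p a" using Z0 res by (auto simp: box_fun_def fun_on_def F_def)
    show "\<forall>e\<in>E. comp F e = G e"
    proof
      fix e assume e: "e \<in> E"
      show "comp F e = G e"
      proof
        fix l
        show "comp F e l = G e l"
        proof (cases "l \<in> box (q e)")
          case False
          thus ?thesis using G[OF e] by (simp add: comp_def F_def q_iff box_fun_def fun_on_def)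
        next
          case True
          define u where "u = (\<lambda>i. c * l i + e i)"
          have u: "u \<in> box a" using True by (simp add: q_iff u_def)
          have "res u = e"
            using E_bounds[OF e] by (auto simp: res_def u_def fun_eq_iff)
          moreover have "(\<lambda>i. u i div c) = l"
          proof
            fix i
            show "u i div c = l i" using c E_bounds(1)[OF e, of i] by (simp add: u_def)
          qed
          ultimately have "F u = G e l" using u by (simp add: F_def)
          thus ?thesis by (simp add: comp_def u_def)
        qed
      qed
    qed
  qed
  define K where "K e = {F \<in> box_fun p (q e). (shifts 1 I ^^ k) F = 0}" for e
  have iter_mem: "(shifts c I ^^ k) F \<in> box_fun p a" if "F \<in> box_fun p a" for F
    by (rule funpow_closed[OF shifts_closed[OF p] that])
  have comp0: "comp 0 e = 0" for e by (auto simp: comp_def fun_eq_iff)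
  have zero_iff: "(shifts c I ^^ k) F = 0 \<longleftrightarrow> (\<forall>e\<in>E. (shifts 1 I ^^ k) (comp F e) = 0)"
    if "F \<in> box_fun p a" for F
  proof -
    have *: "(shifts 1 I ^^ k) (comp F e) = 0 \<longleftrightarrow> comp ((shifts c I ^^ k) F) e = comp 0 e" for e
      by (simp only: comp_iter comp0)
    show ?thesis
      unfolding * using comp_inj[OF iter_mem[OF that] zero_mem] by metis
  qed
  have "bij_betw (\<lambda>F. \<lambda>e\<in>E. comp F e) {F \<in> box_fun p a. (shifts c I ^^ k) F = 0} (\<Pi>\<^sub>E e\<in>E. K e)"
    unfolding bij_betw_def
  proof
    show "inj_on (\<lambda>F. \<lambda>e\<in>E. comp F e) {F \<in> box_fun p a. (shifts c I ^^ k) F = 0}"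
      by (rule inj_onI) (metis (mono_tags, lifting) comp_inj mem_Collect_eq restrict_apply')
    show "(\<lambda>F. \<lambda>e\<in>E. comp F e) ` {F \<in> box_fun p a. (shifts c I ^^ k) F = 0} = (\<Pi>\<^sub>E e\<in>E. K e)"
    proof (intro equalityI subsetI)
      fix G assume "G \<in> (\<lambda>F. \<lambda>e\<in>E. comp F e) ` {F \<in> box_fun p a. (shifts c I ^^ k) F = 0}"
      thus "G \<in> (\<Pi>\<^sub>E e\<in>E. K e)" using comp_mem zero_iff by (auto simp: K_def)
    next
      fix G assume G: "G \<in> (\<Pi>\<^sub>E e\<in>E. K e)"
      then obtain F where F: "F \<in> box_fun p a" "\<forall>e\<in>E. comp F e = G e"
        using comp_surj[of G] by (auto simp: K_def PiE_iff)
      hence "F \<in> {F \<in> box_fun p a. (shifts c I ^^ k) F = 0}"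
        using G zero_iff[OF F(1)] by (auto simp: K_def PiE_iff)
      moreover have "G = (\<lambda>e\<in>E. comp F e)"
        using F(2) G by (auto simp: fun_eq_iff PiE_iff extensional_def)
      ultimately show "G \<in> (\<lambda>F. \<lambda>e\<in>E. comp F e) ` {F \<in> box_fun p a. (shifts c I ^^ k) F = 0}"
        by blast
    qed
  qed
  hence "card {F \<in> box_fun p a. (shifts c I ^^ k) F = 0} = card (\<Pi>\<^sub>E e\<in>E. K e)"
    by (rule bij_betw_same_card)
  also have "finite E" unfolding E_def using a by (intro finite_box[of I]) (auto simp: sides_def)
  hence "card (\<Pi>\<^sub>E e\<in>E. K e) = (\<Prod>e\<in>E. card (K e))" by (rule card_PiE)
  finally show ?thesis by (simp only: E_def K_def q_def)
qed

section \<open>Dimension estimates\<close>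

definition ker_dim :: "nat \<Rightarrow> nat set \<Rightarrow> (nat \<Rightarrow> nat) \<Rightarrow> real" where
  "ker_dim p I a = log p (kernel_card p I a)"

lemma kernel_card_pos:
  assumes p: "Factorial_Ring.prime p" and a: "sides I a"
  shows "kernel_card p I a > 0"
proof -
  interpret elementary_group p "box_fun p a" by (rule elementary_group_box_fun[OF p a])
  show ?thesis unfolding kernel_card_def
    by (rule elementary_group.card_pos[OF kernel_group[OF additive_shifts]])
qed

lemma prime_gt_1_real: "Factorial_Ring.prime (p :: nat) \<Longrightarrow> real p > 1"
  using prime_gt_1_nat[of p] by simp

lemma log_card_mono:
  assumes "Factorial_Ring.prime (p :: nat)" "x > 0" "x \<le> y"
  shows "log p (real x) \<le> log p (real y)"
  using assms(2,3) prime_gt_1_real[OF assms(1)] by (intro log_mono) auto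

lemma log_prod_pos:
  assumes "\<And>x. x \<in> A \<Longrightarrow> f x > (0 :: real)" "b > 0" "b \<noteq> 1"
  shows "log b (\<Prod>x\<in>A. f x) = (\<Sum>x\<in>A. log b (f x))"
  using assms
proof (induction A rule: infinite_finite_induct)
  case (insert x A)
  have "(\<Prod>x\<in>A. f x) > 0" using insert.prems by (intro prod_pos) auto
  moreover have "f x > 0" using insert.prems by simp
  ultimately have "log b (f x * (\<Prod>x\<in>A. f x)) = log b (f x) + log b (\<Prod>x\<in>A. f x)"
    by (intro log_mult_pos)
  thus ?case using insert by simp
qed auto

lemma box_upd_1: "f j > 0 \<Longrightarrow> e \<in> box (f(j := 1)) \<longleftrightarrow> e \<in> box f \<and> e j = 0"
proof
  assume f: "f j > 0" and "e \<in> box (f(j := 1))"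
  hence *: "e i < (f(j := 1)) i" for i unfolding box_def by blast
  have "e j = 0" using *[of j] by simp
  moreover have "e i < f i" for i using *[of i] f by (cases "i = j") auto
  ultimately show "e \<in> box f \<and> e j = 0" by (simp add: box_def)
next
  assume "e \<in> box f \<and> e j = 0"
  thus "e \<in> box (f(j := 1))" by (simp add: box_def)
qed

lemma ker_dim_mono_upd:
  assumes p: "Factorial_Ring.prime p" and a: "sides I a" and i: "i \<in> I" and b: "b \<le> b'"
  shows "ker_dim p I (a(i := b)) \<le> ker_dim p I (a(i := b'))"
proof -
  interpret elementary_group p "box_fun p (a(i := 1))"
    by (rule elementary_group_box_fun[OF p sides_upd[OF a i]])
  have "(shifts 1 I ^^ b') F = 0" if "(shifts 1 I ^^ b) F = 0" for F :: "(nat \<Rightarrow> nat) \<Rightarrow> residues_prod"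
  proof -
    have "(shifts 1 I ^^ k) 0 = (0 :: (nat \<Rightarrow> nat) \<Rightarrow> residues_prod)" for k
      by (rule additive.zero[OF additive_funpow[OF additive_shifts]])
    thus ?thesis using that b funpow_add[of "b' - b" b "shifts 1 I :: ((nat \<Rightarrow> nat) \<Rightarrow> residues_prod) \<Rightarrow> _"] by simp
  qed
  hence "kernel_card p I (a(i := b)) \<le> kernel_card p I (a(i := b'))"
    unfolding kernel_card_eliminate[OF p a i] using finite_W by (intro card_mono) auto
  thus ?thesis unfolding ker_dim_def
    by (intro log_card_mono p kernel_card_pos sides_upd a i)
qed

lemma ker_dim_Suc_le:
  assumes p: "Factorial_Ring.prime p" and a: "sides I a" and i: "i \<in> I"
  shows "ker_dim p I (a(i := Suc b)) \<le> ker_dim p I (a(i := b)) + ker_dim p I (a(i := 1))"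
proof -
  interpret elementary_group p "box_fun p (a(i := 1))"
    by (rule elementary_group_box_fun[OF p sides_upd[OF a i]])
  have pos: "kernel_card p I (a(i := x)) > 0" for x
    by (intro kernel_card_pos p sides_upd a i)
  have "kernel_card p I (a(i := Suc b)) \<le> kernel_card p I (a(i := b)) * kernel_card p I (a(i := 1))"
    using card_kernel_funpow_Suc_le[OF additive_shifts shifts_closed[OF p], where k = b]
    unfolding kernel_card_eliminate[OF p a i] by simp
  hence "ker_dim p I (a(i := Suc b)) \<le> log p (real (kernel_card p I (a(i := b)) * kernel_card p I (a(i := 1))))"
    unfolding ker_dim_def by (rule log_card_mono[OF p pos])
  also have "\<dots> = ker_dim p I (a(i := b)) + ker_dim p I (a(i := 1))"
    unfolding ker_dim_def using pos prime_gt_1_real[OF p] by (simp add: log_mult)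
  finally show ?thesis .
qed

text \<open>
  With the side \<open>i\<close> equal to \<open>1\<close>, a kernel element is determined by its restriction to \<open>u j = 0\<close> for any
  other \<open>j\<close>, and only \<open>card I - 2\<close> coordinates are left.
\<close>
lemma ker_dim_one_le:
  assumes p: "Factorial_Ring.prime p" and a: "sides I a" and ij: "i \<in> I" "j \<in> I" "i \<noteq> j"
    and M: "\<And>l. l \<in> I \<Longrightarrow> a l \<le> M"
  shows "ker_dim p I (a(i := 1)) \<le> real M ^ (card I - 2)"
proof -
  have fin: "finite I" using a by (simp add: sides_def)
  define a' where "a' = a(i := 1, j := 1)"
  have a': "sides I a'" unfolding a'_def by (intro sides_upd a ij)
  interpret elementary_group p "box_fun p a'"
    by (rule elementary_group_box_fun[OF p a'])
  interpret Z: elementary_group p "Zmod p" by (rule elementary_group_Zmod[OF p])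
  have "a(i := 1) = (a(i := 1))(j := a j)" using ij by auto
  hence "kernel_card p I (a(i := 1)) = kernel_card p I ((a(i := 1))(j := a j))" by simp
  also have "\<dots> = card {F \<in> box_fun p a'. (shifts 1 I ^^ a j) F = 0}"
    unfolding a'_def by (rule kernel_card_eliminate[OF p sides_upd[OF a ij(1)] ij(2)])
  also have "\<dots> \<le> card (box_fun p a')" using finite_W by (intro card_mono) auto
  also have "\<dots> = p ^ card (box a')"
    using p prime_gt_0_nat by (simp add: box_fun_def card_fun_on finite_box[OF a'] card_Zmod)
  finally have le: "kernel_card p I (a(i := 1)) \<le> p ^ card (box a')" .
  have "card (box a') = (\<Prod>l\<in>I - {i, j}. a' l)"
    unfolding card_box[OF a'] using fin by (intro prod.mono_neutral_right) (auto simp: a'_def)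
  also have "\<dots> \<le> (\<Prod>l\<in>I - {i, j}. M)"
    by (intro prod_mono) (auto simp: a'_def M)
  also have "\<dots> = M ^ (card I - 2)" using fin ij by (simp add: card_Diff_subset numeral_2_eq_2)
  finally have box: "card (box a') \<le> M ^ (card I - 2)" .
  have "ker_dim p I (a(i := 1)) \<le> log p (real (p ^ card (box a')))"
    unfolding ker_dim_def by (intro log_card_mono p le kernel_card_pos sides_upd a ij)
  also have "\<dots> = real (card (box a'))"
    using prime_gt_1_real[OF p] by (simp add: log_nat_power)
  also have "\<dots> \<le> real M ^ (card I - 2)" using box by (simp flip: of_nat_power)
  finally show ?thesis .
qed

text \<open>
  As a function of the side \<open>b\<^sub>i\<close>, the nullity is that of \<open>T^(b\<^sub>i)\<close> for the operator \<open>T\<close> on the remaining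
  variables. It is thus monotone, and a unit step costs at most the nullity of \<open>T\<close> itself,
  which \<open>ker_dim_one_le\<close> bounds.
\<close>
theorem ker_dim_lipschitz:
  assumes p: "Factorial_Ring.prime p" and a: "sides I a" and b: "sides I b" and I: "card I \<ge> 2"
    and ab: "\<And>i. i \<in> I \<Longrightarrow> a i \<le> b i" and M: "\<And>i. i \<in> I \<Longrightarrow> b i \<le> M"
  shows "ker_dim p I a \<le> ker_dim p I b"
    and "ker_dim p I b \<le> ker_dim p I a + real (\<Sum>i\<in>I. b i - a i) * real M ^ (card I - 2)"
proof -
  have fin: "finite I" using a by (simp add: sides_def)
  have "ker_dim p I a \<le> ker_dim p I b \<and>
    ker_dim p I b \<le> ker_dim p I a + real (\<Sum>i\<in>I. b i - a i) * real M ^ (card I - 2)"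
    using b ab M
  proof (induction "\<Sum>i\<in>I. b i - a i" arbitrary: b)
    case 0
    hence "\<forall>i\<in>I. b i - a i = 0" using fin by simp
    have "a = b"
    proof
      fix i show "a i = b i"
        using \<open>\<forall>i\<in>I. b i - a i = 0\<close> 0(2) 0(3)[of i] a by (cases "i \<in> I") (auto simp: sides_def)
    qed
    thus ?case by simp
  next
    case (Suc d)
    have "\<exists>i\<in>I. b i - a i \<noteq> 0"
    proof (rule ccontr)
      assume "\<not> (\<exists>i\<in>I. b i - a i \<noteq> 0)"
      hence "(\<Sum>i\<in>I. b i - a i) = 0" by (intro sum.neutral) blast
      thus False using Suc(2) by simp
    qed
    then obtain i where i: "i \<in> I" "a i < b i" by auto
    define b' where "b' = b(i := b i - 1)"
    have bb: "b = b'(i := Suc (b i - 1))" using i by (auto simp: b'_def)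
    have b': "sides I b'" unfolding b'_def by (intro sides_upd Suc i)
    have rem: "(\<Sum>l\<in>I. f l) = f i + (\<Sum>l\<in>I - {i}. f l)" for f :: "nat \<Rightarrow> nat"
      using fin i(1) by (rule sum.remove)
    have d: "d = (\<Sum>l\<in>I. b' l - a l)"
      using Suc(2) i unfolding rem by (simp add: b'_def)
    have IH: "ker_dim p I a \<le> ker_dim p I b' \<and>
       ker_dim p I b' \<le> ker_dim p I a + real (\<Sum>i\<in>I. b' i - a i) * real M ^ (card I - 2)"
    proof (rule Suc(1)[OF d b'])
      show "a l \<le> b' l" if "l \<in> I" for l using Suc(4)[OF that] i by (auto simp: b'_def)
      show "b' l \<le> M" if "l \<in> I" for l using Suc(5)[OF that] by (auto simp: b'_def)
    qed
    have "\<exists>j\<in>I. j \<noteq> i"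
    proof (rule ccontr)
      assume "\<not> (\<exists>j\<in>I. j \<noteq> i)"
      hence "I \<subseteq> {i}" by auto
      hence "card I \<le> card {i}" by (intro card_mono) auto
      thus False using I by simp
    qed
    then obtain j where j: "j \<in> I" "i \<noteq> j" by auto
    have "ker_dim p I b \<le> ker_dim p I b' + ker_dim p I (b'(i := 1))"
      using ker_dim_Suc_le[OF p b' i(1), of "b i - 1"] unfolding bb[symmetric] by (simp add: b'_def)
    also have "b'(i := 1) = b(i := 1)" by (simp add: b'_def)
    also have "ker_dim p I (b(i := 1)) \<le> real M ^ (card I - 2)"
      by (rule ker_dim_one_le[OF p Suc(3) i(1) j]) (rule Suc(5))
    finally have up: "ker_dim p I b \<le> ker_dim p I b' + real M ^ (card I - 2)" by simp
    have "ker_dim p I b' \<le> ker_dim p I b"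
      using ker_dim_mono_upd[OF p b' i(1), of "b i - 1" "Suc (b i - 1)"] unfolding bb[symmetric]
      by (simp add: b'_def)
    thus ?case using up IH unfolding Suc(2)[symmetric] d[symmetric] by (auto simp: algebra_simps)
  qed
  thus "ker_dim p I a \<le> ker_dim p I b"
    "ker_dim p I b \<le> ker_dim p I a + real (\<Sum>i\<in>I. b i - a i) * real M ^ (card I - 2)" by auto
qed

corollary ker_dim_diff_le:
  assumes p: "Factorial_Ring.prime p" and a: "sides I a" and b: "sides I b" and I: "card I \<ge> 2"
    and ab: "\<And>i. i \<in> I \<Longrightarrow> a i \<le> b i" and M: "\<And>i. i \<in> I \<Longrightarrow> b i \<le> M"
    and D: "\<And>i. i \<in> I \<Longrightarrow> b i - a i \<le> D"
  shows "\<bar>ker_dim p I b - ker_dim p I a\<bar> \<le> real (card I) * real D * real M ^ (card I - 2)"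
proof -
  have "(\<Sum>i\<in>I. b i - a i) \<le> card I * D"
    using sum_mono[of I "\<lambda>i. b i - a i" "\<lambda>_. D"] D by simp
  hence "real (\<Sum>i\<in>I. b i - a i) \<le> real (card I) * real D"
    by (metis of_nat_le_iff of_nat_mult)
  hence "real (\<Sum>i\<in>I. b i - a i) * real M ^ (card I - 2) \<le> real (card I) * real D * real M ^ (card I - 2)"
    by (rule mult_right_mono) simp
  thus ?thesis using ker_dim_lipschitz[OF assms(1-6)] by simp
qed

lemma ker_dim_fusion:
  assumes p: "Factorial_Ring.prime p" and a: "sides I a" and ij: "i \<in> I" "j \<in> I" "i \<noteq> j"
    and bc: "b \<le> p" "c \<le> p"
  shows "ker_dim p I (a(i := b, j := c)) =
    (\<Sum>r<min b c. ker_dim p I (a(i := block p b c r, j := 1)))"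
proof -
  have "kernel_card p I (a(i := x, j := 1)) > 0" for x
    by (intro kernel_card_pos sides_upd p a ij)
  thus ?thesis
    unfolding ker_dim_def kernel_card_fusion[OF assms] of_nat_prod
    using prime_gt_1_real[OF p] by (subst log_prod_pos) auto
qed

text \<open>
  Trade one variable \<open>j\<close> for the power \<open>T^(p a\<^sub>j)\<close>, which equals the \<open>a\<^sub>j\<close>-th power of the sum of the
  \<open>p\<close>-fold shifts. By \<open>card_kernel_residue_classes\<close> the latter splits over the residue vectors modulo \<open>p\<close>
  of the other variables; there are \<open>p^(card I - 1)\<close> of them, and each contributes the nullity for \<open>a\<close>.
\<close>
lemma ker_dim_scale:
  assumes p: "Factorial_Ring.prime p" and a: "sides I a" and I: "I \<noteq> {}"
  shows "ker_dim p I (\<lambda>i. if i \<in> I then p * a i else 1) = real p ^ (card I - 1) * ker_dim p I a"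
proof -
  have p0: "p > 0" using p prime_gt_0_nat by blast
  have fin: "finite I" using a by (simp add: sides_def)
  obtain j where j: "j \<in> I" using I by auto
  define P where "P = (\<lambda>i. if i \<in> I then p * a i else 1)"
  have P: "sides I P" using fin by (simp add: sides_def P_def)
  define P' where "P' = P(j := 1)"
  have P': "sides I P'" unfolding P'_def by (rule sides_upd[OF P j])
  define T where "T = (shifts 1 I :: ((nat \<Rightarrow> nat) \<Rightarrow> residues_prod) \<Rightarrow> _)"
  have iter: "(T ^^ (p * k)) F = (shifts p I ^^ k) F" if "F \<in> box_fun p P'" for F k
    using that
  proof (induction k)
    case (Suc k)
    have "(T ^^ (p * Suc k)) F = (T ^^ p) ((T ^^ (p * k)) F)"
      by (simp add: funpow_add)
    also have "\<dots> = shifts p I ((T ^^ (p * k)) F)"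
      unfolding T_def by (intro shifts_funpow_prime[OF p P'] funpow_closed[OF shifts_closed[OF p]] Suc)
    finally show ?case using Suc by simp
  qed simp
  define E where "E = box (\<lambda>i. if i \<in> I then p else 1)"
  \<comment> \<open>The coordinate \<open>j\<close> of the reduced box has side \<open>1\<close>, so the residue vectors with \<open>e j > 0\<close> give empty
    boxes and only those in \<open>E0\<close> count.\<close>
  define E0 where "E0 = box ((\<lambda>i. if i \<in> I then p else 1)(j := 1))"
  have E: "sides I (\<lambda>i. if i \<in> I then p else 1)" using fin by (simp add: sides_def)
  have cardE0: "card E0 = p ^ (card I - 1)"
  proof -
    have "card E0 = (\<Prod>i\<in>I. ((\<lambda>i. if i \<in> I then p else 1)(j := 1)) i)"
      unfolding E0_def by (rule card_box[OF sides_upd[OF E j]])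
    also have "\<dots> = (\<Prod>i\<in>I - {j}. p)"
      using fin by (intro prod.mono_neutral_cong_right) auto
    finally show ?thesis using j fin by simp
  qed
  have E0_iff: "e \<in> E0 \<longleftrightarrow> e \<in> E \<and> e j = 0" for e
    using p0 j unfolding E0_def E_def by (intro box_upd_1) simp
  define K where "K e = card {F \<in> box_fun p (\<lambda>i. (P' i - e i + p - 1) div p). (T ^^ a j) F = 0}" for e
  have K0: "K e = kernel_card p I a" if "e \<in> E0" for e
  proof -
    have "(P' i - e i + p - 1) div p = (a(j := 1)) i" for i
    proof -
      have ei: "e i < ((\<lambda>i. if i \<in> I then p else 1)(j := 1)) i"
        using that unfolding E0_def box_def by blast
      consider "i = j \<or> i \<notin> I" | "i \<in> I" "i \<noteq> j" "a i = 0" | "i \<in> I" "i \<noteq> j" "a i > 0" by auto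
      thus ?thesis
      proof cases
        case 1
        hence "e i = 0" "P' i = 1" using ei by (auto simp: P'_def P_def split: if_splits)
        thus ?thesis using 1 p0 a by (auto simp: sides_def)
      next
        case 2
        thus ?thesis using p0 by (simp add: P'_def P_def)
      next
        case 3
        hence "e i < p" "p * a i \<ge> p" "P' i = p * a i" using ei by (auto simp: P'_def P_def)
        hence "P' i - e i + p - 1 = p * a i + (p - 1 - e i)" by linarith
        thus ?thesis using 3 p0 by (simp add: div_add1_eq)
      qed
    qed
    hence "(\<lambda>i. (P' i - e i + p - 1) div p) = a(j := 1)" by (rule ext)
    thus ?thesis unfolding K_def T_def
      using kernel_card_eliminate[OF p a j, of "a j"] by simp
  qed
  have K1: "K e = 1" if "e \<in> E - E0" for e
  proof -
    have "e j > 0" using that by (simp add: E0_iff)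
    hence z: "(P' j - e j + p - 1) div p = 0" using p0 by (simp add: P'_def)
    have "u \<notin> box (\<lambda>i. (P' i - e i + p - 1) div p)" for u
    proof
      assume "u \<in> box (\<lambda>i. (P' i - e i + p - 1) div p)"
      hence "u j < (P' j - e j + p - 1) div p" unfolding box_def by blast
      thus False using z by simp
    qed
    hence "box_fun p (\<lambda>i. (P' i - e i + p - 1) div p) = {0}"
      by (auto simp: box_fun_def fun_on_def)
    moreover have "(T ^^ k) 0 = 0" for k
      unfolding T_def by (rule additive.zero[OF additive_funpow[OF additive_shifts]])
    ultimately have "{F \<in> box_fun p (\<lambda>i. (P' i - e i + p - 1) div p). (T ^^ a j) F = 0} = {0}"
      by auto
    thus ?thesis by (simp add: K_def)
  qed
  have "kernel_card p I P = kernel_card p I (P(j := p * a j))" using j by (simp add: P_def fun_upd_idem)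
  also have "\<dots> = card {F \<in> box_fun p P'. (T ^^ (p * a j)) F = 0}"
    unfolding P'_def T_def by (rule kernel_card_eliminate[OF p P j])
  also have "\<dots> = card {F \<in> box_fun p P'. (shifts p I ^^ a j) F = 0}"
    using iter by (intro arg_cong[of _ _ card]) auto
  also have "\<dots> = (\<Prod>e\<in>E. K e)"
    unfolding card_kernel_residue_classes[OF p P' p0] E_def K_def T_def ..
  also have "\<dots> = (\<Prod>e\<in>E0. K e)"
    using finite_box[OF E] K1 by (intro prod.mono_neutral_right) (auto simp: E_def E0_iff)
  also have "\<dots> = kernel_card p I a ^ (p ^ (card I - 1))"
    by (simp add: K0 cardE0)
  finally show ?thesis
    unfolding ker_dim_def P_def[symmetric]
    using kernel_card_pos[OF p a] prime_gt_1_real[OF p] by (simp add: log_nat_power)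
qed

section \<open>The zigzag polynomials\<close>

text \<open>
  The coefficient of \<open>z^n\<close> in \<open>(sec z + tan z) cos (vz) - sin (vz)\<close>, a polynomial of degree \<open>n\<close> in \<open>v\<close>. Its value
  at \<open>v = 0\<close> is the Euler zigzag number divided by \<open>n!\<close>.
\<close>
definition zigzag :: "nat \<Rightarrow> real \<Rightarrow> real" where
  "zigzag n v = fps_nth (sec_plus_tan * fps_cos v - fps_sin v) n"

lemma sec_plus_tan_times_cos: "sec_plus_tan * fps_cos 1 = 1 + fps_sin 1"
proof -
  have 0: "fps_nth (fps_cos (1::real)) 0 \<noteq> 0" by simp
  have "inverse (fps_cos (1::real)) * fps_cos 1 = 1"
    by (rule inverse_mult_eq_1[OF 0])
  moreover have "fps_tan (1::real) * fps_cos 1 = fps_sin 1"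
    unfolding fps_tan_def using 0 by (simp add: fps_divide_unit mult.assoc inverse_mult_eq_1)
  ultimately show ?thesis by (simp add: sec_plus_tan_def distrib_right)
qed

lemma sec_plus_tan_times_sin: "sec_plus_tan * fps_sin 1 + fps_cos 1 = sec_plus_tan"
proof -
  have "(sec_plus_tan * fps_sin 1 + fps_cos 1) * fps_cos 1 =
      (sec_plus_tan * fps_cos 1) * fps_sin 1 + (fps_cos 1)\<^sup>2"
    by (simp add: algebra_simps power2_eq_square)
  also have "\<dots> = fps_sin 1 + ((fps_cos 1)\<^sup>2 + (fps_sin 1)\<^sup>2)"
    by (simp add: sec_plus_tan_times_cos algebra_simps power2_eq_square)
  also have "\<dots> = sec_plus_tan * fps_cos 1"
    by (simp add: fps_sin_cos_sum_of_squares sec_plus_tan_times_cos)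
  finally have *: "(sec_plus_tan * fps_sin 1 + fps_cos 1) * fps_cos 1 = sec_plus_tan * fps_cos 1" .
  have "fps_nth (fps_cos (1::real)) 0 \<noteq> fps_nth 0 0" by simp
  hence "fps_cos (1::real) \<noteq> 0" by metis
  thus ?thesis using * by simp
qed

text \<open>
  The left side is the generating function at \<open>1 - v\<close>, the right side is the negative of its \<open>v\<close>-derivative
  at \<open>v\<close>, divided by \<open>z\<close>. By the addition theorems everything reduces to the identities
  \<open>(sec z + tan z) cos z - sin z = 1\<close> and \<open>(sec z + tan z) sin z + cos z = sec z + tan z\<close>.
\<close>
lemma zigzag_reflect:
  "sec_plus_tan * fps_cos (1 - v) - fps_sin (1 - v) = sec_plus_tan * fps_sin v + fps_cos v"
proof -
  have "sec_plus_tan * fps_cos (1 - v) - fps_sin (1 - v) =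
     (sec_plus_tan * fps_cos 1 - fps_sin 1) * fps_cos v + (sec_plus_tan * fps_sin 1 + fps_cos 1) * fps_sin v"
    using fps_cos_add[of 1 "- v"] fps_sin_add[of 1 "- v"]
    by (simp add: fps_sin_even fps_cos_odd algebra_simps)
  thus ?thesis by (simp add: sec_plus_tan_times_cos sec_plus_tan_times_sin)
qed

lemma Suc_times_divide_fact: "c * (real (Suc m) * x) / fact (Suc m) = c * x / (fact m :: real)"
proof -
  have "c * (real (Suc m) * x) / fact (Suc m) = (real (Suc m) * (c * x)) / (real (Suc m) * fact m)"
    by (simp only: fact_Suc mult_ac)
  also have "\<dots> = c * x / fact m" by (rule mult_divide_mult_cancel_left) (simp del: of_nat_Suc)
  finally show ?thesis .
qed

lemma DERIV_fps_sin_nth: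
  "((\<lambda>v. fps_nth (fps_sin v) n) has_real_derivative (case n of 0 \<Rightarrow> 0 | Suc m \<Rightarrow> fps_nth (fps_cos v) m)) (at v)"
proof (cases n)
  case (Suc m)
  show ?thesis
  proof (cases "even n")
    case False
    hence m: "even m" "m - 0 = m" using Suc by auto
    have "((\<lambda>v. (-1) ^ (m div 2) * v ^ Suc m / fact (Suc m)) has_real_derivative
       (-1) ^ (m div 2) * (real (Suc m) * v ^ m) / fact (Suc m)) (at v)"
      using DERIV_pow[of "Suc m" v] by (intro DERIV_cdivide DERIV_cmult) simp
    also have "(-1) ^ (m div 2) * (real (Suc m) * v ^ m) / fact (Suc m) = (-1) ^ (m div 2) * v ^ m / fact m"
      by (rule Suc_times_divide_fact)
    finally show ?thesis using m Suc by (simp add: fps_sin_def fps_cos_def del: fact_Suc)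
  qed (auto simp: fps_sin_def fps_cos_def Suc)
qed auto

lemma DERIV_fps_cos_nth:
  "((\<lambda>v. fps_nth (fps_cos v) n) has_real_derivative (case n of 0 \<Rightarrow> 0 | Suc m \<Rightarrow> - fps_nth (fps_sin v) m)) (at v)"
proof (cases n)
  case (Suc m)
  show ?thesis
  proof (cases "even n")
    case True
    hence m: "odd m" using Suc by auto
    then obtain l where l: "m = 2 * l + 1" by (elim oddE)
    have "((\<lambda>v. (-1) ^ (Suc m div 2) * v ^ Suc m / fact (Suc m)) has_real_derivative
       (-1) ^ (Suc m div 2) * (real (Suc m) * v ^ m) / fact (Suc m)) (at v)"
      using DERIV_pow[of "Suc m" v] by (intro DERIV_cdivide DERIV_cmult) simp
    also have "(-1) ^ (Suc m div 2) * (real (Suc m) * v ^ m) / fact (Suc m) = - ((-1) ^ ((m - 1) div 2) * v ^ m / fact m)"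
      unfolding Suc_times_divide_fact using l by simp
    finally show ?thesis using m Suc by (simp add: fps_sin_def fps_cos_def del: fact_Suc)
  qed (auto simp: fps_sin_def fps_cos_def Suc)
qed auto

lemma DERIV_zigzag: "(zigzag (Suc n) has_real_derivative - zigzag n (1 - v)) (at v)"
proof -
  define A where "A = fps_nth sec_plus_tan"
  have eq: "zigzag (Suc n) = (\<lambda>v. (\<Sum>i\<le>Suc n. A i * fps_nth (fps_cos v) (Suc n - i)) - fps_nth (fps_sin v) (Suc n))"
    by (auto simp: zigzag_def fps_mult_nth A_def fun_eq_iff atMost_atLeast0)
  have "(zigzag (Suc n) has_real_derivative
      (\<Sum>i\<le>Suc n. A i * (case Suc n - i of 0 \<Rightarrow> 0 | Suc m \<Rightarrow> - fps_nth (fps_sin v) m)) - fps_nth (fps_cos v) n) (at v)"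
    unfolding eq
    using DERIV_fps_sin_nth[of "Suc n" v]
    by (intro DERIV_diff DERIV_sum DERIV_cmult DERIV_fps_cos_nth) auto
  also have "(\<Sum>i\<le>Suc n. A i * (case Suc n - i of 0 \<Rightarrow> 0 | Suc m \<Rightarrow> - fps_nth (fps_sin v) m)) =
     (\<Sum>i\<le>n. A i * - fps_nth (fps_sin v) (n - i))"
    by (simp add: Suc_diff_le)
  also have "\<dots> - fps_nth (fps_cos v) n = - fps_nth (sec_plus_tan * fps_sin v + fps_cos v) n"
    by (simp add: fps_mult_nth A_def atMost_atLeast0 sum_negf)
  also have "\<dots> = - zigzag n (1 - v)"
    by (simp only: zigzag_reflect[symmetric] zigzag_def)
  finally show ?thesis .
qed

lemma zigzag_at_1: "zigzag n 1 = (if n = 0 then 1 else 0)"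
  by (simp add: zigzag_def sec_plus_tan_times_cos)

lemma zigzag_0_left: "zigzag 0 v = 1"
proof -
  have "zigzag 0 v = zigzag 0 1" by (simp add: zigzag_def)
  thus ?thesis by (simp add: zigzag_at_1)
qed

lemma zigzag_at_0: "zigzag n 0 = fps_nth sec_plus_tan n"
  by (simp add: zigzag_def)

lemma isCont_zigzag: "isCont (zigzag n) v"
proof (cases n)
  case 0
  have "zigzag 0 = (\<lambda>_. 1)" by (auto simp: zigzag_0_left)
  thus ?thesis using 0 by simp
next
  case (Suc m)
  thus ?thesis using DERIV_isCont[OF DERIV_zigzag] by blast
qed

lemma zigzag_bounded: "\<exists>B\<ge>0. \<forall>v\<in>{0..1}. \<bar>zigzag n v\<bar> \<le> B"
proof -
  have "\<exists>M. \<forall>x. 0 \<le> x \<and> x \<le> 1 \<longrightarrow> \<bar>zigzag n x\<bar> \<le> M"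
    using isCont_zigzag by (intro isCont_bounded) (auto intro!: continuous_intros)
  then obtain M where "\<forall>x. 0 \<le> x \<and> x \<le> 1 \<longrightarrow> \<bar>zigzag n x\<bar> \<le> M" by blast
  hence "\<forall>v\<in>{0..1}. \<bar>zigzag n v\<bar> \<le> max M 0" by (auto intro: order.trans[of _ M])
  thus ?thesis by (intro exI[of _ "max M 0"]) auto
qed

lemma zigzag_lipschitz:
  "\<exists>L\<ge>0. \<forall>u\<in>{0..1}. \<forall>v\<in>{0..1}. \<bar>zigzag n u - zigzag n v\<bar> \<le> L * \<bar>u - v\<bar>"
proof (cases n)
  case 0
  thus ?thesis by (intro exI[of _ 0]) (auto simp: zigzag_0_left)
next
  case (Suc m)
  obtain B where B: "B \<ge> 0" "\<forall>v\<in>{0..1}. \<bar>zigzag m v\<bar> \<le> B" using zigzag_bounded by blast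
  have *: "\<bar>zigzag n u - zigzag n v\<bar> \<le> B * \<bar>u - v\<bar>" if uv: "u \<in> {0..1}" "v \<in> {0..1}" "u < v" for u v
  proof -
    obtain z where z: "u < z" "z < v" "zigzag n v - zigzag n u = (v - u) * (- zigzag m (1 - z))"
      using MVT2[OF uv(3), of "zigzag n" "\<lambda>z. - zigzag m (1 - z)"] DERIV_zigzag Suc by auto
    have "\<bar>zigzag m (1 - z)\<bar> \<le> B" using B z uv by auto
    hence "(v - u) * \<bar>zigzag m (1 - z)\<bar> \<le> (v - u) * B" using uv by (intro mult_left_mono) auto
    moreover have "\<bar>zigzag n u - zigzag n v\<bar> = (v - u) * \<bar>zigzag m (1 - z)\<bar>"
      using z uv by (simp add: abs_minus_commute[of "zigzag n u"] abs_mult)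
    ultimately show ?thesis using uv by (simp add: mult.commute)
  qed
  have "\<bar>zigzag n u - zigzag n v\<bar> \<le> B * \<bar>u - v\<bar>" if "u \<in> {0..1}" "v \<in> {0..1}" for u v
    using *[of u v] *[of v u] that by (cases u v rule: linorder_cases) (auto simp: abs_minus_commute)
  thus ?thesis using B(1) by blast
qed

text \<open>
  The limit shape of the block counts: \<open>block_count p n k\<close> is close to \<open>p^n * profile n (k / p)\<close>.
\<close>
definition profile :: "nat \<Rightarrow> real \<Rightarrow> real" where
  "profile n x = (x + zigzag n \<bar>1 - 2 * x\<bar> / 2) / 2 ^ n"

text \<open>
  An antiderivative of the profile. The constants on the two sides of \<open>1/2\<close> match because
  \<open>zigzag (n + 1) 1 = 0\<close>.
\<close>
definition profile_integral :: "nat \<Rightarrow> real \<Rightarrow> real" where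
  "profile_integral n x = (x\<^sup>2 / 2 + (if x \<le> 1/2 then - zigzag (Suc n) (2 * x) else zigzag (Suc n) (2 - 2 * x)) / 4) / 2 ^ n"

lemma profile_lipschitz:
  "\<exists>L\<ge>0. \<forall>x\<in>{0..1}. \<forall>y\<in>{0..1}. \<bar>profile n x - profile n y\<bar> \<le> L * \<bar>x - y\<bar>"
proof -
  obtain L where L: "L \<ge> 0" "\<forall>u\<in>{0..1}. \<forall>v\<in>{0..1}. \<bar>zigzag n u - zigzag n v\<bar> \<le> L * \<bar>u - v\<bar>"
    using zigzag_lipschitz by blast
  have "\<bar>profile n x - profile n y\<bar> \<le> (1 + L) * \<bar>x - y\<bar>" if xy: "x \<in> {0..1}" "y \<in> {0..1}" for x y
  proof -
    have "\<bar>1 - 2 * x\<bar> \<in> {0..1}" "\<bar>1 - 2 * y\<bar> \<in> {0..1}" using xy by auto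
    hence "\<bar>zigzag n \<bar>1 - 2 * x\<bar> - zigzag n \<bar>1 - 2 * y\<bar>\<bar> \<le> L * \<bar>\<bar>1 - 2 * x\<bar> - \<bar>1 - 2 * y\<bar>\<bar>"
      using L by blast
    also have "\<dots> \<le> L * (2 * \<bar>x - y\<bar>)" using L(1) by (intro mult_left_mono) (auto simp: abs_if)
    finally have *: "\<bar>zigzag n \<bar>1 - 2 * x\<bar> - zigzag n \<bar>1 - 2 * y\<bar>\<bar> \<le> L * (2 * \<bar>x - y\<bar>)" .
    have "\<bar>profile n x - profile n y\<bar> =
        \<bar>(x - y) + (zigzag n \<bar>1 - 2 * x\<bar> - zigzag n \<bar>1 - 2 * y\<bar>) / 2\<bar> / 2 ^ n"
    proof -
      have "profile n x - profile n y =
          ((x - y) + (zigzag n \<bar>1 - 2 * x\<bar> - zigzag n \<bar>1 - 2 * y\<bar>) / 2) / 2 ^ n"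
        by (simp add: profile_def diff_divide_distrib add_divide_distrib)
      thus ?thesis by (simp add: abs_divide)
    qed
    also have "\<dots> \<le> \<bar>(x - y) + (zigzag n \<bar>1 - 2 * x\<bar> - zigzag n \<bar>1 - 2 * y\<bar>) / 2\<bar> / 1"
      by (intro divide_left_mono) auto
    also have "\<dots> \<le> \<bar>x - y\<bar> + \<bar>(zigzag n \<bar>1 - 2 * x\<bar> - zigzag n \<bar>1 - 2 * y\<bar>) / 2\<bar>"
      unfolding div_by_1 by (rule abs_triangle_ineq)
    also have "\<dots> \<le> \<bar>x - y\<bar> + L * \<bar>x - y\<bar>"
      using * unfolding abs_divide by (intro add_left_mono) simp
    also have "\<dots> = (1 + L) * \<bar>x - y\<bar>" by (simp add: distrib_right)
    finally show ?thesis .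
  qed
  thus ?thesis using L(1) by (intro exI[of _ "1 + L"]) auto
qed

lemma profile_bounded: "\<exists>B\<ge>0. \<forall>x\<in>{0..1}. \<bar>profile n x\<bar> \<le> B"
proof -
  obtain L where L: "L \<ge> 0" "\<forall>x\<in>{0..1}. \<forall>y\<in>{0..1}. \<bar>profile n x - profile n y\<bar> \<le> L * \<bar>x - y\<bar>"
    using profile_lipschitz by blast
  have "\<bar>profile n x\<bar> \<le> \<bar>profile n 0\<bar> + L" if x: "x \<in> {0..1}" for x
  proof -
    have "\<bar>profile n x - profile n 0\<bar> \<le> L * \<bar>x - 0\<bar>"
      using L(2) x by (meson atLeastAtMost_iff order.refl zero_le_one)
    also have "\<dots> \<le> L * 1" using L(1) x by (intro mult_left_mono) auto
    finally show ?thesis by linarith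
  qed
  thus ?thesis using L(1) by (intro exI[of _ "\<bar>profile n 0\<bar> + L"]) auto
qed

lemma DERIV_mean_bounds:
  fixes F f :: "real \<Rightarrow> real"
  assumes "x \<le> y" and F: "\<And>z. x \<le> z \<Longrightarrow> z \<le> y \<Longrightarrow> (F has_real_derivative f z) (at z)"
    and b: "\<And>z. x \<le> z \<Longrightarrow> z \<le> y \<Longrightarrow> lo \<le> f z \<and> f z \<le> hi"
  shows "(y - x) * lo \<le> F y - F x \<and> F y - F x \<le> (y - x) * hi"
proof (cases "x = y")
  case False
  then obtain z where z: "x < z" "z < y" "F y - F x = (y - x) * f z"
    using MVT2[of x y F f] assms by auto
  show ?thesis unfolding z(3) using b[of z] z by (auto intro!: mult_left_mono)
qed auto

text \<open>
  The mean value theorem in the form needed for Riemann sums, over intervals that may contain the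
  point \<open>1/2\<close>, where the two branches of the antiderivative meet.
\<close>
lemma profile_integral_mean_bounds:
  assumes xy: "x \<le> y"
    and b: "\<And>z. x \<le> z \<Longrightarrow> z \<le> y \<Longrightarrow> lo \<le> profile n z \<and> profile n z \<le> hi"
  shows "(y - x) * lo \<le> profile_integral n y - profile_integral n x \<and>
    profile_integral n y - profile_integral n x \<le> (y - x) * hi"
proof -
  define P Q where "P x = (x\<^sup>2 / 2 - zigzag (Suc n) (2 * x) / 4) / 2 ^ n"
    and "Q x = (x\<^sup>2 / 2 + zigzag (Suc n) (2 - 2 * x) / 4) / 2 ^ n" for x
  have P: "(P has_real_derivative profile n z) (at z)" if "z \<le> 1/2" for z
  proof -
    have "((\<lambda>x. zigzag (Suc n) (2 * x)) has_real_derivative - zigzag n (1 - 2 * z) * 2) (at z)"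
      by (rule DERIV_chain2[OF DERIV_zigzag]) (auto intro!: derivative_eq_intros)
    hence "(P has_real_derivative (z - (- zigzag n (1 - 2 * z) * 2) / 4) / 2 ^ n) (at z)"
      unfolding P_def by (auto intro!: derivative_eq_intros)
    thus ?thesis using that by (simp add: profile_def)
  qed
  have Q: "(Q has_real_derivative profile n z) (at z)" if "z \<ge> 1/2" for z
  proof -
    have "((\<lambda>x. zigzag (Suc n) (2 - 2 * x)) has_real_derivative - zigzag n (1 - (2 - 2 * z)) * - 2) (at z)"
      by (rule DERIV_chain2[OF DERIV_zigzag]) (auto intro!: derivative_eq_intros)
    hence "(Q has_real_derivative (z + (- zigzag n (1 - (2 - 2 * z)) * - 2) / 4) / 2 ^ n) (at z)"
      unfolding Q_def by (auto intro!: derivative_eq_intros)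
    moreover have "\<bar>1 - 2 * z\<bar> = 1 - (2 - 2 * z)" using that by auto
    ultimately show ?thesis by (simp add: profile_def)
  qed
  have IP: "profile_integral n z = P z" if "z \<le> 1/2" for z
    using that by (simp add: profile_integral_def P_def)
  have half: "P (1/2) = Q (1/2)" by (simp add: P_def Q_def zigzag_at_1)
  have IQ: "profile_integral n z = Q z" if "z \<ge> 1/2" for z
  proof (cases "z = 1/2")
    case True
    show ?thesis using IP[of "1/2"] half unfolding True by simp
  next
    case False
    thus ?thesis using that by (simp add: profile_integral_def Q_def)
  qed
  consider "y \<le> 1/2" | "x \<ge> 1/2" | "x \<le> 1/2" "1/2 \<le> y" by linarith
  thus ?thesis
  proof cases
    case 1
    thus ?thesis using DERIV_mean_bounds[OF xy P b] xy by (auto simp: IP)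
  next
    case 2
    thus ?thesis using DERIV_mean_bounds[OF xy Q b] xy by (auto simp: IQ)
  next
    case 3
    have "(1/2 - x) * lo \<le> P (1/2) - P x \<and> P (1/2) - P x \<le> (1/2 - x) * hi"
      using 3 by (intro DERIV_mean_bounds[OF 3(1) P]) (auto intro!: b[THEN conjunct1] b[THEN conjunct2])
    moreover have "(y - 1/2) * lo \<le> Q y - Q (1/2) \<and> Q y - Q (1/2) \<le> (y - 1/2) * hi"
      using 3 by (intro DERIV_mean_bounds[OF 3(2) Q]) (auto intro!: b[THEN conjunct1] b[THEN conjunct2])
    ultimately show ?thesis using 3 half by (simp add: IP IQ algebra_simps)
  qed
qed

text \<open>
  The integral recursion that mirrors the recursion of the block counts: the first term accounts for the blocks of
  full length \<open>p\<close>, the integral for the blocks of lengths \<open>b + c - 1 - 2r\<close>, whose spacing \<open>2\<close> is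
  responsible for the factor \<open>1/2\<close>.
\<close>
lemma profile_Suc:
  assumes n: "n \<ge> 1" and x: "0 \<le> x" "x \<le> 1"
  shows "profile (Suc n) x = max 0 (x - 1/2) * profile n 1 +
    (profile_integral n (1 - \<bar>x - 1/2\<bar>) - profile_integral n \<bar>x - 1/2\<bar>) / 2"
proof -
  define y where "y = \<bar>x - 1/2\<bar>"
  have y: "0 \<le> y" "y \<le> 1/2" using x unfolding y_def by linarith+
  have v: "\<bar>1 - 2 * x\<bar> = 2 * y" by (auto simp: y_def abs_if)
  have one: "profile n 1 = 1 / 2 ^ n" using n by (simp add: profile_def zigzag_at_1)
  have D: "profile_integral n (1 - y) - profile_integral n y = ((1 - 2 * y) + zigzag (Suc n) (2 * y)) / 2 ^ Suc n"
  proof (cases "y = 1/2")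
    case True show ?thesis unfolding True by (simp add: zigzag_at_1)
  next
    case False
    hence "\<not> 1 - y \<le> 1/2" using y by auto
    thus ?thesis using y by (simp add: profile_integral_def field_simps power2_eq_square)
  qed
  have "max 0 (x - 1/2) * profile n 1 + (profile_integral n (1 - y) - profile_integral n y) / 2 =
     (2 * max 0 (x - 1/2) + 1/2 - y + zigzag (Suc n) (2 * y) / 2) / 2 ^ Suc n"
    unfolding one D by (simp add: field_simps)
  also have "2 * max 0 (x - 1/2) + 1/2 - y = x" by (auto simp: y_def max_def)
  finally show ?thesis by (simp add: profile_def v flip: y_def)
qed

section \<open>Asymptotics of the block counts\<close>

text \<open>
  The nullity for \<open>n\<close> variables of side \<open>(p - 1)/2\<close> and one variable of side \<open>k\<close>, computed by merging the
  variables one at a time into the last one. A single variable is a single nilpotent Jordan block and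
  has nullity \<open>1\<close>.
\<close>
fun block_count :: "nat \<Rightarrow> nat \<Rightarrow> nat \<Rightarrow> nat" where
  "block_count p 0 k = 1"
| "block_count p (Suc n) k = (\<Sum>t<min k ((p - 1) div 2). block_count p n (block p k ((p - 1) div 2) t))"

text \<open>
  The sample points have distance \<open>2/p\<close>, and each is the midpoint of the interval between two
  consecutive points \<open>(N - 2t)/p\<close>, on which the profile differs from the sampled value by at most \<open>L/p\<close>.
\<close>
lemma riemann_sum_profile:
  assumes L: "L \<ge> 0" "\<forall>x\<in>{0..1}. \<forall>y\<in>{0..1}. \<bar>profile n x - profile n y\<bar> \<le> L * \<bar>x - y\<bar>"
    and p: "p > 0" and lm: "d \<le> m" "2 * m \<le> N" "N - 2 * d \<le> p"
  shows "\<bar>(\<Sum>t\<in>{d..<m}. profile n ((real N - 1 - 2 * real t) / real p)) -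
      real p / 2 * (profile_integral n ((real N - 2 * real d) / real p) - profile_integral n ((real N - 2 * real m) / real p))\<bar>
     \<le> (real m - real d) * (L / real p)"
  using lm
proof (induction m)
  case (Suc m)
  define g where "g t = (real N - 2 * real t) / real p" for t
  define I where "I = profile_integral n"
  show ?case
  proof (cases "d = Suc m")
    case False
    hence dm: "d \<le> m" using Suc by simp
    define z where "z = (real N - 1 - 2 * real m) / real p"
    have range: "x \<in> {0..1}" if "g (Suc m) \<le> x" "x \<le> g m" for x
    proof -
      have "real (2 * Suc m) \<le> real N" using Suc.prems by (simp only: of_nat_le_iff)
      hence "g (Suc m) \<ge> 0" using p by (simp add: g_def)
      moreover have "N - 2 * m \<le> p" using Suc.prems dm by linarith
      hence "real (N - 2 * m) \<le> real p" by (simp only: of_nat_le_iff)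
      hence "g m \<le> 1" using p Suc.prems by (simp add: g_def of_nat_diff)
      ultimately show ?thesis using that by auto
    qed
    have gz: "g (Suc m) = z - 1 / real p" "g m = z + 1 / real p"
      using p by (auto simp: g_def z_def field_simps)
    have zr: "g (Suc m) \<le> z" "z \<le> g m" using p by (auto simp: gz)
    have b: "profile n z - L / real p \<le> profile n x \<and> profile n x \<le> profile n z + L / real p"
      if "g (Suc m) \<le> x" "x \<le> g m" for x
    proof -
      have "\<bar>profile n x - profile n z\<bar> \<le> L * \<bar>x - z\<bar>"
        using L(2) range[OF that] range[OF zr] by blast
      also have "\<dots> \<le> L * (1 / real p)" using L(1) that unfolding gz by (intro mult_left_mono) auto
      finally show ?thesis by (simp add: abs_le_iff)
    qed
    have "(g m - g (Suc m)) * (profile n z - L / real p) \<le> I (g m) - I (g (Suc m)) \<and>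
        I (g m) - I (g (Suc m)) \<le> (g m - g (Suc m)) * (profile n z + L / real p)"
      unfolding I_def using zr b by (intro profile_integral_mean_bounds) auto
    moreover have "g m - g (Suc m) = 2 / real p" unfolding gz by simp
    ultimately have "real p / 2 * (2 / real p * (profile n z - L / real p)) \<le> real p / 2 * (I (g m) - I (g (Suc m)))"
      "real p / 2 * (I (g m) - I (g (Suc m))) \<le> real p / 2 * (2 / real p * (profile n z + L / real p))"
      by (auto intro!: mult_left_mono simp del: times_divide_eq_left)
    moreover have "real p / 2 * (2 / real p * c) = c" for c using p by simp
    ultimately have step: "\<bar>profile n z - real p / 2 * (I (g m) - I (g (Suc m)))\<bar> \<le> L / real p"
      by (simp only: abs_le_iff) linarith
    have IH: "\<bar>(\<Sum>t\<in>{d..<m}. profile n ((real N - 1 - 2 * real t) / real p)) -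
        real p / 2 * (I (g d) - I (g m))\<bar> \<le> (real m - real d) * (L / real p)"
      using Suc.IH dm Suc.prems by (simp add: g_def I_def)
    have "(\<Sum>t\<in>{d..<Suc m}. profile n ((real N - 1 - 2 * real t) / real p)) -
         real p / 2 * (I (g d) - I (g (Suc m))) =
      ((\<Sum>t\<in>{d..<m}. profile n ((real N - 1 - 2 * real t) / real p)) - real p / 2 * (I (g d) - I (g m)))
       + (profile n z - real p / 2 * (I (g m) - I (g (Suc m))))"
      using dm by (simp add: z_def algebra_simps)
    also have "\<bar>\<dots>\<bar> \<le> (real m - real d) * (L / real p) + L / real p"
      using IH step by (rule abs_triangle_ineq[THEN order.trans, OF add_mono])
    also have "\<dots> = (real (Suc m) - real d) * (L / real p)"
    proof -
      have "(real m - real d) * c + c = (real (Suc m) - real d) * c" for c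
        by (simp add: algebra_simps)
      thus ?thesis .
    qed
    finally show ?thesis by (simp only: g_def I_def)
  qed simp
qed simp

text \<open>
  Three errors are added in the induction step, each of order \<open>p^n\<close> and uniform in \<open>k\<close>: the error of the
  previous step, summed over at most \<open>p\<close> blocks; the error of the Riemann sum; and the effect of replacing the
  number of full blocks and the integration limits by their continuous counterparts, from which they differ
  by \<open>O(1)\<close> and \<open>O(1/p)\<close>. The induction starts at \<open>n = 1\<close>: for \<open>n = 0\<close> the count is constant, whereas the
  profile is not.
\<close>
lemma block_count_profile:
  assumes "n \<ge> 1"
  shows "\<exists>C\<ge>0. \<forall>p k. odd p \<longrightarrow> k \<le> p \<longrightarrow>
    \<bar>real (block_count p n k) - real p ^ n * profile n (real k / real p)\<bar> \<le> C * real p ^ (n - 1)"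
  using assms
proof (induction n rule: nat_induct_at_least)
  case base
  have "\<bar>real (block_count p 1 k) - real p ^ 1 * profile 1 (real k / real p)\<bar> \<le> 1" if "odd p" "k \<le> p" for p k
  proof -
    obtain a where p: "p = 2 * a + 1" using \<open>odd p\<close> by (elim oddE)
    have Z: "zigzag 1 v = 1 - v" for v
    proof -
      have 1: "fps_nth (sec_plus_tan * fps_cos 1) 1 = fps_nth (1 + fps_sin 1) 1"
        by (simp add: sec_plus_tan_times_cos)
      have 0: "fps_nth (sec_plus_tan * fps_cos 1) 0 = fps_nth (1 + fps_sin 1) 0"
        by (simp add: sec_plus_tan_times_cos)
      show ?thesis using 0 1 by (simp add: zigzag_def fps_mult_nth)
    qed
    have "real p ^ 1 * profile 1 (real k / real p) = (real k + (real p - \<bar>real p - 2 * real k\<bar>) / 2) / 2"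
    proof -
      have p0: "real p > 0" using p by simp
      have "\<bar>1 - 2 * (real k / real p)\<bar> = \<bar>real p - 2 * real k\<bar> / real p"
        using p0 by (simp add: field_simps abs_if)
      thus ?thesis using p0 by (simp add: profile_def Z[unfolded One_nat_def] field_simps)
    qed
    moreover have "block_count p 1 k = min k a" using p by simp
    ultimately show ?thesis using p by (auto simp: min_def abs_if field_simps)
  qed
  thus ?case by (intro exI[of _ 1]) auto
next
  case (Suc n)
  obtain C where C: "C \<ge> 0" "\<And>p k. odd p \<Longrightarrow> k \<le> p \<Longrightarrow>
    \<bar>real (block_count p n k) - real p ^ n * profile n (real k / real p)\<bar> \<le> C * real p ^ (n - 1)"
    using Suc.IH by blast
  obtain L where L: "L \<ge> 0" "\<forall>x\<in>{0..1}. \<forall>y\<in>{0..1}. \<bar>profile n x - profile n y\<bar> \<le> L * \<bar>x - y\<bar>"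
    using profile_lipschitz by blast
  obtain B where B: "B \<ge> 0" "\<forall>x\<in>{0..1}. \<bar>profile n x\<bar> \<le> B"
    using profile_bounded by blast
  have I_lip: "\<bar>profile_integral n x - profile_integral n y\<bar> \<le> B * \<bar>x - y\<bar>"
    if "x \<in> {0..1}" "y \<in> {0..1}" for x y
  proof -
    have *: "\<bar>profile_integral n y - profile_integral n x\<bar> \<le> B * \<bar>y - x\<bar>"
      if "x \<in> {0..1}" "y \<in> {0..1}" "x \<le> y" for x y
    proof -
      have "- B \<le> profile n z \<and> profile n z \<le> B" if "x \<le> z" "z \<le> y" for z
      proof -
        have "\<bar>profile n z\<bar> \<le> B" using B(2) that \<open>x \<in> {0..1}\<close> \<open>y \<in> {0..1}\<close> by auto
        thus ?thesis by linarith
      qed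
      from profile_integral_mean_bounds[OF \<open>x \<le> y\<close> this]
      show ?thesis using \<open>x \<le> y\<close> by (auto simp: abs_le_iff mult.commute)
    qed
    show ?thesis using *[of x y] *[of y x] that by (cases "x \<le> y") (auto simp: abs_minus_commute)
  qed
  have "\<bar>real (block_count p (Suc n) k) - real p ^ Suc n * profile (Suc n) (real k / real p)\<bar>
    \<le> (C + (L + 2 * B)) * real p ^ n" if "odd p" "k \<le> p" for p k
  proof -
    obtain a where p: "p = 2 * a + 1" using \<open>odd p\<close> by (elim oddE)
    have p0: "real p > 0" using p by simp
    \<comment> \<open>There are \<open>m\<close> blocks, of which the first \<open>d\<close> have the full length \<open>p\<close>.\<close>
    define m d where "m = min k a" and "d = k + a - p"
    have dm: "d \<le> m" "m \<le> p" using that p by (auto simp: d_def m_def)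
    define x where "x = real k / real p"
    have x: "0 \<le> x" "x \<le> 1" using that p by (auto simp: x_def)
    have px: "real p * x = real k" using p0 by (simp add: x_def)
    have blk: "block p k a t \<le> p" if "t < m" for t
      using that by (auto simp: block_def m_def)
    define S where "S = (\<Sum>t<m. profile n (real (block p k a t) / real p))"
    have "\<bar>real (block_count p (Suc n) k) - real p ^ n * S\<bar> =
      \<bar>\<Sum>t<m. real (block_count p n (block p k a t)) - real p ^ n * profile n (real (block p k a t) / real p)\<bar>"
      by (simp add: p m_def S_def sum_subtractf sum_distrib_left)
    also have "\<dots> \<le> (\<Sum>t<m. C * real p ^ (n - 1))"
      using C(2)[OF \<open>odd p\<close> blk] by (intro order.trans[OF sum_abs] sum_mono) auto
    also have "\<dots> = real m * (C * real p ^ (n - 1))" by simp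
    also have "\<dots> \<le> real p * (C * real p ^ (n - 1))" using dm C(1) by (intro mult_right_mono) auto
    also have "\<dots> = C * real p ^ n" using \<open>n \<ge> 1\<close> by (cases n) auto
    finally have part1: "\<bar>real (block_count p (Suc n) k) - real p ^ n * S\<bar> \<le> C * real p ^ n" .
    define R where "R = (\<Sum>t\<in>{d..<m}. profile n ((real (k + a) - 1 - 2 * real t) / real p))"
    have "{..<m} = {..<d} \<union> {d..<m}" using dm by auto
    hence "S = (\<Sum>t<d. profile n (real (block p k a t) / real p)) + (\<Sum>t\<in>{d..<m}. profile n (real (block p k a t) / real p))"
      unfolding S_def by (simp add: sum.union_disjoint ivl_disj_int)
    also have "(\<Sum>t<d. profile n (real (block p k a t) / real p)) = real d * profile n 1"
      using p0 by (simp add: block_def d_def)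
    also have "(\<Sum>t\<in>{d..<m}. profile n (real (block p k a t) / real p)) = R"
      unfolding R_def by (intro sum.cong refl arg_cong[of _ _ "\<lambda>y. profile n (y / real p)"])
        (auto simp: block_def d_def m_def)
    finally have S: "S = real d * profile n 1 + R" .
    define I where "I = profile_integral n"
    \<comment> \<open>The discrete integration limits \<open>u\<close> and \<open>l\<close> lie within \<open>1/(2p)\<close> of \<open>1 - y\<close> and \<open>y\<close>.\<close>
    define u l where "u = (real (k + a) - 2 * real d) / real p" and "l = (real (k + a) - 2 * real m) / real p"
    have "\<bar>R - real p / 2 * (I u - I l)\<bar> \<le> (real m - real d) * (L / real p)"
      unfolding R_def u_def l_def I_def
      by (rule riemann_sum_profile[OF L]) (use p that in \<open>auto simp: d_def m_def\<close>)
    also have "\<dots> \<le> real p * (L / real p)" using dm L(1) by (intro mult_right_mono) auto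
    also have "\<dots> = L" using p0 by simp
    finally have R: "\<bar>R - real p / 2 * (I u - I l)\<bar> \<le> L" .
    have pu: "real p * u = real (k + a) - 2 * real d" and pl: "real p * l = real (k + a) - 2 * real m"
      using p0 by (auto simp: u_def l_def)
    define y where "y = \<bar>x - 1/2\<bar>"
    have y01: "y \<in> {0..1}" "1 - y \<in> {0..1}" using x by (auto simp: y_def abs_if)
    have py: "real p * y = \<bar>real k - real p / 2\<bar>"
    proof -
      have "real k - real p / 2 = real p * (x - 1/2)" by (simp add: right_diff_distrib px)
      thus ?thesis by (simp add: y_def abs_mult)
    qed
    have ka: "real (k + a) = real k + (real p - 1) / 2" using p by simp
    have rd: "real d = max 0 (real k - (real p + 1) / 2)"
      using p by (auto simp: d_def max_def of_nat_diff field_simps)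
    have rm: "real m = min (real k) ((real p - 1) / 2)" using p by (auto simp: m_def min_def)
    have u01: "u \<in> {0..1}" and l01: "l \<in> {0..1}"
      using p0 that p unfolding u_def l_def rd rm ka by (auto simp: max_def min_def field_simps)
    have "\<bar>real p * u - real p * (1 - y)\<bar> \<le> 1/2"
      unfolding pu right_diff_distrib py rd ka using that by (auto simp: max_def abs_if field_simps)
    hence "\<bar>real p\<bar> * \<bar>u - (1 - y)\<bar> \<le> 1/2" by (simp only: abs_mult[symmetric] right_diff_distrib)
    hence uy: "real p * \<bar>u - (1 - y)\<bar> \<le> 1/2" by simp
    have "\<bar>real p * l - real p * y\<bar> \<le> 1/2"
      unfolding pl py rm ka by (auto simp: min_def abs_if field_simps)
    hence "\<bar>real p\<bar> * \<bar>l - y\<bar> \<le> 1/2" by (simp only: abs_mult[symmetric] right_diff_distrib)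
    hence ly: "real p * \<bar>l - y\<bar> \<le> 1/2" by simp
    have "real p * \<bar>I u - I (1 - y)\<bar> \<le> real p * (B * \<bar>u - (1 - y)\<bar>)"
      unfolding I_def using p0 by (intro mult_left_mono I_lip u01 y01) auto
    also have "\<dots> \<le> B * (1/2)" using mult_left_mono[OF uy B(1)] by (simp add: mult_ac)
    finally have Iu: "real p * \<bar>I u - I (1 - y)\<bar> \<le> B / 2" by simp
    have "real p * \<bar>I l - I y\<bar> \<le> real p * (B * \<bar>l - y\<bar>)"
      unfolding I_def using p0 by (intro mult_left_mono I_lip l01 y01) auto
    also have "\<dots> \<le> B * (1/2)" using mult_left_mono[OF ly B(1)] by (simp add: mult_ac)
    finally have Il: "real p * \<bar>I l - I y\<bar> \<le> B / 2" by simp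
    have "real p / 2 * (I u - I l) - real p / 2 * (I (1 - y) - I y) =
       (real p * (I u - I (1 - y))) / 2 - (real p * (I l - I y)) / 2" by (simp add: field_simps)
    also have "\<bar>\<dots>\<bar> \<le> real p * \<bar>I u - I (1 - y)\<bar> / 2 + real p * \<bar>I l - I y\<bar> / 2"
      using abs_triangle_ineq4[of "(real p * (I u - I (1 - y))) / 2" "(real p * (I l - I y)) / 2"]
      by (simp add: abs_mult)
    also have "\<dots> \<le> B" using Iu Il B(1) by linarith
    finally have RI: "\<bar>real p / 2 * (I u - I l) - real p / 2 * (I (1 - y) - I y)\<bar> \<le> B" .
    have "\<bar>real d - max 0 (real k - real p / 2)\<bar> \<le> 1/2"
      unfolding rd by (auto simp: max_def abs_if field_simps)
    hence "\<bar>real d - max 0 (real k - real p / 2)\<bar> * \<bar>profile n 1\<bar> \<le> 1 * B"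
      using B by (intro mult_mono) auto
    hence dB: "\<bar>real d * profile n 1 - max 0 (real k - real p / 2) * profile n 1\<bar> \<le> B"
      by (simp add: left_diff_distrib flip: abs_mult)
    have "real p * profile (Suc n) x =
        (real p * max 0 (x - 1/2)) * profile n 1 + real p / 2 * (I (1 - y) - I y)"
      unfolding profile_Suc[OF \<open>n \<ge> 1\<close> x] I_def y_def by (simp add: distrib_left)
    also have "real p * max 0 (x - 1/2) = max 0 (real k - real p / 2)"
    proof -
      have "real k - real p / 2 = real p * (x - 1/2)" by (simp add: right_diff_distrib px)
      thus ?thesis using p0 by (simp only: max_mult_distrib_left mult_zero_right) simp
    qed
    finally have prof: "real p * profile (Suc n) x =
        max 0 (real k - real p / 2) * profile n 1 + real p / 2 * (I (1 - y) - I y)" .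
    have "\<bar>S - real p * profile (Suc n) x\<bar> \<le> L + 2 * B"
      using R RI dB unfolding S prof by linarith
    hence *: "real p ^ n * \<bar>S - real p * profile (Suc n) x\<bar> \<le> real p ^ n * (L + 2 * B)"
      by (intro mult_left_mono) auto
    have part2: "\<bar>real p ^ n * S - real p ^ Suc n * profile (Suc n) x\<bar> \<le> (L + 2 * B) * real p ^ n"
    proof -
      have "real p ^ n * S - real p ^ Suc n * profile (Suc n) x = real p ^ n * (S - real p * profile (Suc n) x)"
        by (simp add: right_diff_distrib)
      thus ?thesis using * by (simp add: abs_mult mult.commute)
    qed
    show ?thesis using part1 part2 unfolding x_def by (simp only: distrib_right)
  qed
  thus ?case using C(1) L(1) B(1) by (intro exI[of _ "C + (L + 2 * B)"]) auto
qed

section \<open>The limit of the kernel dimensions\<close>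

definition cube :: "nat set \<Rightarrow> nat \<Rightarrow> nat \<Rightarrow> nat" where
  "cube I m = (\<lambda>i. if i \<in> I then m else 1)"

lemma sides_cube: "finite I \<Longrightarrow> sides I (cube I m)"
  by (simp add: sides_def cube_def)

text \<open>
  The Hilbert-Kunz function of the sum of squares in terms of shifts, see \<open>hk_fun_eq_square_ker_dim\<close>.
\<close>
definition square_ker_dim :: "nat \<Rightarrow> nat set \<Rightarrow> nat \<Rightarrow> real" where
  "square_ker_dim p I q = log p (card {F \<in> box_fun p (cube I q). shifts 2 I F = 0})"

text \<open>
  Splitting by parity gives \<open>2^(card I)\<close> boxes with all sides in \<open>{m, m + 1}\<close>, to which the Lipschitz bound
  applies.
\<close>
lemma square_ker_dim_approx:
  assumes p: "Factorial_Ring.prime p" and I: "finite I" "card I \<ge> 2"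
  shows "\<bar>square_ker_dim p I (2 * m + 1) - 2 ^ card I * ker_dim p I (cube I m)\<bar>
    \<le> 2 ^ card I * (real (card I) * real (m + 1) ^ (card I - 2))"
proof -
  define E where "E = box (\<lambda>i. if i \<in> I then 2 else 1)"
  have sE: "sides I (\<lambda>i. if i \<in> I then 2 else 1)" using I by (simp add: sides_def)
  have finE: "finite E" unfolding E_def by (rule finite_box[OF sE])
  have cardE: "card E = 2 ^ card I" unfolding E_def card_box[OF sE] by simp
  define b where "b e = (\<lambda>i. (cube I (2 * m + 1) i - e i + 2 - 1) div 2)" for e :: "nat \<Rightarrow> nat"
  have e: "e i < (if i \<in> I then 2 else 1)" if "e \<in> E" for e i
    using that unfolding E_def box_def by blast
  have bI: "b e i = (if e i = 0 then m + 1 else m)" if "e \<in> E" "i \<in> I" for e i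
    using e[OF that(1), of i] that(2) by (auto simp: b_def cube_def less_2_cases_iff)
  have sb: "sides I (b e)" if "e \<in> E" for e
  proof -
    have "b e i = 1" if "i \<notin> I" for i
      using e[OF \<open>e \<in> E\<close>, of i] that by (simp add: b_def cube_def)
    thus ?thesis using I by (simp add: sides_def)
  qed
  have "card {F \<in> box_fun p (cube I (2 * m + 1)). shifts 2 I F = 0} = (\<Prod>e\<in>E. kernel_card p I (b e))"
    using card_kernel_residue_classes[OF p sides_cube[OF I(1)], of 2 "2 * m + 1" 1]
    by (simp add: E_def b_def kernel_card_def)
  hence "square_ker_dim p I (2 * m + 1) = (\<Sum>e\<in>E. ker_dim p I (b e))"
    unfolding square_ker_dim_def ker_dim_def
    using prime_gt_1_real[OF p] kernel_card_pos[OF p sb]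
    by (simp add: log_prod_pos)
  hence "\<bar>square_ker_dim p I (2 * m + 1) - 2 ^ card I * ker_dim p I (cube I m)\<bar> =
      \<bar>\<Sum>e\<in>E. ker_dim p I (b e) - ker_dim p I (cube I m)\<bar>"
    by (simp add: sum_subtractf cardE)
  also have "\<dots> \<le> (\<Sum>e\<in>E. real (card I) * real 1 * real (m + 1) ^ (card I - 2))"
  proof (intro order.trans[OF sum_abs] sum_mono)
    fix e assume "e \<in> E"
    thus "\<bar>ker_dim p I (b e) - ker_dim p I (cube I m)\<bar> \<le> real (card I) * real 1 * real (m + 1) ^ (card I - 2)"
      by (intro ker_dim_diff_le[OF p sides_cube sb I(2)] I(1)) (auto simp: bI cube_def)
  qed
  also have "\<dots> = 2 ^ card I * (real (card I) * real (m + 1) ^ (card I - 2))"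
    by (simp add: cardE)
  finally show ?thesis .
qed

text \<open>
  Let \<open>d n\<close> be the nullity of the cube of side \<open>m\<^sub>n = (p^n - 1)/2\<close>, divided by \<open>p^(n(s-1))\<close>. Since
  \<open>m\<^sub>n\<^sub>+\<^sub>1 = p m\<^sub>n + (p - 1)/2\<close>, scaling and the Lipschitz bound give
  \<open>\<bar>d (n + 1) - d n\<bar> \<le> s / (2 p^n)\<close>. These differences form a convergent geometric series, and its tail bounds the
  distance from \<open>d 1\<close> to the limit by \<open>s/p\<close>.
\<close>
theorem square_ker_dim_limit:
  assumes p: "Factorial_Ring.prime p" "odd p" and I: "finite I" "card I \<ge> 2"
  shows "\<exists>\<mu>. (\<lambda>n. square_ker_dim p I (p ^ n) / real (p ^ n) ^ (card I - 1)) \<longlonglongrightarrow> \<mu> \<and>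
    \<bar>\<mu> - 2 ^ card I * (ker_dim p I (cube I ((p - 1) div 2)) / real p ^ (card I - 1))\<bar>
      \<le> 2 ^ card I * real (card I) / real p"
proof -
  define s where "s = card I"
  have s: "s \<ge> 2" using I by (simp add: s_def)
  have p1: "real p > 1" using prime_gt_1_real[OF p(1)] .
  have p3: "p \<ge> 3" using p prime_gt_1_nat[OF p(1)] by (cases "p = 2") auto
  obtain a where a: "p = 2 * a + 1" using p(2) by (elim oddE)
  define m where "m n = (p ^ n - 1) div 2" for n
  have m: "p ^ n = 2 * m n + 1" for n using p(2) by (simp add: m_def)
  have mSuc: "m (Suc n) = p * m n + a" for n
  proof -
    have "2 * m (Suc n) + 1 = p * p ^ n" using m[of "Suc n"] by simp
    also have "p * p ^ n = p * (2 * m n + 1)" by (simp only: m)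
    also have "\<dots> = 2 * (p * m n + a) + 1" using a by (simp add: algebra_simps)
    finally show ?thesis by simp
  qed
  define Q where "Q n = real (p ^ n)" for n
  have Q0: "Q n > 0" for n using p1 by (simp add: Q_def)
  have Qpow: "Q n ^ (s - 1) = Q n * Q n ^ (s - 2)" for n
  proof -
    have "s - 1 = Suc (s - 2)" using s by simp
    thus ?thesis by simp
  qed
  define d where "d n = ker_dim p I (cube I (m n)) / Q n ^ (s - 1)" for n
  define x where "x n = square_ker_dim p I (p ^ n) / Q n ^ (s - 1)" for n
  have d_step: "\<bar>d (Suc n) - d n\<bar> \<le> real s / (2 * Q n)" for n
  proof -
    have cube: "cube I (p * m n) = (\<lambda>i. if i \<in> I then p * cube I (m n) i else 1)"
      by (auto simp: cube_def)
    have scale: "ker_dim p I (cube I (p * m n)) = real p ^ (s - 1) * ker_dim p I (cube I (m n))"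
      unfolding cube s_def using I by (intro ker_dim_scale[OF p(1) sides_cube]) auto
    have "\<bar>ker_dim p I (cube I (m (Suc n))) - ker_dim p I (cube I (p * m n))\<bar>
       \<le> real (card I) * real a * real (p ^ Suc n) ^ (card I - 2)"
    proof (rule ker_dim_diff_le[OF p(1) sides_cube[OF I(1)] sides_cube[OF I(1)] I(2)])
      fix i assume "i \<in> I"
      show "cube I (p * m n) i \<le> cube I (m (Suc n)) i" by (simp add: cube_def mSuc)
      show "cube I (m (Suc n)) i - cube I (p * m n) i \<le> a" by (simp add: cube_def mSuc)
      show "cube I (m (Suc n)) i \<le> p ^ Suc n" using \<open>i \<in> I\<close> by (simp add: cube_def m_def)
    qed
    also have "\<dots> = real s * real a * Q (Suc n) ^ (s - 2)" by (simp add: s_def Q_def)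
    also have "\<dots> \<le> real s * (real p / 2) * Q (Suc n) ^ (s - 2)"
      using a by (intro mult_right_mono mult_left_mono) (auto simp: Q_def)
    finally have *: "\<bar>ker_dim p I (cube I (m (Suc n))) - real p ^ (s - 1) * ker_dim p I (cube I (m n))\<bar>
       \<le> real s * (real p / 2) * Q (Suc n) ^ (s - 2)" by (simp only: scale)
    have QS: "Q (Suc n) = real p * Q n" by (simp add: Q_def)
    have dn: "d n = (real p ^ (s - 1) * ker_dim p I (cube I (m n))) / Q (Suc n) ^ (s - 1)"
      using p1 by (simp add: d_def QS power_mult_distrib)
    have "\<bar>d (Suc n) - d n\<bar> =
       \<bar>ker_dim p I (cube I (m (Suc n))) - real p ^ (s - 1) * ker_dim p I (cube I (m n))\<bar> / Q (Suc n) ^ (s - 1)"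
    proof -
      have "d (Suc n) - (real p ^ (s - 1) * ker_dim p I (cube I (m n))) / Q (Suc n) ^ (s - 1) =
        (ker_dim p I (cube I (m (Suc n))) - real p ^ (s - 1) * ker_dim p I (cube I (m n))) / Q (Suc n) ^ (s - 1)"
        by (simp add: d_def diff_divide_distrib)
      thus ?thesis using Q0[of "Suc n"] dn by (simp add: abs_divide)
    qed
    also have "\<dots> \<le> (real s * (real p / 2) * Q (Suc n) ^ (s - 2)) / Q (Suc n) ^ (s - 1)"
      using * Q0[of "Suc n"] by (intro divide_right_mono) auto
    also have "\<dots> = real s * (real p / 2) / Q (Suc n)"
      unfolding Qpow using Q0[of "Suc n"] by simp
    also have "\<dots> = real s / (2 * Q n)"
      unfolding QS using p1 by simp
    finally show ?thesis .
  qed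
  have x_d: "\<bar>x n - 2 ^ s * d n\<bar> \<le> 2 ^ s * real s / Q n" for n
  proof -
    have "\<bar>square_ker_dim p I (p ^ n) - 2 ^ s * ker_dim p I (cube I (m n))\<bar>
      \<le> 2 ^ s * (real s * real (m n + 1) ^ (s - 2))"
      using square_ker_dim_approx[OF p(1) I, of "m n"] unfolding s_def m[of n] by simp
    also have "\<dots> \<le> 2 ^ s * (real s * Q n ^ (s - 2))"
      unfolding Q_def m[of n] by (intro mult_left_mono power_mono) auto
    finally have *: "\<bar>square_ker_dim p I (p ^ n) - 2 ^ s * ker_dim p I (cube I (m n))\<bar>
      \<le> 2 ^ s * (real s * Q n ^ (s - 2))" .
    have "\<bar>x n - 2 ^ s * d n\<bar> = \<bar>square_ker_dim p I (p ^ n) - 2 ^ s * ker_dim p I (cube I (m n))\<bar> / Q n ^ (s - 1)"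
    proof -
      have "x n - 2 ^ s * d n = (square_ker_dim p I (p ^ n) - 2 ^ s * ker_dim p I (cube I (m n))) / Q n ^ (s - 1)"
        by (simp add: x_def d_def diff_divide_distrib)
      thus ?thesis using Q0[of n] by (simp add: abs_divide)
    qed
    also have "\<dots> \<le> (2 ^ s * (real s * Q n ^ (s - 2))) / Q n ^ (s - 1)"
      using * Q0[of n] by (intro divide_right_mono) auto
    also have "\<dots> = 2 ^ s * real s / Q n" unfolding Qpow using Q0[of n] by simp
    finally show ?thesis .
  qed
  have Qlim: "(\<lambda>n. c / Q n) \<longlonglongrightarrow> 0" for c
  proof -
    have "(\<lambda>n. c * (1 / real p) ^ n) \<longlonglongrightarrow> c * 0"
      using p1 by (intro tendsto_mult tendsto_const LIMSEQ_realpow_zero) auto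
    thus ?thesis by (simp add: Q_def power_one_over)
  qed
  \<comment> \<open>Since \<open>p \<ge> 3\<close>, the step \<open>s / (2 p^n)\<close> is at most \<open>s / p^n - s / p^(n+1)\<close>, so \<open>d n - s / p^n\<close> increases and
    \<open>d n + s / p^n\<close> decreases. The index starts at \<open>1\<close> because \<open>d 1\<close> is the term to be compared with the limit.\<close>
  define f g where "f n = d (Suc n) - real s / Q (Suc n)" and "g n = d (Suc n) + real s / Q (Suc n)" for n
  have QSS: "real s / (2 * Q n) \<le> real s / Q n - real s / Q (Suc n)" for n
  proof -
    have "real s / Q (Suc n) \<le> real s / (2 * Q n)"
      using p3 Q0[of n] by (intro divide_left_mono) (auto simp: Q_def)
    moreover have "real s / Q n = 2 * (real s / (2 * Q n))" using Q0[of n] by simp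
    ultimately show ?thesis by linarith
  qed
  have "\<exists>l. ((\<forall>n. f n \<le> l) \<and> f \<longlonglongrightarrow> l) \<and> ((\<forall>n. l \<le> g n) \<and> g \<longlonglongrightarrow> l)"
  proof (rule nested_sequence_unique)
    show "\<forall>n. f n \<le> f (Suc n)" "\<forall>n. g (Suc n) \<le> g n"
    proof (safe)
      fix n
      have "\<bar>d (Suc (Suc n)) - d (Suc n)\<bar> \<le> real s / Q (Suc n) - real s / Q (Suc (Suc n))"
        using d_step[of "Suc n"] QSS[of "Suc n"] by linarith
      thus "f n \<le> f (Suc n)" "g (Suc n) \<le> g n" unfolding f_def g_def by linarith+
    qed
    show "\<forall>n. f n \<le> g n" using Q0 by (simp add: f_def g_def less_imp_le)
    show "(\<lambda>n. f n - g n) \<longlonglongrightarrow> 0"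
      using LIMSEQ_Suc[OF Qlim[of "- (2 * real s)"]] by (simp add: f_def g_def)
  qed
  then obtain l where l: "\<forall>n. f n \<le> l" "\<forall>n. l \<le> g n" "f \<longlonglongrightarrow> l" by blast
  have "(\<lambda>n. f n + real s / Q (Suc n)) \<longlonglongrightarrow> l + 0"
    by (intro tendsto_add l LIMSEQ_Suc[OF Qlim])
  hence "(\<lambda>n. d (Suc n)) \<longlonglongrightarrow> l" by (simp add: f_def)
  hence d_lim: "d \<longlonglongrightarrow> l" by (rule LIMSEQ_imp_Suc)
  have "(\<lambda>n. x n - 2 ^ s * d n) \<longlonglongrightarrow> 0"
  proof (rule tendsto_0_le[OF Qlim[of "2 ^ s * real s"], of _ 1], rule always_eventually, rule allI)
    fix n
    show "norm (x n - 2 ^ s * d n) \<le> norm (2 ^ s * real s / Q n) * 1"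
      using x_d[of n] Q0[of n] by (simp add: abs_of_pos)
  qed
  from tendsto_add[OF this tendsto_mult[OF tendsto_const[of "2 ^ s"] d_lim]]
  have "x \<longlonglongrightarrow> 2 ^ s * l" by simp
  moreover have "\<bar>l - d 1\<bar> \<le> real s / real p"
    using l(1,2)[THEN spec, of 0] by (simp add: f_def g_def Q_def abs_le_iff)
  hence "2 ^ s * \<bar>l - d 1\<bar> \<le> 2 ^ s * (real s / real p)" by (intro mult_left_mono) auto
  hence "\<bar>2 ^ s * l - 2 ^ s * d 1\<bar> \<le> 2 ^ s * real s / real p"
    by (simp only: right_diff_distrib[symmetric] abs_mult) simp
  ultimately show ?thesis
    unfolding x_def d_def s_def Q_def by (intro exI[of _ "2 ^ card I * l"]) (simp add: m_def)
qed

text \<open>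
  The intermediate boxes of the merging process: the variables \<open>1, ..., n\<close> still have side \<open>h\<close>, the last variable has
  accumulated side \<open>k\<close>, and the variables between them have been absorbed.
\<close>
definition prefix_box :: "nat \<Rightarrow> nat \<Rightarrow> nat \<Rightarrow> nat \<Rightarrow> nat \<Rightarrow> nat" where
  "prefix_box n s h k = (\<lambda>i. if 1 \<le> i \<and> i \<le> n then h else 1)(s := k)"

lemma ker_dim_prefix_box:
  assumes p: "Factorial_Ring.prime p" and n: "n < s" and k: "1 \<le> k" "k \<le> p"
  shows "ker_dim p {1..s} (prefix_box n s ((p - 1) div 2) k) = real (block_count p n k)"
  using n k
proof (induction n arbitrary: k)
  case 0
  have sI: "sides {1..s} (\<lambda>_. 1)" by (simp add: sides_def)
  have sm: "s \<in> {1..s}" using 0 by auto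
  have upd: "(\<lambda>_. 1 :: nat)(s := 1) = (\<lambda>_. 1)" by auto
  interpret elementary_group p "box_fun p (\<lambda>_. 1)" by (rule elementary_group_box_fun[OF p sI])
  have "(shifts 1 {1..s} ^^ k) F = 0" if F: "F \<in> box_fun p (\<lambda>_. 1)" for F
  proof -
    have "shifts 1 {1..s} F = 0"
    proof
      fix u
      have "u(i := u i + 1) \<notin> box (\<lambda>_. 1)" for i
      proof
        assume "u(i := u i + 1) \<in> box (\<lambda>_. 1)"
        hence "(u(i := u i + 1)) i < 1" unfolding box_def by blast
        thus False by simp
      qed
      thus "shifts 1 {1..s} F u = 0 u"
        using F by (simp add: shifts_def box_fun_def fun_on_def)
    qed
    moreover obtain k' where "k = Suc k'" using 0 by (cases k) auto
    ultimately show ?thesis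
      using additive.zero[OF additive_funpow[OF additive_shifts, of k']] by (simp add: funpow_swap1)
  qed
  hence "kernel_card p {1..s} ((\<lambda>_. 1)(s := k)) = card (box_fun p (\<lambda>_. 1))"
    unfolding kernel_card_eliminate[OF p sI sm] upd by (intro arg_cong[of _ _ card]) blast
  also have "\<dots> = p"
    unfolding box_fun_def card_fun_on[OF finite_box[OF sI]] card_box[OF sI]
    using card_Zmod[OF prime_gt_0_nat[OF p]] by simp
  finally have "ker_dim p {1..s} ((\<lambda>_. 1)(s := k)) = 1"
    using prime_gt_1_real[OF p] by (simp add: ker_dim_def)
  moreover have "prefix_box 0 s ((p - 1) div 2) k = (\<lambda>_. 1)(s := k)"
    by (auto simp: prefix_box_def)
  ultimately show ?case by (simp only: block_count.simps of_nat_1)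
next
  case (Suc n)
  define h where "h = (p - 1) div 2"
  define a where "a = (\<lambda>i. if 1 \<le> i \<and> i \<le> n then h else 1)"
  have sa: "sides {1..s} a" using Suc.prems by (auto simp: sides_def a_def)
  have mem: "s \<in> {1..s}" "Suc n \<in> {1..s}" "s \<noteq> Suc n" using Suc.prems by auto
  have "prefix_box (Suc n) s h k = a(s := k, Suc n := h)"
    using mem(3) by (auto simp: prefix_box_def a_def fun_eq_iff)
  hence "ker_dim p {1..s} (prefix_box (Suc n) s h k) =
     (\<Sum>t<min k h. ker_dim p {1..s} (a(s := block p k h t, Suc n := 1)))"
    using ker_dim_fusion[OF p sa mem Suc.prems(3), of h] by (simp add: h_def)
  also have "\<dots> = (\<Sum>t<min k h. real (block_count p n (block p k h t)))"
  proof (intro sum.cong refl)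
    fix t assume t: "t \<in> {..<min k h}"
    have "a(s := block p k h t, Suc n := 1) = prefix_box n s h (block p k h t)"
      using mem(3) by (auto simp: prefix_box_def a_def fun_eq_iff)
    moreover have "1 \<le> block p k h t" "block p k h t \<le> p"
      using t p prime_gt_0_nat[OF p] by (auto simp: block_def)
    ultimately show "ker_dim p {1..s} (a(s := block p k h t, Suc n := 1)) = real (block_count p n (block p k h t))"
      using Suc.IH Suc.prems unfolding h_def by simp
  qed
  finally show ?case by (simp add: h_def)
qed

text \<open>
  The cube of side \<open>(p - 1)/2\<close> is evaluated by \<open>ker_dim_prefix_box\<close> and \<open>block_count_profile\<close>. Its last side
  corresponds to \<open>x = (p - 1)/(2p)\<close>, which tends to \<open>1/2\<close>, where the profile takes the value sought.
\<close>
theorem square_ker_dim_limit_sec_tan: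
  assumes s: "s \<ge> 2"
  shows "\<exists>C. \<forall>p. Factorial_Ring.prime p \<longrightarrow> odd p \<longrightarrow>
    (\<exists>\<mu>. (\<lambda>n. square_ker_dim p {1..s} (p ^ n) / real (p ^ n) ^ (s - 1)) \<longlonglongrightarrow> \<mu> \<and>
      \<bar>\<mu> - (1 + fps_nth sec_plus_tan (s - 1))\<bar> \<le> C / real p)"
proof -
  define r where "r = s - 1"
  have r: "r \<ge> 1" "s = Suc r" using s by (auto simp: r_def)
  obtain C where C: "C \<ge> 0" "\<And>p k. odd p \<Longrightarrow> k \<le> p \<Longrightarrow>
    \<bar>real (block_count p r k) - real p ^ r * profile r (real k / real p)\<bar> \<le> C * real p ^ (r - 1)"
    using block_count_profile[OF r(1)] by blast
  obtain L where L: "L \<ge> 0" "\<forall>x\<in>{0..1}. \<forall>y\<in>{0..1}. \<bar>profile r x - profile r y\<bar> \<le> L * \<bar>x - y\<bar>"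
    using profile_lipschitz by blast
  have half: "2 ^ s * profile r (1/2) = 1 + fps_nth sec_plus_tan (s - 1)"
    using r by (simp add: profile_def zigzag_at_0 field_simps)
  show ?thesis
  proof (rule exI[of _ "2 ^ s * (real s + C + L)"], intro allI impI)
    fix p :: nat assume p: "Factorial_Ring.prime p" "odd p"
    have p1: "real p > 1" using prime_gt_1_real[OF p(1)] .
    obtain h where h: "p = 2 * h + 1" using p(2) by (elim oddE)
    have h1: "h \<ge> 1" using h p1 by (cases h) auto
    obtain \<mu> where \<mu>: "(\<lambda>n. square_ker_dim p {1..s} (p ^ n) / real (p ^ n) ^ (s - 1)) \<longlonglongrightarrow> \<mu>"
      "\<bar>\<mu> - 2 ^ s * (ker_dim p {1..s} (cube {1..s} ((p - 1) div 2)) / real p ^ r)\<bar> \<le> 2 ^ s * real s / real p"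
      using square_ker_dim_limit[OF p, of "{1..s}"] s by (auto simp: r_def)
    have "cube {1..s} h = prefix_box r s h h"
      using r by (auto simp: cube_def prefix_box_def fun_eq_iff)
    hence K: "ker_dim p {1..s} (cube {1..s} ((p - 1) div 2)) = real (block_count p r h)"
      using ker_dim_prefix_box[OF p(1), of r s h] r h h1 by simp
    have pr: "real p ^ r = real p * real p ^ (r - 1)" using r by (cases r) auto
    have "\<bar>real (block_count p r h) / real p ^ r - profile r (real h / real p)\<bar> =
       \<bar>real (block_count p r h) - real p ^ r * profile r (real h / real p)\<bar> / real p ^ r"
    proof -
      have "real (block_count p r h) / real p ^ r - profile r (real h / real p) =
          (real (block_count p r h) - real p ^ r * profile r (real h / real p)) / real p ^ r"
        using p1 by (simp add: diff_divide_distrib)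
      thus ?thesis by (simp add: abs_divide)
    qed
    also have "\<dots> \<le> C * real p ^ (r - 1) / real p ^ r"
      using C(2)[OF p(2), of h] h by (intro divide_right_mono) auto
    also have "\<dots> = C / real p" unfolding pr using p1 by simp
    finally have 1: "\<bar>real (block_count p r h) / real p ^ r - profile r (real h / real p)\<bar> \<le> C / real p" .
    have hp: "real h / real p \<in> {0..1}" using h by auto
    have "\<bar>profile r (real h / real p) - profile r (1/2)\<bar> \<le> L * \<bar>real h / real p - 1/2\<bar>"
      using L(2)[rule_format, OF hp, of "1/2"] by simp
    also have "\<bar>real h / real p - 1/2\<bar> \<le> 1 / real p"
      using p1 h by (simp add: abs_le_iff field_simps)
    hence "L * \<bar>real h / real p - 1/2\<bar> \<le> L * (1 / real p)" using L(1) by (rule mult_left_mono)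
    finally have 2: "\<bar>profile r (real h / real p) - profile r (1/2)\<bar> \<le> L / real p" by simp
    have "\<bar>real (block_count p r h) / real p ^ r - profile r (1/2)\<bar> \<le> C / real p + L / real p"
      using 1 2 by linarith
    hence "2 ^ s * \<bar>real (block_count p r h) / real p ^ r - profile r (1/2)\<bar> \<le> 2 ^ s * (C / real p + L / real p)"
      by (intro mult_left_mono) auto
    hence "\<bar>2 ^ s * (real (block_count p r h) / real p ^ r) - 2 ^ s * profile r (1/2)\<bar> \<le> 2 ^ s * (C / real p + L / real p)"
      by (simp only: right_diff_distrib[symmetric] abs_mult) simp
    hence "\<bar>\<mu> - 2 ^ s * profile r (1/2)\<bar> \<le> 2 ^ s * real s / real p + 2 ^ s * (C / real p + L / real p)"
      using \<mu>(2) unfolding K by linarith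
    also have "\<dots> = 2 ^ s * (real s + C + L) / real p"
      by (simp add: add_divide_distrib distrib_left)
    finally show "\<exists>\<mu>. (\<lambda>n. square_ker_dim p {1..s} (p ^ n) / real (p ^ n) ^ (s - 1)) \<longlonglongrightarrow> \<mu> \<and>
      \<bar>\<mu> - (1 + fps_nth sec_plus_tan (s - 1))\<bar> \<le> 2 ^ s * (real s + C + L) / real p"
      using \<mu>(1) unfolding half by blast
  qed
qed

section \<open>Polynomials over the residue ring\<close>

lemma finite_submultisets: "finite {k. k \<subseteq># m}"
proof (induction m)
  case (add x m)
  have "{k. k \<subseteq># add_mset x m} \<subseteq> {k. k \<subseteq># m} \<union> add_mset x ` {k. k \<subseteq># m}"
  proof
    fix k assume k: "k \<in> {k. k \<subseteq># add_mset x m}"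
    show "k \<in> {k. k \<subseteq># m} \<union> add_mset x ` {k. k \<subseteq># m}"
    proof (cases "x \<in># k")
      case True
      then obtain k' where "k = add_mset x k'" by (metis multi_member_split)
      thus ?thesis using k by auto
    next
      case False
      have "k \<subseteq># m"
      proof (rule mset_subset_eqI)
        fix y
        have "count k y \<le> count (add_mset x m) y"
          using k by (intro mset_subset_eq_count) simp
        thus "count k y \<le> count m y" using False by (cases "y = x") (auto simp: not_in_iff split: if_splits)
      qed
      thus ?thesis by simp
    qed
  qed
  thus ?case using add finite_subset by blast
qed simp

text \<open>
  The product of polynomials with integer coefficients. The product over \<open>\<int>/p\<close> is its reduction modulo \<open>p\<close>, so
  the ring laws can be verified over the integers.
\<close>
definition convolution :: "('c multiset \<Rightarrow> int) \<Rightarrow> ('c multiset \<Rightarrow> int) \<Rightarrow> 'c multiset \<Rightarrow> int" where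
  "convolution P Q m = (\<Sum>k | k \<subseteq># m. P k * Q (m - k))"

lemma convolution_commute: "convolution P Q m = convolution Q P m"
  unfolding convolution_def
proof (rule sum.reindex_bij_witness[of _ "\<lambda>k. m - k" "\<lambda>k. m - k"])
  fix k assume "k \<in> {k. k \<subseteq># m}"
  then obtain c where "m = k + c" by (auto simp: mset_subset_eq_exists_conv)
  thus "m - (m - k) = k" "m - k \<in> {k. k \<subseteq># m}" "m - (m - k) = k" "m - k \<in> {k. k \<subseteq># m}"
    "Q (m - k) * P (m - (m - k)) = P k * Q (m - k)" by auto
qed

lemma convolution_assoc: "convolution (convolution P Q) S m = convolution P (convolution Q S) m"
proof -
  have "convolution (convolution P Q) S m = (\<Sum>k | k \<subseteq># m. \<Sum>l | l \<subseteq># k. P l * Q (k - l) * S (m - k))"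
    by (simp add: convolution_def sum_distrib_right)
  also have "\<dots> = (\<Sum>(k, l)\<in>(SIGMA k:{k. k \<subseteq># m}. {l. l \<subseteq># k}). P l * Q (k - l) * S (m - k))"
    by (rule sum.Sigma) (auto simp: finite_submultisets)
  also have "\<dots> = (\<Sum>(l, j)\<in>(SIGMA l:{l. l \<subseteq># m}. {j. j \<subseteq># m - l}). P l * Q j * S (m - l - j))"
  proof (rule sum.reindex_bij_witness[of _ "\<lambda>(l, j). (l + j, l)" "\<lambda>(k, l). (l, k - l)"], goal_cases)
    case (1 a)
    thus ?case by (auto simp: mset_subset_eq_exists_conv)
  next
    case (2 a)
    obtain k l where a: "a = (k, l)" by (cases a)
    obtain c d where "m = k + c" "k = l + d" using 2 by (auto simp: a mset_subset_eq_exists_conv)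
    thus ?case by (simp add: a)
  next
    case (4 a)
    obtain l j where a: "a = (l, j)" by (cases a)
    obtain c where c: "m = l + c" using 4 by (auto simp: a mset_subset_eq_exists_conv)
    moreover obtain d where "c = j + d" using 4 c by (auto simp: a mset_subset_eq_exists_conv)
    ultimately show ?case by (simp add: a)
  next
    case (5 a)
    obtain k l where a: "a = (k, l)" by (cases a)
    obtain d where "k = l + d" using 5 by (auto simp: a mset_subset_eq_exists_conv)
    thus ?case by (simp add: a)
  qed auto
  also have "\<dots> = (\<Sum>l | l \<subseteq># m. \<Sum>j | j \<subseteq># m - l. P l * Q j * S (m - l - j))"
    by (rule sum.Sigma[symmetric]) (auto simp: finite_submultisets)
  also have "\<dots> = convolution P (convolution Q S) m"
    by (simp add: convolution_def sum_distrib_left mult.assoc)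
  finally show ?thesis .
qed

lemma convolution_add_left: "convolution (\<lambda>k. P k + Q k) S m = convolution P S m + convolution Q S m"
  by (simp add: convolution_def sum.distrib distrib_right)

lemma convolution_cong_mod:
  assumes "\<And>k. P k mod q = P' k mod q" "\<And>k. Q k mod q = Q' k mod q"
  shows "convolution P Q m mod q = convolution P' Q' m mod q"
proof -
  have "(P k * Q (m - k)) mod q = (P' k * Q' (m - k)) mod q" for k
    using assms by (intro mod_mult_cong)
  hence "(\<Sum>k | k \<subseteq># m. (P k * Q (m - k)) mod q) mod q = (\<Sum>k | k \<subseteq># m. (P' k * Q' (m - k)) mod q) mod q"
    by simp
  thus ?thesis unfolding convolution_def by (simp only: mod_sum_eq)
qed

lemma convolution_mod_left: "convolution (\<lambda>k. P k mod q) Q m mod q = convolution P Q m mod q"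
  by (rule convolution_cong_mod) simp_all

lemma convolution_mod_right: "convolution P (\<lambda>k. Q k mod q) m mod q = convolution P Q m mod q"
  by (rule convolution_cong_mod) simp_all

definition monomial :: "int \<Rightarrow> 'c multiset \<Rightarrow> 'c multiset \<Rightarrow> int" where
  "monomial c n = (\<lambda>m. if m = n then c else 0)"

lemma convolution_monomial: "convolution (monomial c n) P m = (if n \<subseteq># m then c * P (m - n) else 0)"
proof -
  have "convolution (monomial c n) P m = (\<Sum>k\<in>{k. k \<subseteq># m} \<inter> {n}. c * P (m - k))"
    unfolding convolution_def by (rule sum.mono_neutral_cong_right)
      (auto simp: finite_submultisets monomial_def split: if_splits)
  thus ?thesis by (auto simp: Int_insert_right)
qed

locale poly_mod_prime =
  fixes p s :: nat
  assumes prime: "Factorial_Ring.prime p"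
begin

abbreviation "R \<equiv> residue_ring (int p)"
abbreviation "A \<equiv> poly_Zp p s"
abbreviation "vars \<equiv> {1..s}"

sublocale R: residues_prime p R by unfold_locales (rule prime, simp)

lemma p_pos: "int p > 0" using prime prime_gt_0_nat by simp

lemma mod_self: "0 \<le> x \<Longrightarrow> x < int p \<Longrightarrow> x mod int p = x" by simp

lemma add_A: "P \<oplus>\<^bsub>A\<^esub> Q = (\<lambda>m. (P m + Q m) mod int p)"
  by (simp add: poly_Zp_def mpoly_ring_def R.indexed_padd_def R.res_add_eq)

lemma zero_A: "\<zero>\<^bsub>A\<^esub> = (\<lambda>m. 0)"
  by (auto simp: poly_Zp_def mpoly_ring_def R.indexed_const_def R.res_zero_eq)

lemma one_A: "\<one>\<^bsub>A\<^esub> = monomial 1 {#}"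
  by (auto simp: poly_Zp_def mpoly_ring_def R.indexed_const_def R.res_zero_eq R.res_one_eq monomial_def)

lemma mult_A: "P \<otimes>\<^bsub>A\<^esub> Q = (\<lambda>m. convolution P Q m mod int p)"
proof
  fix m
  show "(P \<otimes>\<^bsub>A\<^esub> Q) m = convolution P Q m mod int p"
    using R.sum_cong[OF finite_submultisets, of "\<lambda>k. P k * Q (m - k)" m]
    by (simp add: poly_Zp_def mpoly_ring_def R.res_mult_eq convolution_def)
qed

lemma carrier_A: "carrier A = R.indexed_pset vars (carrier R)"
  by (simp add: poly_Zp_def mpoly_ring_def)

lemma monomial_mem: "set_mset n \<subseteq> vars \<Longrightarrow> 0 \<le> c \<Longrightarrow> c < int p \<Longrightarrow> monomial c n \<in> carrier A"
proof (induction n)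
  case empty
  have "(monomial c {#} :: nat multiset \<Rightarrow> int) = R.indexed_const c"
    by (auto simp: monomial_def R.indexed_const_def R.res_zero_eq)
  moreover have "R.indexed_const c \<in> R.indexed_pset vars (carrier R)"
    using empty by (intro R.indexed_pset.indexed_const) (simp add: R.res_carrier_eq)
  ultimately show ?case by (simp only: carrier_A)
next
  case (add i n)
  have "monomial c (add_mset i n) = R.indexed_pmult (monomial c n) i"
    by (auto simp: monomial_def R.indexed_pmult_def R.res_zero_eq fun_eq_iff)
  thus ?case using add unfolding carrier_A by (auto intro!: R.indexed_pset.indexed_pmult)
qed

text \<open>
  The inductively generated carrier consists of the reduced coefficient functions with finite support in the
  monomials of the given variables; the converse inclusion is by induction on the support.
\<close>
lemma mem_carrier_A_iff:
  "P \<in> carrier A \<longleftrightarrow> (\<forall>m. 0 \<le> P m \<and> P m < int p) \<and> finite {m. P m \<noteq> 0} \<and> (\<forall>m. P m \<noteq> 0 \<longrightarrow> set_mset m \<subseteq> vars)"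
    (is "_ \<longleftrightarrow> ?good P")
proof
  assume "P \<in> carrier A"
  hence "P \<in> R.indexed_pset vars (carrier R)" by (simp add: carrier_A)
  thus "?good P"
  proof induction
    case (indexed_const k)
    have "finite {m. m = ({#} :: nat multiset) \<and> k \<noteq> 0}" by (rule finite_subset[of _ "{{#}}"]) auto
    thus ?case using indexed_const by (auto simp: R.indexed_const_def R.res_zero_eq R.res_carrier_eq)
  next
    case (indexed_padd P Q)
    have "{m. (P m + Q m) mod int p \<noteq> 0} \<subseteq> {m. P m \<noteq> 0} \<union> {m. Q m \<noteq> 0}" by auto
    hence "finite {m. (P m + Q m) mod int p \<noteq> 0}" using indexed_padd by (auto intro: finite_subset)
    moreover have "set_mset m \<subseteq> vars" if "(P m + Q m) mod int p \<noteq> 0" for m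
    proof -
      have "P m \<noteq> 0 \<or> Q m \<noteq> 0" using that by auto
      thus ?thesis using indexed_padd by blast
    qed
    ultimately show ?case using p_pos by (simp add: R.indexed_padd_def R.res_add_eq)
  next
    case (indexed_pmult P i)
    have "{m. R.indexed_pmult P i m \<noteq> 0} \<subseteq> add_mset i ` {m. P m \<noteq> 0}"
    proof
      fix m assume "m \<in> {m. R.indexed_pmult P i m \<noteq> 0}"
      hence "i \<in># m" "P (m - {#i#}) \<noteq> 0" by (auto simp: R.indexed_pmult_def R.res_zero_eq split: if_splits)
      thus "m \<in> add_mset i ` {m. P m \<noteq> 0}" by (intro image_eqI[of _ _ "m - {#i#}"]) auto
    qed
    hence "finite {m. R.indexed_pmult P i m \<noteq> 0}" using indexed_pmult by (meson finite_imageI finite_subset)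
    moreover have "set_mset m \<subseteq> vars" if "R.indexed_pmult P i m \<noteq> 0" for m
    proof -
      have *: "i \<in># m" "P (m - {#i#}) \<noteq> 0"
        using that by (auto simp: R.indexed_pmult_def R.res_zero_eq split: if_splits)
      hence "m = add_mset i (m - {#i#})" by simp
      moreover have "set_mset (m - {#i#}) \<subseteq> vars" using * indexed_pmult by blast
      ultimately show ?thesis using indexed_pmult(2) by (metis insert_subset set_mset_add_mset_insert)
    qed
    ultimately show ?case using indexed_pmult p_pos
      by (simp add: R.indexed_pmult_def R.res_zero_eq)
  qed
next
  assume good: "?good P"
  have "finite N \<Longrightarrow> \<forall>P. ?good P \<longrightarrow> {m. P m \<noteq> 0} = N \<longrightarrow> P \<in> carrier A" for N
  proof (induction N rule: finite_induct)
    case empty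
    show ?case
    proof (intro allI impI)
      fix P :: "nat multiset \<Rightarrow> int" assume "{m. P m \<noteq> 0} = {}"
      hence "P = monomial 0 {#}" by (auto simp: monomial_def)
      thus "P \<in> carrier A" using monomial_mem[of "{#}" 0] p_pos by simp
    qed
  next
    case (insert n N)
    show ?case
    proof (intro allI impI)
      fix P assume P: "?good P" "{m. P m \<noteq> 0} = insert n N"
      have supp: "{m. (P(n := 0)) m \<noteq> 0} = N" using P(2) insert(2) by auto
      have "?good (P(n := 0))"
        unfolding supp using P(1) insert(1) p_pos by auto
      hence "P(n := 0) \<in> carrier A" using insert.IH supp by blast
      moreover have "set_mset n \<subseteq> vars" using P by blast
      hence "monomial (P n) n \<in> carrier A" using P(1) by (intro monomial_mem) auto
      ultimately have "P(n := 0) \<oplus>\<^bsub>A\<^esub> monomial (P n) n \<in> carrier A"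
        unfolding carrier_A using R.indexed_pset.indexed_padd
        by (simp add: poly_Zp_def mpoly_ring_def)
      moreover have "P(n := 0) \<oplus>\<^bsub>A\<^esub> monomial (P n) n = P"
        using P(1) by (auto simp: add_A monomial_def fun_eq_iff)
      ultimately show "P \<in> carrier A" by simp
    qed
  qed
  thus "P \<in> carrier A" using good by blast
qed

lemma cring_A: "cring A"
proof (rule cringI)
  show "abelian_group A"
  proof (rule abelian_groupI)
    show "P \<oplus>\<^bsub>A\<^esub> Q \<in> carrier A" if "P \<in> carrier A" "Q \<in> carrier A" for P Q
      using that R.indexed_pset.indexed_padd unfolding carrier_A
      by (simp add: poly_Zp_def mpoly_ring_def)
    show "\<zero>\<^bsub>A\<^esub> \<in> carrier A" using p_pos by (simp add: mem_carrier_A_iff zero_A)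
    show "\<exists>Q\<in>carrier A. Q \<oplus>\<^bsub>A\<^esub> P = \<zero>\<^bsub>A\<^esub>" if P: "P \<in> carrier A" for P
    proof
      have "{m. - P m mod int p \<noteq> 0} \<subseteq> {m. P m \<noteq> 0}" by auto
      hence "finite {m. - P m mod int p \<noteq> 0}" using P unfolding mem_carrier_A_iff by (meson finite_subset)
      moreover have "P m \<noteq> 0" if "- P m mod int p \<noteq> 0" for m using that by auto
      ultimately show "(\<lambda>m. - P m mod int p) \<in> carrier A"
        using P p_pos unfolding mem_carrier_A_iff by (metis pos_mod_bound pos_mod_sign)
      show "(\<lambda>m. - P m mod int p) \<oplus>\<^bsub>A\<^esub> P = \<zero>\<^bsub>A\<^esub>"
        by (simp add: add_A zero_A mod_simps)
    qed
    show "\<zero>\<^bsub>A\<^esub> \<oplus>\<^bsub>A\<^esub> P = P" if "P \<in> carrier A" for P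
      using that by (auto simp: add_A zero_A mem_carrier_A_iff)
  qed (auto simp: add_A mod_simps add_ac)
  show "comm_monoid A"
  proof (rule comm_monoidI)
    show "P \<otimes>\<^bsub>A\<^esub> Q \<in> carrier A" if P: "P \<in> carrier A" and Q: "Q \<in> carrier A" for P Q
    proof -
      have ex: "\<exists>k l. P k \<noteq> 0 \<and> Q l \<noteq> 0 \<and> m = k + l" if "convolution P Q m mod int p \<noteq> 0" for m
      proof -
        have "convolution P Q m \<noteq> 0" using that by auto
        then obtain k where k: "k \<subseteq># m" "P k * Q (m - k) \<noteq> 0"
          unfolding convolution_def by (metis (mono_tags, lifting) mem_Collect_eq sum.neutral)
        thus ?thesis by (intro exI[of _ k] exI[of _ "m - k"]) auto
      qed
      have "{m. convolution P Q m mod int p \<noteq> 0} \<subseteq> (\<lambda>(k, l). k + l) ` ({k. P k \<noteq> 0} \<times> {l. Q l \<noteq> 0})"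
      proof
        fix m assume "m \<in> {m. convolution P Q m mod int p \<noteq> 0}"
        then obtain k l where "P k \<noteq> 0" "Q l \<noteq> 0" "m = k + l" using ex by blast
        thus "m \<in> (\<lambda>(k, l). k + l) ` ({k. P k \<noteq> 0} \<times> {l. Q l \<noteq> 0})"
          by (intro image_eqI[of _ _ "(k, l)"]) auto
      qed
      moreover have "finite ((\<lambda>(k, l). k + l) ` ({k. P k \<noteq> 0} \<times> {l. Q l \<noteq> 0}))"
        using P Q by (auto simp: mem_carrier_A_iff)
      ultimately have "finite {m. convolution P Q m mod int p \<noteq> 0}" by (rule finite_subset)
      moreover have "set_mset m \<subseteq> vars" if nz: "convolution P Q m mod int p \<noteq> 0" for m
      proof -
        obtain k l where "P k \<noteq> 0" "Q l \<noteq> 0" "m = k + l" using ex[OF nz] by blast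
        thus ?thesis using P Q unfolding mem_carrier_A_iff by (simp only: set_mset_union Un_subset_iff) blast
      qed
      ultimately show ?thesis using p_pos by (simp add: mem_carrier_A_iff mult_A)
    qed
    show "\<one>\<^bsub>A\<^esub> \<in> carrier A"
      unfolding one_A using prime prime_gt_1_nat by (intro monomial_mem) auto
    show "(P \<otimes>\<^bsub>A\<^esub> Q) \<otimes>\<^bsub>A\<^esub> S = P \<otimes>\<^bsub>A\<^esub> (Q \<otimes>\<^bsub>A\<^esub> S)" for P Q S
      by (simp add: mult_A convolution_mod_left convolution_mod_right convolution_assoc)
    show "\<one>\<^bsub>A\<^esub> \<otimes>\<^bsub>A\<^esub> P = P" if "P \<in> carrier A" for P
      using that by (auto simp: mult_A one_A convolution_monomial mem_carrier_A_iff)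
    show "P \<otimes>\<^bsub>A\<^esub> Q = Q \<otimes>\<^bsub>A\<^esub> P" for P Q
      by (auto simp: mult_A convolution_commute)
  qed
  show "(P \<oplus>\<^bsub>A\<^esub> Q) \<otimes>\<^bsub>A\<^esub> S = P \<otimes>\<^bsub>A\<^esub> S \<oplus>\<^bsub>A\<^esub> Q \<otimes>\<^bsub>A\<^esub> S" for P Q S
    by (simp add: add_A mult_A convolution_mod_left convolution_add_left mod_simps)
qed

end

section \<open>The ideal in truncated form\<close>

context poly_mod_prime
begin

sublocale A: cring A by (rule cring_A)

lemma var_Zp_eq: "var_Zp p i = monomial 1 {#i#}"
proof -
  have "count m i > 0 \<Longrightarrow> m - {#i#} = {#} \<Longrightarrow> m = {#i#}" for m :: "nat multiset"
    by (metis count_greater_zero_iff insert_DiffM)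
  thus ?thesis
    by (auto simp: R.indexed_var_def R.indexed_pmult_def R.indexed_const_def R.res_zero_eq R.res_one_eq
        monomial_def fun_eq_iff)
qed

lemma var_mem: "i \<in> vars \<Longrightarrow> var_Zp p i \<in> carrier A"
  unfolding var_Zp_eq using prime prime_gt_1_nat by (intro monomial_mem) auto

lemma indexed_pmult_eq: "P \<in> carrier A \<Longrightarrow> R.indexed_pmult P i = var_Zp p i \<otimes>\<^bsub>A\<^esub> P"
  by (auto simp: mult_A var_Zp_eq convolution_monomial R.indexed_pmult_def R.res_zero_eq mem_carrier_A_iff fun_eq_iff)

lemma var_pow_eq: "var_Zp p i [^]\<^bsub>A\<^esub> n = monomial 1 (replicate_mset n i)"
proof (induction n)
  case 0
  show ?case by (simp add: one_A)
next
  case (Suc n)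
  have p1: "int p > 1" using prime prime_gt_1_nat by auto
  have *: "convolution (monomial 1 (replicate_mset n i)) (monomial 1 {#i#}) m = monomial 1 (replicate_mset (Suc n) i) m" for m
  proof (cases "replicate_mset n i \<subseteq># m")
    case True
    then obtain c where "m = replicate_mset n i + c" by (auto simp: mset_subset_eq_exists_conv)
    thus ?thesis by (auto simp: convolution_monomial) (auto simp: monomial_def)
  next
    case False
    hence "m \<noteq> replicate_mset (Suc n) i" by auto
    thus ?thesis using False by (simp add: convolution_monomial) (simp add: monomial_def)
  qed
  have "var_Zp p i [^]\<^bsub>A\<^esub> Suc n = monomial 1 (replicate_mset n i) \<otimes>\<^bsub>A\<^esub> var_Zp p i"
    by (simp only: A.nat_pow_Suc Suc)
  also have "\<dots> = (\<lambda>m. monomial 1 (replicate_mset (Suc n) i) m mod int p)"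
    by (simp only: mult_A var_Zp_eq *)
  also have "\<dots> = monomial 1 (replicate_mset (Suc n) i)"
    using p1 by (auto simp: monomial_def)
  finally show ?case .
qed

text \<open>
  The monomials that survive modulo the \<open>q\<close>-th powers of the variables.
\<close>
definition monomial_box :: "nat \<Rightarrow> nat multiset set" where
  "monomial_box q = {m. set_mset m \<subseteq> vars \<and> (\<forall>i. count m i < q)}"

text \<open>
  The exponent vectors are reflected in the cube, so that multiplication by a variable, which raises exponents and
  hence pulls coefficients up from below, becomes the downward shift of \<open>shifts\<close>.
\<close>
definition corner_complement :: "nat \<Rightarrow> (nat \<Rightarrow> nat) \<Rightarrow> nat multiset" where
  "corner_complement q u = (\<Sum>i\<in>vars. replicate_mset (q - 1 - u i) i)"

lemma count_corner_complement: "count (corner_complement q u) j = (if j \<in> vars then q - 1 - u j else 0)"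
proof -
  have "count (corner_complement q u) j = (\<Sum>i\<in>vars. if i = j then q - 1 - u i else 0)"
    unfolding corner_complement_def count_sum by (intro sum.cong refl) auto
  thus ?thesis by simp
qed

lemma bij_betw_corner_complement:
  assumes "q > 0"
  shows "bij_betw (corner_complement q) (box (cube vars q)) (monomial_box q)"
proof (rule bij_betwI[of _ _ _ "\<lambda>m i. if i \<in> vars then q - 1 - count m i else 0"])
  have bnd: "u i < (if i \<in> vars then q else 1)" if "u \<in> box (cube vars q)" for u i
    using that unfolding box_def cube_def by blast
  show "corner_complement q \<in> box (cube vars q) \<rightarrow> monomial_box q"
  proof
    fix u assume "u \<in> box (cube vars q)"
    have "i \<in> vars" if "i \<in># corner_complement q u" for i
    proof -
      have "count (corner_complement q u) i \<noteq> 0" using that by simp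
      thus ?thesis unfolding count_corner_complement by (metis (full_types))
    qed
    thus "corner_complement q u \<in> monomial_box q"
      using assms by (auto simp: monomial_box_def count_corner_complement)
  qed
  show "(\<lambda>m i. if i \<in> vars then q - 1 - count m i else 0) \<in> monomial_box q \<rightarrow> box (cube vars q)"
    using assms by (auto simp: box_def cube_def)
  show "(\<lambda>i. if i \<in> vars then q - 1 - count (corner_complement q u) i else 0) = u"
    if "u \<in> box (cube vars q)" for u
  proof
    fix i show "(if i \<in> vars then q - 1 - count (corner_complement q u) i else 0) = u i"
      using bnd[OF that, of i] by (auto simp: count_corner_complement)
  qed
  show "corner_complement q (\<lambda>i. if i \<in> vars then q - 1 - count m i else 0) = m" if m: "m \<in> monomial_box q" for m
  proof (rule multiset_eqI)
    fix i
    have "count m i < q" "i \<notin> vars \<Longrightarrow> count m i = 0"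
      using m by (auto simp: monomial_box_def count_eq_zero_iff)
    thus "count (corner_complement q (\<lambda>i. if i \<in> vars then q - 1 - count m i else 0)) i = count m i"
      by (auto simp: count_corner_complement)
  qed
qed

lemma finite_monomial_box: "q > 0 \<Longrightarrow> finite (monomial_box q)"
  using bij_betw_finite[OF bij_betw_corner_complement] finite_box[OF sides_cube[of vars]] by auto

lemma monomial_box_diff: "m \<in> monomial_box q \<Longrightarrow> m - k \<in> monomial_box q"
proof -
  assume m: "m \<in> monomial_box q"
  have "count (m - k) i < q" for i using m by (auto simp: monomial_box_def intro: le_less_trans[of _ "count m i"])
  moreover have "set_mset (m - k) \<subseteq> vars" using m by (auto simp: monomial_box_def dest: in_diffD)
  ultimately show ?thesis by (simp add: monomial_box_def)
qed

text \<open>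
  The ring \<open>B\<close> of polynomials modulo the \<open>q\<close>-th powers of the variables, with elements written as coefficient
  functions. The quotient map is \<open>trunc\<close>, and only the action of the variables on \<open>B\<close> is used, in
  the form of \<open>var_mult\<close> and \<open>square_mult\<close>.
\<close>
definition box_poly :: "nat \<Rightarrow> (nat multiset \<Rightarrow> residues_prod) set" where
  "box_poly q = fun_on (monomial_box q) (Zmod p)"

definition trunc :: "nat \<Rightarrow> (nat multiset \<Rightarrow> int) \<Rightarrow> nat multiset \<Rightarrow> residues_prod" where
  "trunc q P = (\<lambda>m. if m \<in> monomial_box q then residue p (P m) else 0)"

definition var_mult :: "nat \<Rightarrow> nat \<Rightarrow> (nat multiset \<Rightarrow> residues_prod) \<Rightarrow> nat multiset \<Rightarrow> residues_prod" where
  "var_mult q i F = (\<lambda>m. if m \<in> monomial_box q \<and> i \<in># m then F (m - {#i#}) else 0)"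

definition square_mult :: "nat \<Rightarrow> (nat multiset \<Rightarrow> residues_prod) \<Rightarrow> nat multiset \<Rightarrow> residues_prod" where
  "square_mult q F = (\<Sum>i\<in>vars. var_mult q i (var_mult q i F))"

lemma box_poly_group: "q > 0 \<Longrightarrow> elementary_group p (box_poly q)"
  unfolding box_poly_def by (intro elementary_group.fun_on_group elementary_group_Zmod prime finite_monomial_box)

lemma trunc_mem: "trunc q P \<in> box_poly q"
  by (auto simp: box_poly_def fun_on_def trunc_def Zmod_def)

lemma trunc_add: "trunc q (P \<oplus>\<^bsub>A\<^esub> Q) = trunc q P + trunc q Q"
  by (auto simp: trunc_def add_A residue_mod residue_add fun_eq_iff)

lemma trunc_zero: "trunc q \<zero>\<^bsub>A\<^esub> = 0"
  by (auto simp: trunc_def zero_A fun_eq_iff)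

lemma trunc_minus:
  assumes "P \<in> carrier A"
  shows "trunc q (\<ominus>\<^bsub>A\<^esub> P) = - trunc q P"
proof -
  have "trunc q P + trunc q (\<ominus>\<^bsub>A\<^esub> P) = 0"
    using assms by (simp flip: trunc_add add: A.r_neg trunc_zero)
  thus ?thesis by (simp add: eq_neg_iff_add_eq_0 add.commute)
qed

lemma trunc_diff:
  assumes "P \<in> carrier A" "Q \<in> carrier A"
  shows "trunc q (P \<ominus>\<^bsub>A\<^esub> Q) = trunc q P - trunc q Q"
  using assms by (simp add: A.minus_eq trunc_add trunc_minus)

lemma trunc_finsum:
  assumes "finite F" "\<And>i. i \<in> F \<Longrightarrow> f i \<in> carrier A"
  shows "trunc q (\<Oplus>\<^bsub>A\<^esub>i\<in>F. f i) = (\<Sum>i\<in>F. trunc q (f i))"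
  using assms
proof (induction F)
  case (insert x F)
  have "(\<Oplus>\<^bsub>A\<^esub>i\<in>insert x F. f i) = f x \<oplus>\<^bsub>A\<^esub> (\<Oplus>\<^bsub>A\<^esub>i\<in>F. f i)"
    using insert by (intro A.finsum_insert) auto
  thus ?case using insert by (simp add: trunc_add)
qed (simp add: trunc_zero)

lemma trunc_var_mult: "trunc q (var_Zp p i \<otimes>\<^bsub>A\<^esub> P) = var_mult q i (trunc q P)"
  by (auto simp: trunc_def var_mult_def mult_A var_Zp_eq convolution_monomial residue_mod fun_eq_iff monomial_box_diff)

lemma trunc_const_mult: "trunc q (monomial c {#} \<otimes>\<^bsub>A\<^esub> P) = of_int c * trunc q P"
  by (auto simp: trunc_def mult_A convolution_monomial residue_mod fun_eq_iff of_int_fun_apply of_int_times_residue)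

lemma trunc_surj:
  assumes "q > 0" "F \<in> box_poly q"
  shows "\<exists>P\<in>carrier A. trunc q P = F"
proof
  have bij: "bij_betw (residue p) {0..<int p} (Zmod p)"
    using prime prime_gt_0_nat by (intro Zmod_bij) auto
  define r where "r = inv_into {0..<int p} (residue p)"
  have r: "residue p (r z) = z" "r z \<in> {0..<int p}" if "z \<in> Zmod p" for z
    using bij that unfolding r_def bij_betw_def by (metis f_inv_into_f, metis inv_into_into)
  define P where "P m = (if m \<in> monomial_box q then r (F m) else 0)" for m
  have F: "F m \<in> Zmod p" "m \<notin> monomial_box q \<Longrightarrow> F m = 0" for m
    using assms(2) zero_mem_Zmod unfolding box_poly_def by (auto intro: fun_on_mem simp: fun_on_def)
  have "{m. P m \<noteq> 0} \<subseteq> monomial_box q" by (auto simp: P_def)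
  hence "finite {m. P m \<noteq> 0}" using finite_monomial_box[OF assms(1)] by (rule finite_subset)
  moreover have "set_mset m \<subseteq> vars" if "P m \<noteq> 0" for m
    using that by (auto simp: P_def monomial_box_def split: if_splits)
  moreover have "0 \<le> P m \<and> P m < int p" for m using r(2)[OF F(1)] p_pos by (auto simp: P_def)
  ultimately show "P \<in> carrier A" unfolding mem_carrier_A_iff by blast
  show "trunc q P = F" using r(1)[OF F(1)] F(2) by (auto simp: trunc_def P_def fun_eq_iff)
qed

lemma var_mult_mem: "F \<in> box_poly q \<Longrightarrow> var_mult q i F \<in> box_poly q"
  using fun_on_mem[OF zero_mem_Zmod, of F "monomial_box q"] zero_mem_Zmod
  by (auto simp: box_poly_def var_mult_def) (auto simp: fun_on_def)

lemma additive_var_mult: "additive (var_mult q i)"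
  unfolding additive_def by (auto simp: var_mult_def fun_eq_iff)

lemma var_mult_commute: "var_mult q i (var_mult q j F) = var_mult q j (var_mult q i F)"
proof
  fix m
  have "i \<in># m \<and> j \<in># m - {#i#} \<longleftrightarrow> j \<in># m \<and> i \<in># m - {#j#}"
    by (cases "i = j") (auto simp: in_diff_count)
  thus "var_mult q i (var_mult q j F) m = var_mult q j (var_mult q i F) m"
    by (auto simp: var_mult_def monomial_box_diff add_mset_commute)
qed

lemma additive_square_mult: "additive (square_mult q)"
  using additive_var_mult unfolding additive_def square_mult_def by (simp add: sum.distrib)

lemma square_mult_mem:
  assumes "q > 0" "F \<in> box_poly q"
  shows "square_mult q F \<in> box_poly q"
  unfolding square_mult_def
  by (intro elementary_group.sum_mem[OF box_poly_group[OF assms(1)]] var_mult_mem assms(2))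

lemma var_mult_square_mult: "var_mult q i (square_mult q F) = square_mult q (var_mult q i F)"
proof -
  interpret additive "var_mult q i" by (rule additive_var_mult)
  show ?thesis unfolding square_mult_def sum
    by (intro sum.cong refl) (metis var_mult_commute)
qed

lemma trunc_square_mult:
  assumes "P \<in> carrier A"
  shows "trunc q (sum_squares p s \<otimes>\<^bsub>A\<^esub> P) = square_mult q (trunc q P)"
proof -
  have "sum_squares p s \<otimes>\<^bsub>A\<^esub> P = (\<Oplus>\<^bsub>A\<^esub>i\<in>vars. var_Zp p i [^]\<^bsub>A\<^esub> (2::nat) \<otimes>\<^bsub>A\<^esub> P)"
    unfolding sum_squares_def using assms var_mem by (intro A.finsum_ldistr) auto
  hence "trunc q (sum_squares p s \<otimes>\<^bsub>A\<^esub> P) = (\<Sum>i\<in>vars. trunc q (var_Zp p i [^]\<^bsub>A\<^esub> (2::nat) \<otimes>\<^bsub>A\<^esub> P))"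
    using assms var_mem by (simp only:) (intro trunc_finsum, auto)
  also have "\<dots> = (\<Sum>i\<in>vars. var_mult q i (var_mult q i (trunc q P)))"
  proof (intro sum.cong refl)
    fix i assume i: "i \<in> vars"
    have "var_Zp p i [^]\<^bsub>A\<^esub> (2::nat) \<otimes>\<^bsub>A\<^esub> P = var_Zp p i \<otimes>\<^bsub>A\<^esub> (var_Zp p i \<otimes>\<^bsub>A\<^esub> P)"
      using var_mem[OF i] assms by (simp add: numeral_2_eq_2 A.m_assoc)
    thus "trunc q (var_Zp p i [^]\<^bsub>A\<^esub> (2::nat) \<otimes>\<^bsub>A\<^esub> P) = var_mult q i (var_mult q i (trunc q P))"
      by (simp add: trunc_var_mult)
  qed
  finally show ?thesis by (simp add: square_mult_def)
qed

lemma sum_squares_mem: "sum_squares p s \<in> carrier A"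
  unfolding sum_squares_def using var_mem by (intro A.finsum_closed) auto

text \<open>
  The \<open>A\<close>-submodules of \<open>B\<close>; closure under constants is automatic over a prime field.
\<close>
definition shift_module :: "nat \<Rightarrow> (nat multiset \<Rightarrow> residues_prod) set \<Rightarrow> bool" where
  "shift_module q M \<longleftrightarrow> M \<subseteq> box_poly q \<and> 0 \<in> M \<and> (\<forall>x\<in>M. \<forall>y\<in>M. x - y \<in> M) \<and>
     (\<forall>i\<in>vars. var_mult q i ` M \<subseteq> M)"

lemma shift_module_group:
  assumes "q > 0" "shift_module q M"
  shows "elementary_group p M"
proof -
  interpret B: elementary_group p "box_poly q" by (rule box_poly_group[OF assms(1)])
  show ?thesis
    using assms(2) B.prime_p B.finite_W B.torsion finite_subset
    unfolding shift_module_def by unfold_locales blast+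
qed

lemma shift_module_var: "shift_module q M \<Longrightarrow> i \<in> vars \<Longrightarrow> x \<in> M \<Longrightarrow> var_mult q i x \<in> M"
  unfolding shift_module_def by blast

lemma trunc_mult_mem:
  assumes q: "q > 0" and M: "shift_module q M" and a: "a \<in> carrier A" and P: "P \<in> carrier A" "trunc q P \<in> M"
  shows "trunc q (a \<otimes>\<^bsub>A\<^esub> P) \<in> M"
proof -
  interpret M: elementary_group p M by (rule shift_module_group[OF q M])
  have mem: "b \<in> carrier A" if "b \<in> R.indexed_pset vars (carrier R)" for b
    using that by (simp add: carrier_A)
  from a have "a \<in> R.indexed_pset vars (carrier R)" by (simp add: carrier_A)
  thus ?thesis
  proof induction
    case (indexed_const k)
    have "R.indexed_const k = monomial k ({#} :: nat multiset)"
      by (auto simp: monomial_def R.indexed_const_def R.res_zero_eq)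
    hence "trunc q (R.indexed_const k \<otimes>\<^bsub>A\<^esub> P) = of_int k * trunc q P"
      by (simp only: trunc_const_mult)
    thus ?case using M.of_int_mem[OF P(2)] by (simp only:)
  next
    case (indexed_padd a b)
    have "R.indexed_padd a b = a \<oplus>\<^bsub>A\<^esub> b" by (simp add: poly_Zp_def mpoly_ring_def)
    hence "trunc q (R.indexed_padd a b \<otimes>\<^bsub>A\<^esub> P) = trunc q (a \<otimes>\<^bsub>A\<^esub> P) + trunc q (b \<otimes>\<^bsub>A\<^esub> P)"
      using mem[OF indexed_padd(1)] mem[OF indexed_padd(2)] P(1) by (simp only: A.l_distr trunc_add)
    thus ?case using M.add_mem[OF indexed_padd(3,4)] by (simp only:)
  next
    case (indexed_pmult a i)
    hence "R.indexed_pmult a i \<otimes>\<^bsub>A\<^esub> P = var_Zp p i \<otimes>\<^bsub>A\<^esub> (a \<otimes>\<^bsub>A\<^esub> P)"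
      using mem P var_mem by (simp add: indexed_pmult_eq A.m_assoc)
    thus ?case using shift_module_var[OF M indexed_pmult(2,3)] by (simp only: trunc_var_mult)
  qed
qed

definition preimage_ideal :: "nat \<Rightarrow> (nat multiset \<Rightarrow> residues_prod) set \<Rightarrow> (nat multiset \<Rightarrow> int) set" where
  "preimage_ideal q M = {P \<in> carrier A. trunc q P \<in> M}"

lemma preimage_ideal_ideal:
  assumes q: "q > 0" and M: "shift_module q M"
  shows "ideal (preimage_ideal q M) A"
proof (rule idealI)
  interpret M: elementary_group p M by (rule shift_module_group[OF q M])
  show "ring A" by (rule A.ring_axioms)
  show "subgroup (preimage_ideal q M) (add_monoid A)"
  proof (rule A.add.subgroupI)
    show "preimage_ideal q M \<noteq> {}"
      using M.zero_mem trunc_zero by (auto simp: preimage_ideal_def)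
  qed (auto simp: preimage_ideal_def trunc_add trunc_minus M.add_mem M.uminus_mem simp flip: a_inv_def)
  show *: "x \<otimes>\<^bsub>A\<^esub> a \<in> preimage_ideal q M" if "a \<in> preimage_ideal q M" "x \<in> carrier A" for a x
    using that trunc_mult_mem[OF q M] by (auto simp: preimage_ideal_def)
  show "a \<otimes>\<^bsub>A\<^esub> x \<in> preimage_ideal q M" if "a \<in> preimage_ideal q M" "x \<in> carrier A" for a x
    using *[OF that] that by (simp add: A.m_comm preimage_ideal_def)
qed

lemma image_shift_module:
  assumes q: "q > 0"
  shows "shift_module q (square_mult q ` box_poly q)"
proof -
  interpret B: elementary_group p "box_poly q" by (rule box_poly_group[OF q])
  interpret additive "square_mult q" by (rule additive_square_mult)
  have "square_mult q x - square_mult q y \<in> square_mult q ` box_poly q" if "x \<in> box_poly q" "y \<in> box_poly q" for x y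
    using B.diff_mem[OF that] by (metis diff imageI)
  moreover have "0 \<in> square_mult q ` box_poly q" using B.zero_mem zero by (metis imageI)
  moreover have "var_mult q i (square_mult q x) \<in> square_mult q ` box_poly q" if "x \<in> box_poly q" for i x
    unfolding var_mult_square_mult using var_mult_mem[OF that] by (rule imageI)
  ultimately show ?thesis using square_mult_mem[OF q] by (auto simp: shift_module_def)
qed

text \<open>
  A polynomial without monomials in the cube is a combination of multiples of \<open>q\<close>-th powers, by induction on its
  support.
\<close>
lemma trunc_zero_mem_ideal:
  assumes q: "q > 0" and K: "ideal K A" and pow: "\<And>i. i \<in> vars \<Longrightarrow> var_Zp p i [^]\<^bsub>A\<^esub> q \<in> K"
    and P: "P \<in> carrier A" "trunc q P = 0"
  shows "P \<in> K"
proof -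
  interpret K: ideal K A by fact
  have main: "finite N \<Longrightarrow> \<forall>P\<in>carrier A. {m. P m \<noteq> 0} = N \<longrightarrow> (\<forall>m\<in>monomial_box q. P m = 0) \<longrightarrow> P \<in> K" for N
  proof (induction N rule: finite_induct)
    case empty
    show ?case
    proof (intro ballI impI)
      fix P :: "nat multiset \<Rightarrow> int" assume "{m. P m \<noteq> 0} = {}"
      hence "P = \<zero>\<^bsub>A\<^esub>" by (auto simp: zero_A)
      thus "P \<in> K" by simp
    qed
  next
    case (insert n N)
    show ?case
    proof (intro ballI impI)
      fix P assume P: "P \<in> carrier A" "{m. P m \<noteq> 0} = insert n N" "\<forall>m\<in>monomial_box q. P m = 0"
      have supp: "{m. (P(n := 0)) m \<noteq> 0} = N" using P(2) insert(2) by auto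
      have cP: "P(n := 0) \<in> carrier A"
        using P(1) insert(1) p_pos unfolding mem_carrier_A_iff supp by auto
      hence 1: "P(n := 0) \<in> K" using insert.IH supp P(3) by auto
      have bound: "0 \<le> P n" "P n < int p" and n: "set_mset n \<subseteq> vars"
        using P(1,2) unfolding mem_carrier_A_iff by blast+
      have "n \<notin> monomial_box q" using P(2,3) by auto
      then obtain i where i: "count n i \<ge> q" using n by (auto simp: monomial_box_def not_less)
      have "i \<in># n" using i q by (simp flip: count_greater_zero_iff)
      hence iv: "i \<in> vars" using n by blast
      have "replicate_mset q i \<subseteq># n" using i by (simp add: count_le_replicate_mset_subset_eq)
      then obtain n' where n': "n = replicate_mset q i + n'" by (auto simp: mset_subset_eq_exists_conv)
      have "var_Zp p i [^]\<^bsub>A\<^esub> q \<otimes>\<^bsub>A\<^esub> monomial (P n) n' = monomial (P n) n"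
      proof
        fix m show "(var_Zp p i [^]\<^bsub>A\<^esub> q \<otimes>\<^bsub>A\<^esub> monomial (P n) n') m = monomial (P n) n m"
        proof (cases "replicate_mset q i \<subseteq># m")
          case True
          then obtain c where "m = replicate_mset q i + c" by (auto simp: mset_subset_eq_exists_conv)
          thus ?thesis using bound by (simp add: var_pow_eq mult_A convolution_monomial) (simp add: monomial_def n')
        next
          case False
          hence "m \<noteq> n" by (auto simp: n')
          thus ?thesis using False by (simp add: var_pow_eq mult_A convolution_monomial) (simp add: monomial_def)
        qed
      qed
      moreover have "monomial (P n) n' \<in> carrier A"
        using n bound by (intro monomial_mem) (auto simp: n')
      ultimately have "monomial (P n) n \<in> K" using K.I_r_closed[OF pow[OF iv]] by metis
      moreover have "P(n := 0) \<oplus>\<^bsub>A\<^esub> monomial (P n) n = P"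
        using P(1) by (auto simp: add_A monomial_def fun_eq_iff mem_carrier_A_iff)
      ultimately show "P \<in> K" using 1 K.a_closed by metis
    qed
  qed
  have zero: "P m = 0" if "m \<in> monomial_box q" for m
  proof -
    have "residue p (P m) = residue p 0" using fun_cong[OF P(2), of m] that by (simp add: trunc_def)
    thus ?thesis using P(1) unfolding residue_eq_iff mem_carrier_A_iff by (metis mod_0 mod_self)
  qed
  have "finite {m. P m \<noteq> 0}" using P(1) by (simp add: mem_carrier_A_iff)
  from main[OF this, rule_format, OF P(1) refl zero] show ?thesis .
qed

text \<open>
  An element whose image lies in \<open>h B\<close> differs from a multiple of \<open>h\<close> by an element of the kernel of
  \<open>trunc\<close>, which \<open>trunc_zero_mem_ideal\<close> places in the ideal of the \<open>q\<close>-th powers.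
\<close>
lemma genideal_eq_preimage:
  assumes q: "q > 0"
  shows "genideal A (insert (sum_squares p s) ((\<lambda>i. var_Zp p i [^]\<^bsub>A\<^esub> q) ` vars)) =
    preimage_ideal q (square_mult q ` box_poly q)" (is "genideal A ?S = ?J")
proof
  interpret B: elementary_group p "box_poly q" by (rule box_poly_group[OF q])
  have sub: "?S \<subseteq> carrier A" using sum_squares_mem var_mem by auto
  have pow0: "trunc q (var_Zp p i [^]\<^bsub>A\<^esub> q) = 0" for i
    by (auto simp: trunc_def var_pow_eq monomial_def fun_eq_iff monomial_box_def)
  have z: "0 \<in> square_mult q ` box_poly q"
    using image_shift_module[OF q] by (simp add: shift_module_def)
  have "trunc q (sum_squares p s) = square_mult q (trunc q \<one>\<^bsub>A\<^esub>)"
    using trunc_square_mult[of "\<one>\<^bsub>A\<^esub>" q] sum_squares_mem by simp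
  hence "trunc q (sum_squares p s) \<in> square_mult q ` box_poly q" using trunc_mem by (metis imageI)
  hence "?S \<subseteq> ?J" using sub pow0 z by (auto simp: preimage_ideal_def)
  thus "genideal A ?S \<subseteq> ?J"
    by (rule A.genideal_minimal[OF preimage_ideal_ideal[OF q image_shift_module[OF q]]])
  have K: "ideal (genideal A ?S) A" by (rule A.genideal_ideal[OF sub])
  interpret K: ideal "genideal A ?S" A by (rule K)
  have gen: "?S \<subseteq> genideal A ?S" by (rule A.genideal_self[OF sub])
  show "?J \<subseteq> genideal A ?S"
  proof
    fix P assume "P \<in> ?J"
    then obtain F where P: "P \<in> carrier A" and F: "F \<in> box_poly q" "trunc q P = square_mult q F"
      by (auto simp: preimage_ideal_def)
    obtain Q where Q: "Q \<in> carrier A" "trunc q Q = F" using trunc_surj[OF q F(1)] by blast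
    define D where "D = sum_squares p s \<otimes>\<^bsub>A\<^esub> Q"
    have "sum_squares p s \<in> genideal A ?S" using gen by blast
    hence D: "D \<in> genideal A ?S" unfolding D_def by (rule K.I_r_closed[OF _ Q(1)])
    have Dc: "D \<in> carrier A" unfolding D_def by (rule A.m_closed[OF sum_squares_mem Q(1)])
    have "trunc q (P \<ominus>\<^bsub>A\<^esub> D) = 0"
    proof -
      have "trunc q D = square_mult q F" unfolding D_def trunc_square_mult[OF Q(1)] Q(2) ..
      thus ?thesis unfolding trunc_diff[OF P Dc] F(2) by (simp only: diff_self)
    qed
    hence "P \<ominus>\<^bsub>A\<^esub> D \<in> genideal A ?S"
    proof (rule trunc_zero_mem_ideal[OF q K _ A.minus_closed[OF P Dc], rotated])
      show "var_Zp p i [^]\<^bsub>A\<^esub> q \<in> genideal A ?S" if "i \<in> vars" for i using gen that by blast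
    qed
    hence "(P \<ominus>\<^bsub>A\<^esub> D) \<oplus>\<^bsub>A\<^esub> D \<in> genideal A ?S" using D by (rule K.a_closed)
    moreover have "(P \<ominus>\<^bsub>A\<^esub> D) \<oplus>\<^bsub>A\<^esub> D = P"
      using P Dc by (simp add: A.minus_eq A.a_assoc A.l_neg)
    ultimately show "P \<in> genideal A ?S" by simp
  qed
qed

section \<open>Colength of the ideal\<close>

lemma carrier_quotient: "carrier (A Quot J) = (\<lambda>a. J +>\<^bsub>A\<^esub> a) ` carrier A"
  by (auto simp: FactRing_def A_RCOSETS_def')

text \<open>
  The quotient by the preimage of \<open>M\<close> is \<open>B / M\<close>.
\<close>
lemma card_quotient:
  assumes q: "q > 0" and M: "shift_module q M"
  shows "card (box_poly q) = card (carrier (A Quot preimage_ideal q M)) * card M"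
    and "finite (carrier (A Quot preimage_ideal q M))"
proof -
  interpret B: elementary_group p "box_poly q" by (rule box_poly_group[OF q])
  define J where "J = preimage_ideal q M"
  interpret J: ideal J A unfolding J_def by (rule preimage_ideal_ideal[OF q M])
  define lift where "lift F = (SOME P. P \<in> carrier A \<and> trunc q P = F)" for F
  have lift: "lift F \<in> carrier A" "trunc q (lift F) = F" if "F \<in> box_poly q" for F
    using someI_ex[of "\<lambda>P. P \<in> carrier A \<and> trunc q P = F"] trunc_surj[OF q that]
    unfolding lift_def by blast+
  define g where "g F = J +>\<^bsub>A\<^esub> lift F" for F
  have coset_eq: "J +>\<^bsub>A\<^esub> a = J +>\<^bsub>A\<^esub> b \<longleftrightarrow> trunc q a - trunc q b \<in> M"
    if "a \<in> carrier A" "b \<in> carrier A" for a b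
  proof -
    have "J +>\<^bsub>A\<^esub> a = J +>\<^bsub>A\<^esub> b \<longleftrightarrow> a \<ominus>\<^bsub>A\<^esub> b \<in> J"
      using A.quotient_eq_iff_same_a_r_cos[OF J.is_ideal that] by (rule sym)
    also have "\<dots> \<longleftrightarrow> trunc q a - trunc q b \<in> M"
      using A.minus_closed[OF that] unfolding J_def preimage_ideal_def mem_Collect_eq trunc_diff[OF that] by blast
    finally show ?thesis .
  qed
  have im: "g ` box_poly q = carrier (A Quot J)"
  proof
    show "g ` box_poly q \<subseteq> carrier (A Quot J)"
      using lift by (auto simp: g_def carrier_quotient)
    show "carrier (A Quot J) \<subseteq> g ` box_poly q"
    proof
      fix C assume "C \<in> carrier (A Quot J)"
      then obtain a where a: "a \<in> carrier A" "C = J +>\<^bsub>A\<^esub> a" by (auto simp: carrier_quotient)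
      have "C = g (trunc q a)"
        using M a lift[OF trunc_mem] unfolding g_def by (subst a(2), subst coset_eq) (auto simp: shift_module_def)
      thus "C \<in> g ` box_poly q" using trunc_mem by blast
    qed
  qed
  have g: "g F = g G \<longleftrightarrow> F - G \<in> M" if "F \<in> box_poly q" "G \<in> box_poly q" for F G
    unfolding g_def coset_eq[OF lift(1)[OF that(1)] lift(1)[OF that(2)]] lift(2)[OF that(1)] lift(2)[OF that(2)] ..
  have "M \<subseteq> box_poly q" using M by (simp add: shift_module_def)
  from B.card_eq_cosets_times_subgroup[OF this g]
  show "card (box_poly q) = card (carrier (A Quot preimage_ideal q M)) * card M"
    unfolding im J_def .
  show "finite (carrier (A Quot preimage_ideal q M))"
    unfolding J_def[symmetric] im[symmetric] by (rule finite_imageI[OF B.finite_W])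
qed

text \<open>
  The variables act nilpotently on \<open>B / M\<close>, so some nonzero class \<open>v\<close> is killed by all of them, and it spans a
  submodule of order \<open>p\<close>. If there were no such \<open>v\<close>, one could keep multiplying an element outside \<open>M\<close> by
  variables and obtain elements outside \<open>M\<close> supported in arbitrarily high degrees.
\<close>
lemma shift_module_extend:
  assumes q: "q > 0" and M: "shift_module q M" and ne: "M \<noteq> box_poly q"
  shows "\<exists>M'. shift_module q M' \<and> M \<subset> M' \<and> card M' \<le> p * card M"
proof -
  interpret B: elementary_group p "box_poly q" by (rule box_poly_group[OF q])
  interpret M: elementary_group p M by (rule shift_module_group[OF q M])
  have sub: "M \<subseteq> box_poly q" and closed: "\<And>i x. i \<in> vars \<Longrightarrow> x \<in> M \<Longrightarrow> var_mult q i x \<in> M"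
    using M shift_module_var[OF M] by (auto simp: shift_module_def)
  have "\<exists>v\<in>box_poly q - M. \<forall>i\<in>vars. var_mult q i v \<in> M"
  proof (rule ccontr)
    assume contra: "\<not> ?thesis"
    have deep: "\<exists>F\<in>box_poly q - M. \<forall>m. F m \<noteq> 0 \<longrightarrow> size m \<ge> d" for d
    proof (induction d)
      case 0
      show ?case using ne sub by auto
    next
      case (Suc d)
      then obtain F where F: "F \<in> box_poly q - M" "\<forall>m. F m \<noteq> 0 \<longrightarrow> size m \<ge> d" by blast
      then obtain i where i: "i \<in> vars" "var_mult q i F \<notin> M" using contra by blast
      have "size m \<ge> Suc d" if nz: "var_mult q i F m \<noteq> 0" for m
      proof -
        have im: "i \<in># m" "F (m - {#i#}) \<noteq> 0" using nz by (auto simp: var_mult_def split: if_splits)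
        hence "d \<le> size (m - {#i#})" using F(2) by blast
        thus ?thesis using size_Suc_Diff1[OF im(1)] by simp
      qed
      thus ?case using i F var_mult_mem by blast
    qed
    define D where "D = Suc (Max (size ` monomial_box q))"
    obtain F where F: "F \<in> box_poly q - M" "\<forall>m. F m \<noteq> 0 \<longrightarrow> size m \<ge> D" using deep by blast
    have "F m = 0" for m
    proof (rule ccontr)
      assume nz: "F m \<noteq> 0"
      hence "m \<in> monomial_box q" using F(1) by (auto simp: box_poly_def fun_on_def)
      hence "size m \<le> Max (size ` monomial_box q)" using finite_monomial_box[OF q] by (intro Max_ge) auto
      thus False using F(2) nz by (auto simp: D_def)
    qed
    hence "F = 0" by (simp add: fun_eq_iff)
    thus False using F(1) M.zero_mem by simp
  qed
  then obtain v where v: "v \<in> box_poly q" "v \<notin> M" "\<And>i. i \<in> vars \<Longrightarrow> var_mult q i v \<in> M" by blast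
  define M' where "M' = {x + of_int c * v |x c. x \<in> M}"
  have M'I: "x + of_int c * v \<in> M'" if "x \<in> M" for x c using that by (auto simp: M'_def)
  have MM': "x \<in> M'" if "x \<in> M" for x using M'I[OF that, of 0] by simp
  have "shift_module q M'"
    unfolding shift_module_def
  proof (intro conjI ballI subsetI)
    show "x \<in> box_poly q" if xM: "x \<in> M'" for x
    proof -
      obtain a c where "x = a + of_int c * v" "a \<in> M" using xM by (auto simp: M'_def)
      thus ?thesis using B.add_mem[OF _ B.of_int_mem[OF v(1)]] sub by blast
    qed
    show "0 \<in> M'" by (rule MM'[OF M.zero_mem])
    show "x - y \<in> M'" if xy: "x \<in> M'" "y \<in> M'" for x y
    proof -
      obtain a b c d where ab: "x = a + of_int c * v" "y = b + of_int d * v" "a \<in> M" "b \<in> M"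
        using xy by (auto simp: M'_def)
      have "x - y = (a - b) + of_int (c - d) * v"
        unfolding ab(1,2) of_int_diff left_diff_distrib by (rule add_diff_add)
      thus ?thesis using M'I[OF M.diff_mem[OF ab(3,4)]] by (simp only:)
    qed
    show "z \<in> M'" if i: "i \<in> vars" and z: "z \<in> var_mult q i ` M'" for i z
    proof -
      obtain x c where x: "x \<in> M" "z = var_mult q i (x + of_int c * v)" using z by (auto simp: M'_def)
      have "z = var_mult q i x + of_int c * var_mult q i v"
        unfolding x(2) additive.add[OF additive_var_mult] additive_of_int[OF additive_var_mult] ..
      thus ?thesis using MM'[OF M.add_mem[OF closed[OF i x(1)] M.of_int_mem[OF v(3)[OF i]]]] by (simp only:)
    qed
  qed
  moreover have "M \<subset> M'"
  proof -
    have "v \<in> M'" using M'I[OF M.zero_mem, of 1] by simp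
    thus ?thesis using MM' v(2) by auto
  qed
  moreover have "card M' \<le> p * card M"
  proof -
    have "M' \<subseteq> (\<lambda>(x, c). x + of_nat c * v) ` (M \<times> {..<p})"
    proof
      fix z assume "z \<in> M'"
      then obtain x c where z: "x \<in> M" "z = x + of_int c * v" by (auto simp: M'_def)
      have "of_int c * v = of_int (int p * (c div int p) + c mod int p) * v" by simp
      also have "\<dots> = of_int (c div int p) * (of_nat p * v) + of_int (c mod int p) * v"
        by (simp only: of_int_add of_int_mult of_int_of_nat_eq distrib_left distrib_right mult_ac)
      also have "of_int (c mod int p) = (of_nat (nat (c mod int p)) :: nat multiset \<Rightarrow> residues_prod)"
        using p_pos by simp
      finally have "of_int c * v = of_nat (nat (c mod int p)) * v"
        by (simp only: B.torsion[OF v(1)] mult_zero_right add_0_left)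
      hence "z = x + of_nat (nat (c mod int p)) * v" using z(2) by (simp only:)
      moreover have "nat (c mod int p) < p" using p_pos by (simp add: nat_less_iff)
      ultimately show "z \<in> (\<lambda>(x, c). x + of_nat c * v) ` (M \<times> {..<p})"
        using z(1) by (intro image_eqI[of _ _ "(x, nat (c mod int p))"]) auto
    qed
    hence "card M' \<le> card ((\<lambda>(x, c). x + of_nat c * v) ` (M \<times> {..<p}))"
      using M.finite_W by (intro card_mono) auto
    also have "\<dots> \<le> card (M \<times> {..<p})" using M.finite_W by (intro card_image_le) auto
    finally show ?thesis by (simp add: card_cartesian_product mult.commute)
  qed
  ultimately show ?thesis by blast
qed

text \<open>
  The quotient as a module and the quotient as a ring have different record types but the same additive structure.
\<close>
lemma subgroup_quot_module:
  "subgroup C (add_monoid (quot_module A J)) \<longleftrightarrow> subgroup C (add_monoid (A Quot J))"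
  by (simp add: subgroup_def m_inv_def quot_module_def)

text \<open>
  The quotient is \<open>B / h B\<close>, whose order \<open>p^e\<close> equals that of the kernel of \<open>h\<close> on \<open>B\<close> by rank and nullity. In a strictly
  increasing chain of submodules the orders are increasing powers of \<open>p\<close>, by Lagrange's theorem, so at most \<open>e\<close> steps
  are possible. Starting at \<open>h B\<close> and enlarging the submodule by \<open>shift_module_extend\<close>, which multiplies the order by at
  most \<open>p\<close>, at least \<open>e\<close> steps are made before \<open>B\<close> is reached.
\<close>
theorem colength_eq:
  assumes q: "q > 0"
  shows "\<exists>e. colength A (genideal A (insert (sum_squares p s) ((\<lambda>i. var_Zp p i [^]\<^bsub>A\<^esub> q) ` vars))) = enat e \<and>
    p ^ e = card {F \<in> box_poly q. square_mult q F = 0}"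
proof -
  define HB where "HB = square_mult q ` box_poly q"
  define J where "J = preimage_ideal q HB"
  have p1: "p > 1" using prime prime_gt_1_nat by simp
  have HB: "shift_module q HB" unfolding HB_def by (rule image_shift_module[OF q])
  interpret B: elementary_group p "box_poly q" by (rule box_poly_group[OF q])
  interpret HB: elementary_group p HB by (rule shift_module_group[OF q HB])
  interpret J: ideal J A unfolding J_def by (rule preimage_ideal_ideal[OF q HB])
  interpret Q: ring "A Quot J" by (rule J.quotient_is_ring)
  define N where "N = card (carrier (A Quot J))"
  have finQ: "finite (carrier (A Quot J))" unfolding J_def by (rule card_quotient(2)[OF q HB])
  have NB: "card (box_poly q) = N * card HB" unfolding N_def J_def by (rule card_quotient(1)[OF q HB])
  have NK: "N = card {F \<in> box_poly q. square_mult q F = 0}"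
    using B.card_eq_kernel_times_image[OF additive_square_mult[of q]] NB HB.card_pos
    unfolding HB_def[symmetric] by simp
  have "card (box_poly q) = p ^ card (monomial_box q)"
    using finite_monomial_box[OF q] p1 by (simp add: box_poly_def card_fun_on card_Zmod)
  hence "N dvd p ^ card (monomial_box q)" using NB by (metis dvd_triv_left)
  then obtain e where e: "N = p ^ e" using divides_primepow_nat[OF prime] by blast
  define S where "S = {enat n |n. \<exists>N :: nat \<Rightarrow> (nat multiset \<Rightarrow> int) set set.
      (\<forall>i\<le>n. submodule (N i) A (quot_module A J)) \<and> (\<forall>i<n. N i \<subset> N (Suc i))}"
  have upper: "n \<le> e" if N: "\<forall>i\<le>n. submodule (N i) A (quot_module A J)" "\<forall>i<n. N i \<subset> N (Suc i)" for n N
  proof -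
    have sub: "subgroup (N i) (add_monoid (A Quot J))" if "i \<le> n" for i
      using N(1) that unfolding submodule_def by (simp only: subgroup_quot_module)
    have "\<exists>k. card (N i) = p ^ k" if "i \<le> n" for i
    proof -
      have "card (rcosets\<^bsub>add_monoid (A Quot J)\<^esub> N i) * card (N i) = Coset.order (add_monoid (A Quot J))"
        by (rule Q.add.lagrange[OF sub[OF that]])
      moreover have "Coset.order (add_monoid (A Quot J)) = p ^ e" by (simp add: Coset.order_def flip: e N_def)
      ultimately have "card (N i) dvd p ^ e" by (metis dvd_triv_right)
      thus ?thesis using divides_primepow_nat[OF prime] by blast
    qed
    hence "\<forall>i. \<exists>k. i \<le> n \<longrightarrow> card (N i) = p ^ k" by blast
    then obtain k where k: "\<And>i. i \<le> n \<Longrightarrow> card (N i) = p ^ k i" by metis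
    have subset: "N i \<subseteq> carrier (A Quot J)" if "i \<le> n" for i
      using subgroup.subset[OF sub[OF that]] by simp
    have "k i < k (Suc i)" if "i < n" for i
    proof -
      have "card (N i) < card (N (Suc i))"
        using N(2) that subset[of "Suc i"] finQ by (intro psubset_card_mono) (auto intro: finite_subset)
      thus ?thesis using k that p1 by simp
    qed
    hence "i \<le> n \<Longrightarrow> i \<le> k i" for i
    proof (induction i)
      case (Suc i)
      have "i \<le> k i" "k i < k (Suc i)" using Suc by auto
      thus ?case by simp
    qed simp
    hence "n \<le> k n" by simp
    moreover have "p ^ k n \<le> p ^ e"
      unfolding k[OF order.refl, symmetric] e[symmetric] N_def by (intro card_mono finQ subset) simp
    ultimately show ?thesis using p1 by simp
  qed
  have "\<exists>Y. (\<forall>i\<le>j. shift_module q (Y i) \<and> card (Y i) \<le> p ^ i * card HB \<and> HB \<subseteq> Y i) \<and> (\<forall>i<j. Y i \<subset> Y (Suc i))"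
    if "j \<le> e" for j
    using that
  proof (induction j)
    case 0
    show ?case using HB by (intro exI[of _ "\<lambda>_. HB"]) auto
  next
    case (Suc j)
    then obtain Y where Y: "\<forall>i\<le>j. shift_module q (Y i) \<and> card (Y i) \<le> p ^ i * card HB \<and> HB \<subseteq> Y i"
      "\<forall>i<j. Y i \<subset> Y (Suc i)" by auto
    have "card (Y j) \<le> p ^ j * card HB" using Y(1) by blast
    also have "\<dots> < p ^ e * card HB" using Suc.prems p1 HB.card_pos by simp
    finally have "Y j \<noteq> box_poly q" using NB e by auto
    moreover have "shift_module q (Y j)" using Y(1) by blast
    ultimately obtain M where M: "shift_module q M" "Y j \<subset> M" "card M \<le> p * card (Y j)"
      using shift_module_extend[OF q, of "Y j"] by metis
    have "card M \<le> p * (p ^ j * card HB)" using M(3) Y(1) by (meson le_trans mult_le_mono2 order.refl)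
    hence "card M \<le> p ^ Suc j * card HB" by (simp add: mult.assoc)
    moreover have "HB \<subseteq> M" using Y(1) M(2) by blast
    ultimately show ?case using Y M
      by (intro exI[of _ "Y(Suc j := M)"]) (auto simp: le_Suc_eq less_Suc_eq)
  qed
  from this[OF order.refl] obtain Y where
    Y: "\<And>i. i \<le> e \<Longrightarrow> shift_module q (Y i)" "\<And>i. i \<le> e \<Longrightarrow> HB \<subseteq> Y i" "\<And>i. i < e \<Longrightarrow> Y i \<subset> Y (Suc i)"
    by blast
  define C where "C i = {J +>\<^bsub>A\<^esub> P |P. P \<in> preimage_ideal q (Y i)}" for i
  have C_iff: "J +>\<^bsub>A\<^esub> P \<in> C i \<longleftrightarrow> trunc q P \<in> Y i" if P: "P \<in> carrier A" and i: "i \<le> e" for P i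
  proof
    interpret Y: elementary_group p "Y i" by (rule shift_module_group[OF q Y(1)[OF i]])
    assume "J +>\<^bsub>A\<^esub> P \<in> C i"
    then obtain P' where P': "P' \<in> carrier A" "trunc q P' \<in> Y i" "J +>\<^bsub>A\<^esub> P = J +>\<^bsub>A\<^esub> P'"
      by (auto simp: C_def preimage_ideal_def)
    have "P \<ominus>\<^bsub>A\<^esub> P' \<in> J"
      by (rule iffD2[OF A.quotient_eq_iff_same_a_r_cos[OF J.is_ideal P P'(1)] P'(3)])
    hence "trunc q (P \<ominus>\<^bsub>A\<^esub> P') \<in> HB" unfolding J_def preimage_ideal_def by blast
    hence "trunc q P - trunc q P' \<in> Y i"
      using Y(2)[OF i] unfolding trunc_diff[OF P P'(1)] by blast
    from Y.add_mem[OF this P'(2)] show "trunc q P \<in> Y i" by (simp only: diff_add_cancel)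
  next
    assume "trunc q P \<in> Y i"
    thus "J +>\<^bsub>A\<^esub> P \<in> C i" using P unfolding C_def preimage_ideal_def by blast
  qed
  have sub: "submodule (C i) A (quot_module A J)" if i: "i \<le> e" for i
  proof -
    interpret I: ideal "preimage_ideal q (Y i)" A by (rule preimage_ideal_ideal[OF q Y(1)[OF i]])
    have hom: "J +>\<^bsub>A\<^esub> (x \<oplus>\<^bsub>A\<^esub> y) = (J +>\<^bsub>A\<^esub> x) \<oplus>\<^bsub>A Quot J\<^esub> (J +>\<^bsub>A\<^esub> y)"
      if "x \<in> carrier A" "y \<in> carrier A" for x y
      using that by (simp add: FactRing_def J.a_rcos_sum)
    show ?thesis
    proof (rule submodule.intro)
      have "subgroup (C i) (add_monoid (A Quot J))"
      proof (rule Q.add.subgroupI)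
        show "C i \<subseteq> carrier (A Quot J)" using I.a_subset by (auto simp: C_def carrier_quotient)
        show "C i \<noteq> {}" unfolding C_def
          using additive_subgroup.zero_closed[OF I.additive_subgroup_axioms] by blast
        show "x \<oplus>\<^bsub>A Quot J\<^esub> y \<in> C i" if xy: "x \<in> C i" "y \<in> C i" for x y
        proof -
          obtain P P' where P: "P \<in> preimage_ideal q (Y i)" "x = J +>\<^bsub>A\<^esub> P"
            "P' \<in> preimage_ideal q (Y i)" "y = J +>\<^bsub>A\<^esub> P'" using xy by (auto simp: C_def)
          have "x \<oplus>\<^bsub>A Quot J\<^esub> y = J +>\<^bsub>A\<^esub> (P \<oplus>\<^bsub>A\<^esub> P')"
            unfolding P(2,4) using hom[OF I.Icarr[OF P(1)] I.Icarr[OF P(3)]] by simp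
          thus ?thesis using I.a_closed[OF P(1,3)] by (auto simp: C_def)
        qed
        show "\<ominus>\<^bsub>A Quot J\<^esub> x \<in> C i" if x: "x \<in> C i" for x
        proof -
          obtain P where P: "P \<in> preimage_ideal q (Y i)" "x = J +>\<^bsub>A\<^esub> P" using x by (auto simp: C_def)
          have Pc: "P \<in> carrier A" using P(1) by (rule I.Icarr)
          have "(J +>\<^bsub>A\<^esub> (\<ominus>\<^bsub>A\<^esub> P)) \<oplus>\<^bsub>A Quot J\<^esub> x = J +>\<^bsub>A\<^esub> \<zero>\<^bsub>A\<^esub>"
            unfolding P(2) using Pc by (simp flip: hom add: A.l_neg)
          also have "\<dots> = \<zero>\<^bsub>A Quot J\<^esub>"
            using J.a_rcos_const[OF additive_subgroup.zero_closed[OF J.additive_subgroup_axioms]] by (simp add: FactRing_def)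
          finally have "(J +>\<^bsub>A\<^esub> (\<ominus>\<^bsub>A\<^esub> P)) \<oplus>\<^bsub>A Quot J\<^esub> x = \<zero>\<^bsub>A Quot J\<^esub>" .
          hence "\<ominus>\<^bsub>A Quot J\<^esub> x = J +>\<^bsub>A\<^esub> (\<ominus>\<^bsub>A\<^esub> P)"
            using Pc P(2) by (intro Q.minus_equality) (auto simp: carrier_quotient)
          moreover have "\<ominus>\<^bsub>A\<^esub> P \<in> preimage_ideal q (Y i)" using P(1) by (rule I.a_inv_closed)
          ultimately show ?thesis by (auto simp: C_def)
        qed
      qed
      thus "subgroup (C i) (add_monoid (quot_module A J))" by (simp only: subgroup_quot_module)
      show "submodule_axioms (C i) A (quot_module A J)"
      proof
        fix a x assume ax: "a \<in> carrier A" "x \<in> C i"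
        then obtain P where P: "P \<in> preimage_ideal q (Y i)" "x = J +>\<^bsub>A\<^esub> P" by (auto simp: C_def)
        have "a \<odot>\<^bsub>quot_module A J\<^esub> x = J +>\<^bsub>A\<^esub> (a \<otimes>\<^bsub>A\<^esub> P)"
          using ax(1) I.Icarr[OF P(1)] by (simp add: quot_module_def FactRing_def P(2) J.rcoset_mult_add)
        thus "a \<odot>\<^bsub>quot_module A J\<^esub> x \<in> C i"
          using I.I_l_closed[OF P(1) ax(1)] by (auto simp: C_def)
      qed
    qed
  qed
  have strict: "C i \<subset> C (Suc i)" if i: "i < e" for i
  proof -
    have "C i \<subseteq> C (Suc i)" using Y(3)[OF i] by (auto simp: C_def preimage_ideal_def)
    moreover obtain F where F: "F \<in> Y (Suc i)" "F \<notin> Y i" using Y(3)[OF i] by blast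
    have "F \<in> box_poly q" using F(1) Y(1)[of "Suc i"] i by (auto simp: shift_module_def)
    then obtain P where P: "P \<in> carrier A" "trunc q P = F" using trunc_surj[OF q] by blast
    have "J +>\<^bsub>A\<^esub> P \<in> C (Suc i)" "J +>\<^bsub>A\<^esub> P \<notin> C i" using C_iff[OF P(1)] F P(2) i by auto
    ultimately show ?thesis by blast
  qed
  have "enat e \<in> S" unfolding S_def using sub strict by blast
  moreover have "x \<le> enat e" if "x \<in> S" for x using that upper by (auto simp: S_def)
  ultimately have "Sup S = enat e" by (intro antisym Sup_least Sup_upper)
  hence "colength A J = enat e" unfolding colength_def module_length_def S_def .
  thus ?thesis
    unfolding genideal_eq_preimage[OF q] J_def HB_def using e NK by metis
qed

lemma card_kernel_square_mult:
  assumes q: "q > 0"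
  shows "card {F \<in> box_poly q. square_mult q F = 0} = card {F \<in> box_fun p (cube vars q). shifts 2 vars F = 0}"
proof -
  interpret B: elementary_group p "box_poly q" by (rule box_poly_group[OF q])
  define bx where "bx = box (cube vars q)"
  define \<Psi> where "\<Psi> F = (\<lambda>u. if u \<in> bx then F (corner_complement q u) else 0)"
    for F :: "nat multiset \<Rightarrow> residues_prod"
  note cc = bij_betw_corner_complement[OF q, folded bx_def]
  have ccm: "corner_complement q u \<in> monomial_box q" if "u \<in> bx" for u using cc that by (auto simp: bij_betw_def)
  define ci where "ci = inv_into bx (corner_complement q)"
  have ci1: "ci m \<in> bx" "corner_complement q (ci m) = m" if "m \<in> monomial_box q" for m
    using cc that unfolding ci_def bij_betw_def by (metis inv_into_into, metis f_inv_into_f)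
  have ci2: "ci (corner_complement q u) = u" if "u \<in> bx" for u
    using cc that unfolding ci_def by (metis bij_betw_inv_into_left)
  have bij: "bij_betw \<Psi> (box_poly q) (box_fun p (cube vars q))"
  proof (rule bij_betwI[of _ _ _ "\<lambda>G m. if m \<in> monomial_box q then G (ci m) else 0"])
    show "\<Psi> \<in> box_poly q \<rightarrow> box_fun p (cube vars q)"
      using ccm by (auto simp: \<Psi>_def box_poly_def box_fun_def fun_on_def bx_def)
    show "(\<lambda>G m. if m \<in> monomial_box q then G (ci m) else 0) \<in> box_fun p (cube vars q) \<rightarrow> box_poly q"
      using ci1 by (auto simp: box_poly_def box_fun_def fun_on_def bx_def)
    show "(\<lambda>m. if m \<in> monomial_box q then \<Psi> F (ci m) else 0) = F" if "F \<in> box_poly q" for F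
      using that ci1 by (auto simp: \<Psi>_def box_poly_def fun_on_def fun_eq_iff)
    show "\<Psi> (\<lambda>m. if m \<in> monomial_box q then G (ci m) else 0) = G" if "G \<in> box_fun p (cube vars q)" for G
    proof
      fix u show "\<Psi> (\<lambda>m. if m \<in> monomial_box q then G (ci m) else 0) u = G u"
        using that by (cases "u \<in> bx") (simp_all add: \<Psi>_def ccm ci2, simp add: box_fun_def fun_on_def bx_def)
    qed
  qed
  have "\<Psi> (square_mult q F) = shifts 2 vars (\<Psi> F)" for F
  proof
    fix u
    show "\<Psi> (square_mult q F) u = shifts 2 vars (\<Psi> F) u"
    proof (cases "u \<in> bx")
      case False
      have "u(i := u i + 2) \<notin> bx" for i
      proof
        assume *: "u(i := u i + 2) \<in> bx"
        have "u j < cube vars q j" for j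
        proof -
          have "(u(i := u i + 2)) j < cube vars q j" using * unfolding bx_def box_def by blast
          thus ?thesis by (cases "j = i") auto
        qed
        thus False using False by (simp add: bx_def box_def)
      qed
      thus ?thesis using False by (simp add: \<Psi>_def shifts_def)
    next
      case True
      have lt: "u i < q" if "i \<in> vars" for i
      proof -
        have "u i < cube vars q i" using True unfolding bx_def box_def by blast
        thus ?thesis using that by (simp add: cube_def)
      qed
      define m where "m = corner_complement q u"
      have m: "m \<in> monomial_box q" unfolding m_def by (rule ccm[OF True])
      have sq: "var_mult q i (var_mult q i F) m = \<Psi> F (u(i := u i + 2))" if i: "i \<in> vars" for i
      proof -
        have cm: "count m i = q - 1 - u i" using i by (simp add: m_def count_corner_complement)
        show ?thesis
        proof (cases "u i + 2 < q")
          case True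
          have "(u(i := u i + 2)) j < cube vars q j" for j
          proof (cases "j = i")
            case False
            thus ?thesis using \<open>u \<in> bx\<close> by (simp add: bx_def box_def)
          qed (use True i in \<open>simp add: cube_def\<close>)
          hence u2: "u(i := u i + 2) \<in> bx" by (simp add: bx_def box_def)
          have "i \<in># m" "i \<in># m - {#i#}"
            using True cm by (auto simp: in_diff_count simp flip: count_greater_zero_iff)
          moreover have "m - {#i#} - {#i#} = corner_complement q (u(i := u i + 2))"
            by (rule multiset_eqI) (auto simp: m_def count_corner_complement)
          ultimately show ?thesis
            using m u2 by (simp only: var_mult_def \<Psi>_def monomial_box_diff if_True simp_thms)
        next
          case False
          have "u(i := u i + 2) \<notin> bx"
          proof
            assume "u(i := u i + 2) \<in> bx"
            hence "(u(i := u i + 2)) i < cube vars q i" unfolding bx_def box_def by blast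
            thus False using False i by (simp add: cube_def)
          qed
          moreover have "\<not> (i \<in># m \<and> i \<in># m - {#i#})"
            using False cm by (auto simp: in_diff_count)
          ultimately show ?thesis by (auto simp: var_mult_def \<Psi>_def)
        qed
      qed
      have "\<Psi> (square_mult q F) u = square_mult q F m" using True by (simp only: \<Psi>_def if_True m_def)
      also have "\<dots> = (\<Sum>i\<in>vars. var_mult q i (var_mult q i F) m)"
        by (simp only: square_mult_def sum_fun_apply)
      also have "\<dots> = (\<Sum>i\<in>vars. \<Psi> F (u(i := u i + 2)))" by (intro sum.cong refl sq)
      finally show ?thesis by (simp only: shifts_def)
    qed
  qed
  moreover have "square_mult q ` box_poly q \<subseteq> box_poly q" using square_mult_mem[OF q] by blast
  moreover have "\<Psi> 0 = 0" by (auto simp: \<Psi>_def fun_eq_iff)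
  ultimately show ?thesis
    using card_kernel_transfer[OF bij, of "square_mult q" "shifts 2 vars" 1] B.zero_mem by simp
qed

theorem hk_fun_eq_square_ker_dim:
  "real (the_enat (hk_fun p s (sum_squares p s) n)) = square_ker_dim p vars (p ^ n)"
proof -
  have q: "p ^ n > 0" using prime prime_gt_0_nat by simp
  obtain e where e: "hk_fun p s (sum_squares p s) n = enat e"
    "p ^ e = card {F \<in> box_poly (p ^ n). square_mult (p ^ n) F = 0}"
    using colength_eq[OF q] unfolding hk_fun_def by blast
  have "square_ker_dim p vars (p ^ n) = log p (real (p ^ e))"
    unfolding square_ker_dim_def card_kernel_square_mult[OF q, symmetric] e(2) ..
  also have "\<dots> = real e" using prime_gt_1_real[OF prime] by (simp add: log_nat_power)
  finally show ?thesis by (simp add: e(1))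
qed

end

section \<open>The limit of the multiplicities\<close>

theorem theorem3p8:
  fixes s :: nat
  assumes "s \<ge> 2"
  shows "((\<lambda>p. hk_multiplicity p s (sum_squares p s))
            \<longlongrightarrow> 1 + fps_nth sec_plus_tan (s - 1))
         (inf at_top (principal {p :: nat. Factorial_Ring.prime p}))"
proof -
  define l where "l = 1 + fps_nth sec_plus_tan (s - 1)"
  obtain C where C: "\<And>p. Factorial_Ring.prime p \<Longrightarrow> odd p \<Longrightarrow>
    \<exists>\<mu>. (\<lambda>n. square_ker_dim p {1..s} (p ^ n) / real (p ^ n) ^ (s - 1)) \<longlonglongrightarrow> \<mu> \<and> \<bar>\<mu> - l\<bar> \<le> C / real p"
    using square_ker_dim_limit_sec_tan[OF assms] unfolding l_def by blast
  have bound: "norm (hk_multiplicity p s (sum_squares p s) - l) \<le> norm (C / real p) * 1"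
    if p: "Factorial_Ring.prime p" "p \<ge> 3" for p
  proof -
    interpret poly_mod_prime p s by unfold_locales (rule p(1))
    have "odd p" using p prime_odd_nat[of p] by simp
    then obtain \<mu> where \<mu>: "(\<lambda>n. square_ker_dim p {1..s} (p ^ n) / real (p ^ n) ^ (s - 1)) \<longlonglongrightarrow> \<mu>"
      "\<bar>\<mu> - l\<bar> \<le> C / real p" using C p(1) by blast
    have "hk_multiplicity p s (sum_squares p s) = \<mu>"
      unfolding hk_multiplicity_def hk_fun_eq_square_ker_dim by (rule limI[OF \<mu>(1)])
    moreover have "\<bar>\<mu> - l\<bar> \<le> \<bar>C / real p\<bar>" using \<mu>(2) abs_ge_self by (rule order.trans)
    ultimately show ?thesis by (simp only: real_norm_def mult_1_right)
  qed
  have "((\<lambda>p. hk_multiplicity p s (sum_squares p s) - l) \<longlongrightarrow> 0)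
         (inf at_top (principal {p :: nat. Factorial_Ring.prime p}))"
  proof (rule tendsto_0_le)
    have "((\<lambda>p. C / real p) \<longlongrightarrow> 0) at_top"
      by (intro tendsto_divide_0[OF tendsto_const] filterlim_real_sequentially filterlim_at_top_imp_at_infinity)
    thus "((\<lambda>p. C / real p) \<longlongrightarrow> 0) (inf at_top (principal {p :: nat. Factorial_Ring.prime p}))"
      by (rule tendsto_mono[OF inf_le1])
    show "\<forall>\<^sub>F p in inf at_top (principal {p :: nat. Factorial_Ring.prime p}).
        norm (hk_multiplicity p s (sum_squares p s) - l) \<le> norm (C / real p) * 1"
      unfolding eventually_inf_principal
      by (rule eventually_mono[OF eventually_ge_at_top[of 3]]) (use bound in blast)
  qed
  thus ?thesis unfolding l_def by (subst (asm) LIM_zero_iff) simp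
qed

end
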